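(* Let $r\ge1$, let $n_1,\dots,n_r$ be non-negative integers, and let $a,b,x_1,\dots,x_r$ be generic nonzero complex parameters. Then $$\sum_{\substack{0\le k_i\le n_i\\ i=1,\dots,r}}\frac{\Delta(\mathbf xq^{2\mathbf k};p)}{\Delta(\mathbf x;p)}q^{|\mathbf k|-e_2(\mathbf k)}\prod_{1\le i<j\le r}\frac1{(x_ix_j;q^2,p)_{k_i+k_j}}$$ $$\times\prod_{i=1}^r\left(\frac{\theta(ax_iq^{2k_i+|\mathbf k|};p)}{\theta(ax_i;p)}\frac{(ax_i;q,p)_{|\mathbf k|}\,(aq/x_i;q,p)_{|\mathbf k|-k_i}}{(ax_iq^{2n_i+1},aq^{1-2n_i}/x_i;q,p)_{|\mathbf k|}\,(q^{k_i-|\mathbf k|}x_i/a;q,p)_{k_i}}\right)$$ $$\times\frac{(a^2q;q^2,p)_{|\mathbf k|}\,(b,q/b;q,p)_{|\mathbf k|}}{\prod_{i=1}^r(abx_iq,ax_iq^2/b;q^2,p)_{k_i}}\prod_{i,j=1}^r\frac{(q^{-2n_j}x_i/x_j,x_ix_jq^{2n_j};q^2,p)_{k_i}}{(q^2x_i/x_j;q^2,p)_{k_i}}$$ $$=\prod_{i=1}^r\frac{(ax_iq;q,p)_{2n_i}\,(x_iq/ab,bx_i/a;q^2,p)_{n_i}}{(x_i/a;q,p)_{2n_i}\,(abx_iq,ax_iq^2/b;q^2,p)_{n_i}}.$$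
   Context: $p,q$ are complex numbers with $|p|<1$, $q\ne0$, and $q^k\notin p^{\mathbb Z}$ for all integers $k>0$ (if $p=0$: $q^k\ne1$). For $x\ne0$, $\theta(x;p)=\prod_{j=0}^\infty(1-p^jx)(1-p^{j+1}/x)$. Elliptic shifted factorials: $(a;q,p)_k=\prod_{j=0}^{k-1}\theta(aq^j;p)$ for $k\in\mathbb Z_{\ge0}$ (similarly with base $q^2$), and $(a_1,\dots,a_m;q,p)_k=(a_1;q,p)_k\cdots(a_m;q,p)_k$. For $\mathbf k=(k_1,\dots,k_r)$, $|\mathbf k|=k_1+\cdots+k_r$ and $e_2(\mathbf k)=\sum_{1\le i<j\le r}k_ik_j$. For $\mathbf x=(x_1,\dots,x_r)$, $\Delta(\mathbf x;p)=\prod_{1\le i<j\le r}x_j\theta(x_i/x_j;p)$, and $\mathbf xq^{2\mathbf k}=(x_1q^{2k_1},\dots,x_rq^{2k_r})$. In expressions such as $x_iq/ab$, everything after the slash is in the denominator. All parameters are assumed generic so that no denominator vanishes. *)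

theory Defs
  imports "HOL-Analysis.Analysis"
begin

text \<open>
  An \<open>r\<close>-tuple is a function on \<open>nat\<close> of which only the values at \<open>1, \<dots>, r\<close> are used.
\<close>

definition theta :: "complex \<Rightarrow> complex \<Rightarrow> complex" where
  "theta x p = (\<Prod>j. (1 - p ^ j * x) * (1 - p ^ (j + 1) / x))"

text \<open>
  \<open>ell_fac [a\<^sub>1, \<dots>, a\<^sub>m] q p k\<close> is \<open>(a\<^sub>1, \<dots>, a\<^sub>m; q, p)\<^sub>k\<close>.
\<close>

definition ell_fac :: "complex list \<Rightarrow> complex \<Rightarrow> complex \<Rightarrow> nat \<Rightarrow> complex" where
  "ell_fac as q p k = (\<Prod>a\<leftarrow>as. \<Prod>j<k. theta (a * q ^ j) p)"

definition vsize :: "nat \<Rightarrow> (nat \<Rightarrow> nat) \<Rightarrow> nat" where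
  "vsize r k = (\<Sum>i=1..r. k i)"

definition e2 :: "nat \<Rightarrow> (nat \<Rightarrow> nat) \<Rightarrow> nat" where
  "e2 r k = (\<Sum>i=1..r. \<Sum>j=i+1..r. k i * k j)"

definition Delta :: "nat \<Rightarrow> (nat \<Rightarrow> complex) \<Rightarrow> complex \<Rightarrow> complex" where
  "Delta r x p = (\<Prod>i=1..r. \<Prod>j=i+1..r. x j * theta (x i / x j) p)"

text \<open>
  The multi-indices \<open>k\<close> with \<open>0 \<le> k\<^sub>i \<le> n\<^sub>i\<close>. The extensional function space makes each
  tuple occur exactly once, so that sums over this set are sums over tuples.
\<close>

definition mbox :: "nat \<Rightarrow> (nat \<Rightarrow> nat) \<Rightarrow> (nat \<Rightarrow> nat) set" where
  "mbox r n = (\<Pi>\<^sub>E i\<in>{1..r}. {0..n i})"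

end

theory Submission
  imports Defs
begin

text \<open>
  Up to the factors \<open>(abx\<^sub>iq, ax\<^sub>iq\<^sup>2/b; q\<^sup>2, p)\<close> with index \<open>n\<^sub>i\<close>, both sides are, as functions
  of \<open>b\<close>, theta functions of degree \<open>|n|\<close> which are invariant under \<open>b \<mapsto> q/b\<close>. These form a
  space of dimension \<open>|n| + 1\<close>: by the Jacobi triple product
  \<open>\<theta>(cb)\<theta>(cq/b)\<close> is a linear combination of two functions of \<open>b\<close> that do not depend on \<open>c\<close>, so the
  elements of the space are binary forms of degree \<open>|n|\<close>. It therefore suffices to compare
  both sides at the \<open>|n| + 1\<close> points \<open>b = 1\<close> and \<open>b = q\<^bsup>1-2M\<^esup>/(ax\<^sub>s)\<close>, where
  \<open>1 \<le> M \<le> n\<^sub>s\<close>. At \<open>b = 1\<close> only the term \<open>k = 0\<close> remains. At the other points only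
  the terms with \<open>k\<^sub>s \<ge> M\<close> remain, and after shifting \<open>k\<^sub>s\<close> by \<open>M\<close> they form the same
  sum with \<open>n\<^sub>s\<close>, \<open>x\<^sub>s\<close>, \<open>a\<close>, \<open>b\<close> replaced by \<open>n\<^sub>s - M\<close>, \<open>x\<^sub>sq\<^bsup>2M\<^esup>\<close>, \<open>aq\<^bsup>M\<^esup>\<close>, \<open>bq\<^bsup>M\<^esup>\<close>,
  so that induction on \<open>|n|\<close> applies. This needs parameters more generic than
  those of the theorem, which follows by continuity.
\<close>

section \<open>The theta function\<close>

text \<open>The points b = q^(1-2M)/(ax_s) are zeros of (abx_sq;q^2,p) with index n_s. After
  clearing denominators a summand retains only the factors from k_s on, hence it vanishes there if
  k_s < M. There are n_s such points for each s, so with b = 1 they number exactly |n| + 1. The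
  obstacle is the shift at such a point: the quotient of a summand by the right-hand side must not
  change. To check this, the summand is split into pieces depending on a pair of indices, on a
  single index, or on |k|. The pieces are not invariant one by one. At these b, factors containing
  abx_i become functions of x_i/x_s and combine with those of the pair (i, s), and the powers of q
  left over multiply to 1 only when all i are taken together. Every comparison is made a matter of
  indices: shifted factorials are written as quotients of values of functions of an integer, after
  reversal if their argument is inverted. This divides by theta functions at negative as well as
  positive powers of q, which is the reason for the strong genericity.\<close>

lemma infsum_tendsto_dominated:
  fixes f :: "nat \<Rightarrow> 'a \<Rightarrow> complex"
  assumes "g summable_on A" "\<And>n k. k \<in> A \<Longrightarrow> norm (f n k) \<le> g k"
    and "\<And>k. k \<in> A \<Longrightarrow> (\<lambda>n. f n k) \<longlonglongrightarrow> h k"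
  shows "(\<lambda>n. infsum (f n) A) \<longlonglongrightarrow> infsum h A"
proof -
  have g0: "g k \<ge> 0" if "k \<in> A" for k
    using order_trans[OF norm_ge_zero assms(2)[OF that]] .
  \<comment> \<open>Sums over A are read as integrals for the counting measure, so that dominated
    convergence of Lebesgue integrals applies.\<close>
  have gs: "integrable (count_space A) g"
    using abs_summable_equivalent[of g A] assms(1) g0
    by (metis (mono_tags, lifting) abs_summable_on_def norm_of_real real_norm_def summable_on_cong abs_of_nonneg)
  have meas: "f' \<in> borel_measurable (count_space A)" for f' :: "'a \<Rightarrow> complex" by simp
  have ae: "AE k in count_space A. (\<lambda>n. f n k) \<longlonglongrightarrow> h k"
    using assms(3) by (simp add: AE_count_space)
  have bd: "\<And>n. AE k in count_space A. norm (f n k) \<le> g k"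
    using assms(2) by (simp add: AE_count_space)
  have 1: "integrable (count_space A) h"
    by (rule integrable_dominated_convergence[OF meas meas gs ae bd])
  have 2: "integrable (count_space A) (f n)" for n
    by (rule integrable_dominated_convergence2[OF meas meas gs ae bd])
  have 3: "(\<lambda>n. integral\<^sup>L (count_space A) (f n)) \<longlonglongrightarrow> integral\<^sup>L (count_space A) h"
    by (rule integral_dominated_convergence[OF meas meas gs ae bd])
  have "integral\<^sup>L (count_space A) f' = infsum f' A" if "integrable (count_space A) f'" for f' :: "'a \<Rightarrow> complex"
    using infsetsum_infsum[of f' A] that by (simp add: abs_summable_on_def infsetsum_def)
  then show ?thesis using 1 2 3 by simp
qed

section \<open>Theta series and their convergence\<close>

text \<open>The binomial coefficient k choose 2 for integer k. It is non-negative on both sides of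
  0, and a natural exponent keeps \<open>p ^ tri k\<close> correct for p = 0.\<close>

definition tri :: "int \<Rightarrow> nat" where "tri k = nat (k * (k - 1) div 2)"

lemma tri_int: "2 * int (tri k) = k * (k - 1)"
proof -
  have "even (k * (k - 1))" by auto
  moreover have "k * (k - 1) \<ge> 0"
    by (cases "k \<ge> 1") (auto simp: zero_le_mult_iff)
  ultimately show ?thesis unfolding tri_def by auto
qed

lemma tri_Suc: "int (tri (k + 1)) = int (tri k) + k"
  using tri_int[of k] tri_int[of "k + 1"] by (simp add: algebra_simps)

definition tterm :: "complex \<Rightarrow> int \<Rightarrow> complex \<Rightarrow> complex" where
  "tterm p k x = (-1) powi k * p ^ tri k * x powi k"


lemma tri_reflect: "tri (1 - k) = tri k"
  using tri_int[of k] tri_int[of "1 - k"] by (simp add: algebra_simps)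

text \<open>The quotient of consecutive terms is P^n c, which tends to 0, so the ratio test applies
  whatever the size of c.\<close>

lemma summable_tri_nat:
  fixes P c :: real
  assumes "0 \<le> P" "P < 1" "0 \<le> c"
  shows "summable (\<lambda>n. P ^ tri (int n) * c ^ n)"
proof -
  have "(\<lambda>n. P ^ n * c) \<longlonglongrightarrow> 0 * c"
    using assms by (intro tendsto_intros LIMSEQ_realpow_zero) auto
  then have "eventually (\<lambda>n. P ^ n * c < 1 / 2) sequentially"
    by (intro order_tendstoD(2)) auto
  then obtain N where N: "\<And>n. n \<ge> N \<Longrightarrow> P ^ n * c < 1 / 2"
    by (auto simp: eventually_sequentially)
  show ?thesis
  proof (rule summable_ratio_test[of "1 / 2" N])
    fix n assume n: "n \<ge> N"
    have "tri (int (Suc n)) = tri (int n) + n"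
      using tri_Suc[of "int n"] by (simp add: add.commute)
    then have "norm (P ^ tri (int (Suc n)) * c ^ Suc n) = (P ^ n * c) * (P ^ tri (int n) * c ^ n)"
      using assms by (simp add: power_add mult_ac)
    also have "\<dots> \<le> 1 / 2 * (P ^ tri (int n) * c ^ n)"
      using N[OF n] assms by (intro mult_right_mono) auto
    finally show "norm (P ^ tri (int (Suc n)) * c ^ Suc n) \<le> 1 / 2 * norm (P ^ tri (int n) * c ^ n)"
      using assms by simp
  qed auto
qed

lemma summable_on_tri:
  fixes P c :: real
  assumes P: "0 \<le> P" "P < 1" and c: "0 < c"
  shows "(\<lambda>k. P ^ tri k * c powi k) summable_on (UNIV :: int set)"
proof -
  let ?f = "\<lambda>k::int. P ^ tri k * c powi k"
  have 1: "?f summable_on {0..}"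
  proof -
    have "bij_betw int UNIV {0..}"
      by (rule bij_betwI[where g = nat]) auto
    moreover have "(\<lambda>n. ?f (int n)) summable_on UNIV"
      using summable_tri_nat[of P c] assms
      by (intro norm_summable_imp_summable_on) auto
    ultimately show ?thesis
      using summable_on_reindex_bij_betw[of int UNIV "{0..}" ?f] by simp
  qed
  have 2: "?f summable_on {..-1}"
  proof -
    have "bij_betw (\<lambda>n. - 1 - int n) UNIV {..-1}"
      by (rule bij_betwI[where g = "\<lambda>k. nat (- 1 - k)"]) auto
    moreover have "(\<lambda>n. ?f (- 1 - int n)) summable_on UNIV"
    proof (rule norm_summable_imp_summable_on)
      \<comment> \<open>The symmetry \<open>tri (1 - k) = tri k\<close> sends k = -1 - n to n + 2
        and replaces c by 1/c. Up to the factor c, the negative half is thus a tail of a series over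
        the natural numbers.\<close>
      have "summable (\<lambda>n. c * (P ^ tri (int (n + 2)) * (1 / c) ^ (n + 2)))"
        using summable_tri_nat[of P "1 / c"] assms
        by (intro summable_mult summable_ignore_initial_segment) auto
      moreover have "?f (- 1 - int n) = c * (P ^ tri (int (n + 2)) * (1 / c) ^ (n + 2))" for n
      proof -
        have "tri (- 1 - int n) = tri (int (n + 2))"
          using tri_reflect[of "int (n + 2)"] by (simp add: algebra_simps)
        moreover have "c powi (- 1 - int n) = (1 / c) ^ (n + 1)"
        proof -
          have e: "- 1 - int n = - int (n + 1)" by simp
          show ?thesis unfolding e power_int_minus power_int_of_nat by (simp add: field_simps)
        qed
        ultimately show ?thesis using c by (simp add: field_simps)
      qed
      ultimately show "summable (\<lambda>n. norm (?f (- 1 - int n)))"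
        using assms by simp
    qed
    ultimately show ?thesis
      using summable_on_reindex_bij_betw[of "\<lambda>n. - 1 - int n" UNIV "{..-1}" ?f] by simp
  qed
  have "?f summable_on ({0..} \<union> {..-1})"
    by (rule summable_on_Un_disjoint[OF 1 2]) auto
  moreover have "{0..} \<union> {..-1} = (UNIV :: int set)" by auto
  ultimately show ?thesis by simp
qed

lemma norm_tterm: "norm (tterm p k x) = norm p ^ tri k * norm x powi k"
  by (simp add: tterm_def norm_mult norm_power norm_power_int)

lemma abs_summable_tterm:
  assumes "norm p < 1" "x \<noteq> 0"
  shows "(\<lambda>k. norm (tterm p k x)) summable_on UNIV"
  unfolding norm_tterm using assms by (intro summable_on_tri) auto

definition theta_series :: "complex \<Rightarrow> complex \<Rightarrow> complex" where
  "theta_series p x = (\<Sum>\<^sub>\<infinity>k. tterm p k x)"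

lemma theta_series_tendsto:
  assumes p: "norm p < 1" and x: "x \<noteq> 0" and lim: "X \<longlonglongrightarrow> x" and X: "\<And>n. X n \<noteq> 0"
  shows "(\<lambda>n. theta_series p (X n)) \<longlonglongrightarrow> theta_series p x"
proof -
  have nz: "norm (X n) > 0" for n using X by simp
  have "Bseq X" using lim by (rule convergent_imp_Bseq[OF convergentI])
  then obtain R where R: "R > 0" "\<And>n. norm (X n) \<le> R" by (auto elim: BseqE)
  have "(\<lambda>n. inverse (X n)) \<longlonglongrightarrow> inverse x" using lim x by (intro tendsto_intros)
  then have "Bseq (\<lambda>n. inverse (X n))" by (rule convergent_imp_Bseq[OF convergentI])
  then obtain R' where R': "R' > 0" "\<And>n. norm (inverse (X n)) \<le> R'" by (auto elim: BseqE)
  show ?thesis unfolding theta_series_def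
  proof (rule infsum_tendsto_dominated)
    \<comment> \<open>All \<open>X n\<close> lie in the annulus 1/R' \<le> |z| \<le> R. The first
      summand of the bound dominates the terms with k \<ge> 0, the second those with k < 0.\<close>
    show "(\<lambda>k. norm p ^ tri k * R powi k + norm p ^ tri k * (1 / R') powi k) summable_on UNIV"
      using p R R' by (intro summable_on_add summable_on_tri) auto
    show "norm (tterm p k (X n)) \<le> norm p ^ tri k * R powi k + norm p ^ tri k * (1 / R') powi k" for n k
    proof (cases "k \<ge> 0")
      case True
      then have "norm (X n) powi k \<le> R powi k"
        by (intro power_int_mono) (auto simp: R)
      then have "norm p ^ tri k * norm (X n) powi k \<le> norm p ^ tri k * R powi k"
        by (intro mult_left_mono) auto
      then show ?thesis using R' by (simp add: norm_tterm add_increasing2)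
    next
      case False
      then obtain m where m: "k = - int m" by (metis int_cases2 of_nat_0_le_iff)
      have "(1 / norm (X n)) ^ m \<le> R' ^ m"
        using R'(2)[of n] by (intro power_mono) (auto simp: norm_divide inverse_eq_divide)
      then have "norm (X n) powi k \<le> (1 / R') powi k"
        by (simp add: m power_int_minus field_simps)
      then have "norm p ^ tri k * norm (X n) powi k \<le> norm p ^ tri k * (1 / R') powi k"
        by (intro mult_left_mono) auto
      then show ?thesis using R by (simp add: norm_tterm add_increasing)
    qed
    show "(\<lambda>n. tterm p k (X n)) \<longlonglongrightarrow> tterm p k x" for k
      unfolding tterm_def using lim x by (intro tendsto_intros) auto
  qed
qed

section \<open>The finite form of the triple product\<close>

definition euler_fac :: "complex \<Rightarrow> nat \<Rightarrow> complex" where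
  "euler_fac p n = (\<Prod>j<n. 1 - p ^ (j + 1))"

text \<open>The Gaussian binomial coefficient with base p, extended by zero to all integers m so
  that both Pascal rules hold without side conditions on m.\<close>

definition q_binomial :: "complex \<Rightarrow> nat \<Rightarrow> int \<Rightarrow> complex" where
  "q_binomial p n m = (if 0 \<le> m \<and> m \<le> int n
     then euler_fac p n / (euler_fac p (nat m) * euler_fac p (n - nat m)) else 0)"

lemma one_minus_power_nonzero: "norm (p :: complex) < 1 \<Longrightarrow> 1 - p ^ (j + 1) \<noteq> 0"
  by (metis add_gr_0 eq_iff_diff_eq_0 less_one norm_one norm_power order_less_irrefl power_less_one_iff
      norm_ge_zero)

lemma euler_fac_nonzero: "norm p < 1 \<Longrightarrow> euler_fac p n \<noteq> 0"
  unfolding euler_fac_def using one_minus_power_nonzero by (subst prod_zero_iff) auto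

lemma euler_fac_Suc: "euler_fac p (Suc n) = euler_fac p n * (1 - p ^ (n + 1))"
  by (simp add: euler_fac_def)

lemma q_binomial_pascal:
  assumes p: "norm p < 1"
  shows "q_binomial p (Suc n) m = q_binomial p n m + p ^ nat (int n + 1 - m) * q_binomial p n (m - 1)"
    and "q_binomial p (Suc n) m = p ^ nat m * q_binomial p n m + q_binomial p n (m - 1)"
proof -
  consider "m < 0 \<or> m > int n + 1" | "m = 0" | "m = int n + 1" | "1 \<le> m" "m \<le> int n" by linarith
  then have "q_binomial p (Suc n) m = q_binomial p n m + p ^ nat (int n + 1 - m) * q_binomial p n (m - 1)
    \<and> q_binomial p (Suc n) m = p ^ nat m * q_binomial p n m + q_binomial p n (m - 1)"
  proof cases
    case 1
    then show ?thesis by (auto simp: q_binomial_def)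
  next
    case 2
    then show ?thesis using euler_fac_nonzero[OF p] by (simp add: q_binomial_def)
  next
    case 3
    have "nat (1 + int n) = Suc n" "euler_fac p 0 = 1" by (simp_all add: euler_fac_def)
    then show ?thesis using 3 euler_fac_nonzero[OF p]
      by (simp add: q_binomial_def add.commute)
  next
    case 4
    \<comment> \<open>Over the common denominator (p;p)_{i+1} (p;p)_{j+1} both rules reduce to
      writing 1 - p^(i+1) p^(j+1) as (1 - p^(j+1)) + p^(j+1) (1 - p^(i+1)), or the same with i and j
      exchanged.\<close>
    define i j where "i = nat (m - 1)" and "j = nat (int n - m)"
    have m: "m = int (Suc i)" and n: "n = i + j + 1" using 4 by (auto simp: i_def j_def)
    note nz = euler_fac_nonzero[OF p] one_minus_power_nonzero[OF p]
    have e: "nat (int n + 1 - m) = j + 1" "nat m = i + 1" "n - nat m = j" "Suc n - nat m = Suc j"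
      "nat (m - 1) = i" "n - i = Suc j" "n - Suc i = j" "nat m = Suc i"
      using m n by auto
    let ?E = "euler_fac p"
    have 1: "q_binomial p (Suc n) m = ?E n * (1 - p ^ (n + 1)) / (?E (Suc i) * ?E (Suc j))"
      using 4 by (simp add: q_binomial_def e euler_fac_Suc[of p n])
    have 2: "q_binomial p n m = ?E n * (1 - p ^ (j + 1)) / (?E (Suc i) * ?E (Suc j))"
      using 4 nz by (simp add: q_binomial_def e(2-7) euler_fac_Suc[of p j] del: power_Suc)
    have 3: "q_binomial p n (m - 1) = ?E n * (1 - p ^ (i + 1)) / (?E (Suc i) * ?E (Suc j))"
      using 4 nz by (simp add: q_binomial_def e(3-6) euler_fac_Suc[of p i] del: power_Suc)
    have pn: "p ^ (n + 1) = p ^ (i + 1) * p ^ (j + 1)" by (simp add: n power_add)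
    show ?thesis unfolding 1 2 3 e pn
      by (simp add: add_divide_distrib[symmetric] del: power_Suc) (simp add: algebra_simps)
  qed
  then show "q_binomial p (Suc n) m = q_binomial p n m + p ^ nat (int n + 1 - m) * q_binomial p n (m - 1)"
    and "q_binomial p (Suc n) m = p ^ nat m * q_binomial p n m + q_binomial p n (m - 1)" by blast+
qed


text \<open>The coefficient of x^k in the product of a factors 1 - p^j x and b factors 1 -
  p^(j+1)/x.\<close>

definition triple_coeff :: "complex \<Rightarrow> nat \<Rightarrow> nat \<Rightarrow> int \<Rightarrow> complex" where
  "triple_coeff p a b k = (-1) powi k * p ^ tri k * q_binomial p (a + b) (int b + k)"

text \<open>Multiplication by the new factor 1 - p^a x is one of the Pascal rules, because tri(k) +
  (a+1-k) = a + tri(k-1). For k > a+1 the truncated exponent is multiplied by a vanishing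
  coefficient.\<close>

lemma triple_coeff_Suc_left:
  assumes p: "norm p < 1"
  shows "triple_coeff p (Suc a) b k = triple_coeff p a b k - p ^ a * triple_coeff p a b (k - 1)"
proof -
  have 1: "p ^ tri k * (p ^ nat (int (a + b) + 1 - (int b + k)) * q_binomial p (a + b) (int b + k - 1))
      = p ^ a * (p ^ tri (k - 1) * q_binomial p (a + b) (int b + k - 1))"
  proof (cases "k \<le> int a + 1")
    case True
    have "tri k + nat (int (a + b) + 1 - (int b + k)) = a + tri (k - 1)"
      using tri_Suc[of "k - 1"] True by simp
    then show ?thesis by (simp flip: power_add mult.assoc)
  qed (simp add: q_binomial_def)
  have 2: "(-1 :: complex) powi (k - 1) = - ((-1) powi k)"
    by (simp add: power_int_diff)
  show ?thesis unfolding triple_coeff_def 2 add_Suc q_binomial_pascal(1)[OF p]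
    using 1 by (simp add: algebra_simps)
qed

lemma triple_coeff_Suc_right:
  assumes p: "norm p < 1"
  shows "triple_coeff p a (Suc b) k = triple_coeff p a b k - p ^ (b + 1) * triple_coeff p a b (k + 1)"
proof -
  have 1: "p ^ tri k * (p ^ nat (int (Suc b) + k) * q_binomial p (a + b) (int b + (k + 1)))
      = p ^ (b + 1) * (p ^ tri (k + 1) * q_binomial p (a + b) (int b + (k + 1)))"
  proof (cases "int b + (k + 1) \<ge> 0")
    case True
    have "tri k + nat (int (Suc b) + k) = b + 1 + tri (k + 1)"
      using tri_Suc[of k] True by simp
    then show ?thesis by (simp only: flip: power_add mult.assoc)
  qed (simp add: q_binomial_def)
  have 2: "(-1 :: complex) powi (k + 1) = - ((-1) powi k)"
    by (simp add: power_int_add)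
  have 3: "int (Suc b) + k = int b + (k + 1)" "int (Suc b) + k - 1 = int b + k" by simp_all
  show ?thesis unfolding triple_coeff_def 2 add_Suc_right q_binomial_pascal(2)[OF p] 3(2)
    using 1 unfolding 3(1) by (simp add: algebra_simps)
qed

text \<open>Induction on the numbers of factors of either kind. The sum extends over all integers,
  although only finitely many terms are nonzero, so that the limit can later be exchanged with a sum
  over a fixed set.\<close>

lemma finite_triple_product:
  assumes p: "norm p < 1" and x: "x \<noteq> 0"
  shows "((\<lambda>k. triple_coeff p a b k * x powi k) has_sum
    (\<Prod>j<a. 1 - p ^ j * x) * (\<Prod>j<b. 1 - p ^ (j + 1) / x)) UNIV"
proof (induction a)
  case 0
  show ?case
  proof (induction b)
    case 0
    have "tri 0 = 0" by (simp add: tri_def)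
    then show ?case
      by (intro has_sum_finite_neutralI[of "{0}"])
         (auto simp: triple_coeff_def q_binomial_def euler_fac_def)
  next
    case (Suc b)
    let ?f = "\<lambda>k. triple_coeff p 0 b k * x powi k"
    let ?S = "(\<Prod>j<0. 1 - p ^ j * x) * (\<Prod>j<b. 1 - p ^ (j + 1) / x)"
    have "((\<lambda>k. ?f (k + 1)) has_sum ?S) UNIV"
      using Suc has_sum_reindex_bij_witness[of UNIV "\<lambda>k. k - 1" "\<lambda>k. k + 1" UNIV ?f "\<lambda>k. ?f (k + 1)" ?S ?S]
      by simp
    then have "((\<lambda>k. ?f k + - (p ^ (b + 1) / x) * ?f (k + 1)) has_sum (?S + - (p ^ (b + 1) / x) * ?S)) UNIV"
      by (intro has_sum_add Suc has_sum_cmult_right)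
    moreover have "?f k + - (p ^ (b + 1) / x) * ?f (k + 1) = triple_coeff p 0 (Suc b) k * x powi k" for k
    proof -
      have e: "x powi (k + 1) = x powi k * x" using x by (simp add: power_int_add)
      have "c * X + - (P / x) * (d * (X * x)) = (c - P * d) * X" for c d P X
        using x by (simp add: field_simps)
      then show ?thesis unfolding triple_coeff_Suc_right[OF p, of 0 b k] e .
    qed
    moreover have "?S + - (p ^ (b + 1) / x) * ?S = (\<Prod>j<0. 1 - p ^ j * x) * (\<Prod>j<Suc b. 1 - p ^ (j + 1) / x)"
      unfolding prod.lessThan_Suc by (simp add: right_diff_distrib)
    ultimately show ?case by (simp only:)
  qed
next
  case (Suc a)
  let ?f = "\<lambda>k. triple_coeff p a b k * x powi k"
  let ?S = "(\<Prod>j<a. 1 - p ^ j * x) * (\<Prod>j<b. 1 - p ^ (j + 1) / x)"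
  have "((\<lambda>k. ?f (k - 1)) has_sum ?S) UNIV"
    using Suc has_sum_reindex_bij_witness[of UNIV "\<lambda>k. k + 1" "\<lambda>k. k - 1" UNIV ?f "\<lambda>k. ?f (k - 1)" ?S ?S]
    by simp
  then have "((\<lambda>k. ?f k + - (p ^ a * x) * ?f (k - 1)) has_sum (?S + - (p ^ a * x) * ?S)) UNIV"
    by (intro has_sum_add Suc has_sum_cmult_right)
  moreover have "?f k + - (p ^ a * x) * ?f (k - 1) = triple_coeff p (Suc a) b k * x powi k" for k
  proof -
    have e: "x powi k = x powi (k - 1) * x" using x by (simp add: power_int_diff)
    have "c * (X * x) + - (P * x) * (d * X) = (c - P * d) * (X * x)" for c d P X
      by (simp add: algebra_simps)
    then show ?thesis unfolding triple_coeff_Suc_left[OF p, of a b k] e .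
  qed
  moreover have "?S + - (p ^ a * x) * ?S = (\<Prod>j<Suc a. 1 - p ^ j * x) * (\<Prod>j<b. 1 - p ^ (j + 1) / x)"
    unfolding prod.lessThan_Suc by (simp add: algebra_simps)
  ultimately show ?case by (simp only:)
qed

section \<open>The infinite product and the Jacobi triple product\<close>

lemma summable_norm_power_mult: "norm (p :: complex) < 1 \<Longrightarrow> summable (\<lambda>j. norm (p ^ j * c))"
  by (simp add: norm_mult norm_power summable_mult2)

lemma convergent_prod_theta_factors:
  assumes "norm (p :: complex) < 1"
  shows "convergent_prod (\<lambda>j. 1 - p ^ j * c)" and "convergent_prod (\<lambda>j. 1 - p ^ (j + 1) / c)"
proof -
  have *: "convergent_prod (\<lambda>j. 1 - p ^ j * c)" for c
    using summable_norm_power_mult[OF assms, of c]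
    by (intro abs_convergent_prod_imp_convergent_prod summable_imp_abs_convergent_prod) simp
  show "convergent_prod (\<lambda>j. 1 - p ^ j * c)" by (rule *)
  show "convergent_prod (\<lambda>j. 1 - p ^ (j + 1) / c)" using *[of "p / c"] by (simp add: mult.commute)
qed

lemma theta_LIMSEQ:
  assumes "norm p < 1"
  shows "(\<lambda>N. (\<Prod>j<N. 1 - p ^ j * x) * (\<Prod>j<N. 1 - p ^ (j + 1) / x)) \<longlonglongrightarrow> theta x p"
proof -
  have "convergent_prod (\<lambda>j. (1 - p ^ j * x) * (1 - p ^ (j + 1) / x))"
    by (intro convergent_prod_mult convergent_prod_theta_factors assms)
  from convergent_prod_LIMSEQ[OF this]
  have "(\<lambda>N. \<Prod>j<Suc N. (1 - p ^ j * x) * (1 - p ^ (j + 1) / x)) \<longlonglongrightarrow> theta x p"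
    unfolding theta_def lessThan_Suc_atMost .
  then show ?thesis by (subst (asm) filterlim_sequentially_Suc) (simp add: prod.distrib)
qed

text \<open>A convergent infinite product vanishes only if one of its factors does; the two kinds of
  factors give l \<le> 0 and l > 0 respectively.\<close>

lemma theta_eq_0D:
  assumes p: "norm p < 1" and x: "x \<noteq> 0" and 0: "theta x p = 0"
  obtains l :: int where "x = p powi l"
proof -
  have "convergent_prod (\<lambda>j. (1 - p ^ j * x) * (1 - p ^ (j + 1) / x))"
    by (intro convergent_prod_mult convergent_prod_theta_factors p)
  from prodinf_nonzero[OF this] 0 obtain j where "(1 - p ^ j * x) * (1 - p ^ (j + 1) / x) = 0"
    unfolding theta_def by blast
  then consider "p ^ j * x = 1" | "p ^ (j + 1) / x = 1" by auto
  then show ?thesis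
  proof cases
    case 1
    moreover from 1 have "p ^ j \<noteq> 0" by (metis mult_zero_left zero_neq_one)
    ultimately have "x = p powi (- int j)"
      by (simp add: power_int_minus field_simps)
    then show ?thesis by (rule that)
  next
    case 2
    then have "x = p ^ (j + 1)" using x by (simp add: field_simps)
    then have "x = p powi int (j + 1)" by (simp only: power_int_of_nat)
    then show ?thesis by (rule that)
  qed
qed

lemma euler_fac_limit:
  assumes p: "norm p < 1"
  obtains L where "L \<noteq> 0" "euler_fac p \<longlonglongrightarrow> L"
proof -
  have c: "convergent_prod (\<lambda>j. 1 - p ^ (j + 1))"
    using convergent_prod_theta_factors(2)[OF p, of 1] by simp
  have "(\<lambda>N. euler_fac p (Suc N)) \<longlonglongrightarrow> (\<Prod>j. 1 - p ^ (j + 1))"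
    using convergent_prod_LIMSEQ[OF c] unfolding euler_fac_def lessThan_Suc_atMost .
  then have "euler_fac p \<longlonglongrightarrow> (\<Prod>j. 1 - p ^ (j + 1))" by (subst (asm) filterlim_sequentially_Suc)
  moreover have "(\<Prod>j. 1 - p ^ (j + 1)) \<noteq> 0"
    using prodinf_nonzero[OF c] one_minus_power_nonzero[OF p] by blast
  ultimately show ?thesis by (rule that[rotated])
qed

text \<open>The Euler products and their inverses converge, hence are bounded. The uniform bound
  supplies the summable majorant in the passage from the finite to the infinite triple
  product.\<close>

lemma q_binomial_bounded:
  assumes p: "norm p < 1"
  obtains B where "\<And>n m. norm (q_binomial p n m) \<le> B"
proof -
  obtain L where L: "L \<noteq> 0" "euler_fac p \<longlonglongrightarrow> L" using euler_fac_limit[OF p] .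
  have "Bseq (euler_fac p)" using L(2) by (rule convergent_imp_Bseq[OF convergentI])
  then obtain R where R: "R > 0" "\<And>n. norm (euler_fac p n) \<le> R" by (auto elim: BseqE)
  have "(\<lambda>n. inverse (euler_fac p n)) \<longlonglongrightarrow> inverse L" using L by (intro tendsto_intros)
  then have "Bseq (\<lambda>n. inverse (euler_fac p n))" by (rule convergent_imp_Bseq[OF convergentI])
  then obtain R' where R': "R' > 0" "\<And>n. norm (inverse (euler_fac p n)) \<le> R'" by (auto elim: BseqE)
  have "norm (q_binomial p n m) \<le> R * (R' * R')" for n m
  proof (cases "0 \<le> m \<and> m \<le> int n")
    case True
    then have "norm (q_binomial p n m) = norm (euler_fac p n) *
        (norm (inverse (euler_fac p (nat m))) * norm (inverse (euler_fac p (n - nat m))))"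
      by (simp add: q_binomial_def norm_mult norm_divide norm_inverse field_simps)
    also have "\<dots> \<le> R * (R' * R')"
      using R R' by (intro mult_mono) (auto simp: less_imp_le)
    finally show ?thesis .
  next
    case False
    then show ?thesis using R R' by (auto simp: q_binomial_def)
  qed
  then show ?thesis by (rule that)
qed

text \<open>The limit of the finite formula with a = b = N. The constant L is (p;p)_\<infinity>, and
  the Gaussian binomial of 2N over N + k tends to L/(L L) = 1/L for every fixed k.\<close>

lemma jacobi_triple_product:
  assumes p: "norm p < 1"
  obtains L where "L \<noteq> 0" "\<And>x. x \<noteq> 0 \<Longrightarrow> theta x p = theta_series p x / L"
proof -
  obtain L where L: "L \<noteq> 0" "euler_fac p \<longlonglongrightarrow> L" using euler_fac_limit[OF p] .
  obtain B where B: "\<And>n m. norm (q_binomial p n m) \<le> B" using q_binomial_bounded[OF p] by blast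
  have "theta x p = theta_series p x / L" if x: "x \<noteq> 0" for x
  proof -
    have lim: "(\<lambda>N. infsum (\<lambda>k. triple_coeff p N N k * x powi k) UNIV) \<longlonglongrightarrow> infsum (\<lambda>k. tterm p k x * (1 / L)) UNIV"
    proof (rule infsum_tendsto_dominated[where g = "\<lambda>k. norm (tterm p k x) * B"])
      show "(\<lambda>k. norm (tterm p k x) * B) summable_on UNIV"
        by (intro summable_on_cmult_left abs_summable_tterm p x)
      have eq: "triple_coeff p N N k * x powi k = tterm p k x * q_binomial p (N + N) (int N + k)" for N k
        by (simp add: triple_coeff_def tterm_def)
      show "norm (triple_coeff p N N k * x powi k) \<le> norm (tterm p k x) * B" for N k
        unfolding eq norm_mult by (intro mult_left_mono B) auto
      fix k :: int
      have "eventually (\<lambda>N. q_binomial p (N + N) (int N + k) = euler_fac p (N + N)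
          / (euler_fac p (nat (int N + k)) * euler_fac p (nat (int N - k)))) sequentially"
      proof (rule eventually_sequentiallyI[of "nat \<bar>k\<bar>"])
        fix N assume "N \<ge> nat \<bar>k\<bar>"
        then have "0 \<le> int N + k \<and> int N + k \<le> int (N + N)" "N + N - nat (int N + k) = nat (int N - k)"
          by auto
        then show "q_binomial p (N + N) (int N + k) = euler_fac p (N + N)
          / (euler_fac p (nat (int N + k)) * euler_fac p (nat (int N - k)))"
          unfolding q_binomial_def by simp
      qed
      moreover have "(\<lambda>N. euler_fac p (N + N)
          / (euler_fac p (nat (int N + k)) * euler_fac p (nat (int N - k)))) \<longlonglongrightarrow> L / (L * L)"
      proof -
        have c: "filterlim (\<lambda>N. N + N) at_top sequentially" "filterlim (\<lambda>N. nat (int N + k)) at_top sequentially"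
          "filterlim (\<lambda>N. nat (int N - k)) at_top sequentially"
          unfolding filterlim_at_top eventually_sequentially
        proof (safe, goal_cases)
          case (1 Z) then show ?case by (intro exI[of _ Z]) auto
        next
          case (2 Z) then show ?case by (intro exI[of _ "Z + nat \<bar>k\<bar>"]) auto
        next
          case (3 Z) then show ?case by (intro exI[of _ "Z + nat \<bar>k\<bar>"]) auto
        qed
        show ?thesis
          using L(1) by (intro tendsto_intros filterlim_compose[OF L(2)] c) auto
      qed
      ultimately have "(\<lambda>N. q_binomial p (N + N) (int N + k)) \<longlonglongrightarrow> L / (L * L)"
        by (simp add: tendsto_cong)
      then show "(\<lambda>N. triple_coeff p N N k * x powi k) \<longlonglongrightarrow> tterm p k x * (1 / L)"
        unfolding eq using L(1) by (intro tendsto_intros) simp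
    qed
    have "infsum (\<lambda>k. triple_coeff p N N k * x powi k) UNIV
        = (\<Prod>j<N. 1 - p ^ j * x) * (\<Prod>j<N. 1 - p ^ (j + 1) / x)" for N
      using finite_triple_product[OF p x] by (rule infsumI)
    with lim theta_LIMSEQ[OF p, of x] have "theta x p = infsum (\<lambda>k. tterm p k x * (1 / L)) UNIV"
      by (simp add: LIMSEQ_unique)
    then show ?thesis
      unfolding theta_series_def using infsum_cmult_left'[of "\<lambda>k. tterm p k x" "1 / L" UNIV] by simp
  qed
  with L(1) show ?thesis by (rule that)
qed


section \<open>Inversion and the determinant formula\<close>

text \<open>The finite products at x and 1/x agree up to boundary factors. These are
  cross-multiplied, and the common factor 1 - x is cancelled only after the limit; for x = 1 both
  sides vanish.\<close>

lemma theta_inverse: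
  assumes p: "norm p < 1" and x: "x \<noteq> 0"
  shows "theta (1 / x) p = - theta x p / x"
proof (cases "x = 1")
  case True
  have "\<forall>N>0. (\<Prod>j<N. 1 - p ^ j * 1) * (\<Prod>j<N. 1 - p ^ (j + 1) / 1) = 0"
    by (auto simp: prod_zero_iff intro!: bexI[of _ 0])
  then have "(\<lambda>N. (\<Prod>j<N. 1 - p ^ j * 1) * (\<Prod>j<N. 1 - p ^ (j + 1) / 1)) \<longlonglongrightarrow> 0"
    by (intro tendsto_eventually eventually_sequentiallyI[of 1]) simp_all
  with theta_LIMSEQ[OF p, of 1] have "theta 1 p = 0" using LIMSEQ_unique by blast
  then show ?thesis using True by simp
next
  case False
  let ?P = "\<lambda>x N. (\<Prod>j<N. 1 - p ^ j * x) * (\<Prod>j<N. 1 - p ^ (j + 1) / x)"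
  have shift: "(\<Prod>j<N. 1 - p ^ j * y) * (1 - p ^ N * y) = (1 - y) * (\<Prod>j<N. 1 - p ^ (j + 1) * y)" for N y
    using prod.lessThan_Suc_shift[of "\<lambda>j. 1 - p ^ j * y" N] by simp
  have eq: "?P (1 / x) N * ((1 - x) * (1 - p ^ N * (1 / x))) = ?P x N * ((1 - 1 / x) * (1 - p ^ N * x))" for N
  proof -
    have swap: "(V * U') * ((1 - x) * c) = (V * c) * ((1 - x) * U')"
      "(U * V') * ((1 - 1 / x) * c) = ((1 - 1 / x) * V') * (U * c)" for U V U' V' c
      by (simp_all only: mult_ac)
    have e: "p ^ (j + 1) / (1 / x) = p ^ (j + 1) * x" "p ^ (j + 1) / x = p ^ (j + 1) * (1 / x)" for j
      by simp_all
    show ?thesis unfolding e swap shift by (simp only: mult_ac)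
  qed
  have pN: "(\<lambda>N. p ^ N) \<longlonglongrightarrow> 0" using p by (rule LIMSEQ_power_zero)
  have "(\<lambda>N. ?P (1 / x) N * ((1 - x) * (1 - p ^ N * (1 / x)))) \<longlonglongrightarrow> theta (1 / x) p * ((1 - x) * (1 - 0 * (1 / x)))"
    by (intro tendsto_intros theta_LIMSEQ p pN)
  moreover have "(\<lambda>N. ?P x N * ((1 - 1 / x) * (1 - p ^ N * x))) \<longlonglongrightarrow> theta x p * ((1 - 1 / x) * (1 - 0 * x))"
    by (intro tendsto_intros theta_LIMSEQ p pN)
  ultimately have "theta (1 / x) p * (1 - x) = theta x p * (1 - 1 / x)"
    unfolding eq by (simp add: LIMSEQ_unique)
  also have "theta x p * (1 - 1 / x) = (- theta x p / x) * (1 - x)"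
    using x by (simp add: field_simps)
  finally have "theta (1 / x) p * (1 - x) = (- theta x p / x) * (1 - x)" .
  moreover have "1 - x \<noteq> 0" using False by simp
  ultimately show ?thesis by (metis mult_right_cancel)
qed

lemma infsum_mult_product:
  fixes f g :: "'a \<Rightarrow> complex"
  assumes "(\<lambda>(x, y). f x * g y) summable_on (UNIV :: ('a \<times> 'a) set)"
  shows "(\<Sum>\<^sub>\<infinity>(x, y)\<in>UNIV. f x * g y) = infsum f UNIV * infsum g UNIV"
proof -
  have "(\<Sum>\<^sub>\<infinity>(x, y)\<in>UNIV \<times> UNIV. f x * g y) = (\<Sum>\<^sub>\<infinity>x. \<Sum>\<^sub>\<infinity>y. f x * g y)"
    by (rule infsum_Sigma'_banach[symmetric]) (use assms in simp)
  then show ?thesis by (simp add: infsum_cmult_right' infsum_cmult_left')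
qed

lemma summable_on_mult_product:
  fixes f g :: "'a \<Rightarrow> complex"
  assumes "(\<lambda>x. norm (f x)) summable_on UNIV" "(\<lambda>x. norm (g x)) summable_on UNIV"
  shows "(\<lambda>(x, y). f x * g y) summable_on UNIV"
proof -
  have "(\<lambda>z. norm ((\<lambda>(x, y). f x * g y) z)) summable_on (UNIV \<times> UNIV)"
    unfolding Infinite_Sum.abs_summable_on_Sigma_iff
    using assms by (auto simp: norm_mult infsum_cmult_right' abs_of_nonneg infsum_nonneg
        intro!: summable_on_cmult_left summable_on_cmult_right)
  then show ?thesis using abs_summable_summable by fastforce
qed

text \<open>
  In the product of two theta series, the parity of \<open>m + n\<close> for the summation indices \<open>m\<close>, \<open>n\<close> splits
  the double sum into two products of simple sums, whence the determinant.
\<close>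

lemma theta_wedge:
  assumes p: "norm p < 1"
  obtains G H where "\<And>x y. x \<noteq> 0 \<Longrightarrow> y \<noteq> 0 \<Longrightarrow>
    theta (x * y) p * theta (x / y) p = x * (G x * H y - H x * G y)"
proof -
  obtain L where L: "L \<noteq> 0" "\<And>x. x \<noteq> 0 \<Longrightarrow> theta x p = theta_series p x / L"
    using jacobi_triple_product[OF p] by blast
  \<comment> \<open>The exponents come from \<open>tri (i + j) + tri (i - j)\<close> and
    \<open>tri (i + j + 1) + tri (i - j)\<close>, in which i and j separate.\<close>
  define a where "a x k = p ^ nat (k * k - k) * x powi (2 * k)" for x and k :: int
  define b where "b x k = p ^ nat (k * k) * x powi (2 * k)" for x and k :: int
  define d where "d x k = p ^ nat (k * k + k) * x powi (2 * k + 1)" for x and k :: int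
  define A where "A x = infsum (a x) UNIV" for x
  define B where "B x = infsum (b x) UNIV" for x
  have kk: "k * k - k \<ge> 0" "k * k + k \<ge> 0" "k * k \<ge> 0" for k :: int
  proof -
    have "k * k - k = 2 * int (tri k)" "k * k + k = 2 * int (tri (k + 1))"
      using tri_int[of k] tri_int[of "k + 1"] by (simp_all add: algebra_simps)
    then show "k * k - k \<ge> 0" "k * k + k \<ge> 0" "k * k \<ge> 0" by auto
  qed
  have prod_series: "theta_series p (x * y) * theta_series p (x / y)
      = A x * B y - x / y * B x * A y" if x: "x \<noteq> 0" and y: "y \<noteq> 0" for x y
  proof -
    let ?F = "\<lambda>(m, n). tterm p m (x * y) * tterm p n (x / y)"
    \<comment> \<open>\<open>h0\<close> enumerates the pairs with even sum, \<open>h1\<close> those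
      with odd sum.\<close>
    define h0 h1 where "h0 = (\<lambda>(i, j). (i + j, i - j :: int))"
      and "h1 = (\<lambda>(i, j). (i + j + 1, i - j :: int))"
    have S: "?F summable_on UNIV"
      using x y by (intro summable_on_mult_product abs_summable_tterm p) auto
    have inj: "inj h0" "inj h1" by (auto simp: inj_def h0_def h1_def)
    have disj: "range h0 \<inter> range h1 = {}"
    proof -
      have "h0 u \<noteq> h1 v" for u v
      proof (cases u; cases v)
        fix i j i' j' assume uv: "u = (i, j)" "v = (i', j')"
        have "\<not> (i + j = i' + j' + 1 \<and> i - j = i' - j')" by presburger
        then show ?thesis by (simp add: uv h0_def h1_def)
      qed
      then show ?thesis by blast
    qed
    have un: "range h0 \<union> range h1 = UNIV"
    proof -
      have "(m, n) \<in> range h0 \<union> range h1" for m n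
      proof (cases "even (m + n)")
        case True
        then have "h0 ((m + n) div 2, (m - n) div 2) = (m, n)"
          by (simp add: h0_def) presburger
        then show ?thesis by (metis UnI1 rangeI)
      next
        case False
        then have "h1 ((m + n - 1) div 2, (m - n - 1) div 2) = (m, n)"
          by (simp add: h1_def) presburger
        then show ?thesis by (metis UnI2 rangeI)
      qed
      then show ?thesis by auto
    qed
    have powi_split: "(x * y) powi m * (x / y) powi n = x powi (m + n) * y powi (m - n)" for m n
      using x y by (simp add: power_int_mult_distrib power_int_divide_distrib power_int_add power_int_diff)
    have F0: "(?F \<circ> h0) = (\<lambda>(i, j). a x i * b y j)"
    proof (rule ext, clarify)
      fix i j :: int
      have t: "tri (i + j) + tri (i - j) = nat (i * i - i) + nat (j * j)"
        using tri_int[of "i + j"] tri_int[of "i - j"] kk[of i] kk[of j] by (simp add: algebra_simps)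
      have s: "(-1 :: complex) powi (i + j) * (-1) powi (i - j) = 1"
        by (simp flip: power_int_add)
      have e: "(x * y) powi (i + j) * (x / y) powi (i - j) = x powi (2 * i) * y powi (2 * j)"
        by (simp add: powi_split)
      have "(?F \<circ> h0) (i, j) = ((-1) powi (i + j) * (-1) powi (i - j)) * (p ^ tri (i + j) * p ^ tri (i - j))
          * ((x * y) powi (i + j) * (x / y) powi (i - j))"
        by (simp add: h0_def tterm_def mult_ac)
      also have "\<dots> = a x i * b y j"
        unfolding s e power_add[symmetric] t by (simp add: a_def b_def power_add)
      finally show "(?F \<circ> h0) (i, j) = a x i * b y j" .
    qed
    have F1: "(?F \<circ> h1) = (\<lambda>(i, j). (- x * b x i) * d y j)"
    proof (rule ext, clarify)
      fix i j :: int
      have t: "tri (i + j + 1) + tri (i - j) = nat (i * i) + nat (j * j + j)"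
        using tri_int[of "i + j + 1"] tri_int[of "i - j"] kk[of i] kk[of j] by (simp add: algebra_simps)
      have s: "(-1 :: complex) powi (i + j + 1) * (-1) powi (i - j) = - 1"
        by (simp flip: power_int_add)
      have "(x * y) powi (i + j + 1) * (x / y) powi (i - j) = x powi (2 * i + 1) * y powi (2 * j + 1)"
        by (simp add: powi_split)
      then have e: "(x * y) powi (i + j + 1) * (x / y) powi (i - j) = x * x powi (2 * i) * y powi (2 * j + 1)"
        using x by (simp add: power_int_add)
      have "(?F \<circ> h1) (i, j) = ((-1) powi (i + j + 1) * (-1) powi (i - j)) * (p ^ tri (i + j + 1) * p ^ tri (i - j))
          * ((x * y) powi (i + j + 1) * (x / y) powi (i - j))"
        by (simp add: h1_def tterm_def mult_ac)
      also have "\<dots> = (- x * b x i) * d y j"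
        unfolding s e power_add[symmetric] t by (simp add: b_def d_def power_add)
      finally show "(?F \<circ> h1) (i, j) = (- x * b x i) * d y j" .
    qed
    have S0: "?F summable_on range h0" and S1: "?F summable_on range h1"
      using S by (rule summable_on_subset_banach; simp)+
    have "theta_series p (x * y) * theta_series p (x / y) = infsum ?F UNIV"
      unfolding theta_series_def using S by (rule infsum_mult_product[symmetric])
    also have "\<dots> = infsum ?F (range h0 \<union> range h1)" by (simp only: un)
    also have "\<dots> = infsum ?F (range h0) + infsum ?F (range h1)"
      by (rule infsum_Un_disjoint[OF S0 S1 disj])
    also have "infsum ?F (range h0) = A x * B y"
      unfolding infsum_reindex[OF inj(1)] F0 A_def B_def
      using S0 unfolding summable_on_reindex[OF inj(1)] F0 by (rule infsum_mult_product)
    also have "infsum ?F (range h1) = infsum (\<lambda>i. - x * b x i) UNIV * infsum (d y) UNIV"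
      unfolding infsum_reindex[OF inj(2)] F1
      using S1 unfolding summable_on_reindex[OF inj(2)] F1 by (rule infsum_mult_product)
    also have "infsum (\<lambda>i. - x * b x i) UNIV = - x * B x"
      unfolding B_def by (rule infsum_cmult_right')
    \<comment> \<open>A shift of the summation index turns the third series into the first. Thereby
      both products involve the same functions A and B, and their difference becomes a
      determinant.\<close>
    also have "infsum (d y) UNIV = A y / y"
    proof -
      have "d y k = a y (k + 1) * (1 / y)" for k
        using y by (simp add: a_def d_def power_int_add algebra_simps power2_eq_square)
      then have "infsum (d y) UNIV = infsum (\<lambda>k. a y k * (1 / y)) UNIV"
        by (intro infsum_reindex_bij_witness[of UNIV "\<lambda>k. k - 1" "\<lambda>k. k + 1"]) auto
      then show ?thesis unfolding A_def by (simp add: infsum_cmult_left' flip: times_divide_eq_right) simp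
    qed
    finally show ?thesis by (simp add: algebra_simps)
  qed
  show ?thesis
  proof (rule that[of "\<lambda>x. A x / (x * L)" "\<lambda>x. B x / L"])
    fix x y :: complex assume xy: "x \<noteq> 0" "y \<noteq> 0"
    have "theta (x * y) p * theta (x / y) p = (A x * B y - x / y * B x * A y) / (L * L)"
      using xy by (simp add: L(2) prod_series)
    also have "\<dots> = x * (A x / (x * L) * (B y / L) - B x / L * (A y / (y * L)))"
      using xy L(1) by (simp add: field_simps)
    finally show "theta (x * y) p * theta (x / y) p = x * (A x / (x * L) * (B y / L) - B x / L * (A y / (y * L)))" .
  qed
qed

lemma theta_tendsto:
  assumes p: "norm p < 1" and x: "x \<noteq> 0" and lim: "X \<longlonglongrightarrow> x" and X: "\<And>n. X n \<noteq> 0"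
  shows "(\<lambda>n. theta (X n) p) \<longlonglongrightarrow> theta x p"
proof -
  obtain L where L: "L \<noteq> 0" "\<And>x. x \<noteq> 0 \<Longrightarrow> theta x p = theta_series p x / L"
    using jacobi_triple_product[OF p] by blast
  show ?thesis
    using L x X by (simp add: tendsto_divide theta_series_tendsto[OF p x lim])
qed

section \<open>Elliptic shifted factorials\<close>

locale elliptic_nome =
  fixes p :: complex
  assumes nome: "norm p < 1"
begin

abbreviation th :: "complex \<Rightarrow> complex" where "th x \<equiv> theta x p"

text \<open>This is (c u^m;u,p)_k. Keeping the integer offset m apart from c lets factorials whose
  arguments differ by powers of u share one base point c.\<close>

definition efac :: "complex \<Rightarrow> complex \<Rightarrow> int \<Rightarrow> nat \<Rightarrow> complex" where
  "efac u c m k = (\<Prod>j<k. th (c * u powi (m + int j)))"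

text \<open>
  A multiplicative primitive in \<open>m\<close>: elliptic shifted factorials are quotients of
  values of \<open>egam\<close>, so that shifting parameters by powers of the base only shifts indices.
\<close>

definition egam :: "complex \<Rightarrow> complex \<Rightarrow> int \<Rightarrow> complex" where
  "egam u c m = (if m \<ge> 0 then efac u c 0 (nat m) else 1 / efac u c m (nat (- m)))"

lemma th_inverse: "x \<noteq> 0 \<Longrightarrow> th (1 / x) = - th x / x"
  by (rule theta_inverse[OF nome])

lemma th_one [simp]: "th 1 = 0"
  using th_inverse[of 1] by simp

lemma efac_0 [simp]: "efac u c m 0 = 1"
  by (simp add: efac_def)

lemma efac_Suc: "efac u c m (Suc k) = efac u c m k * th (c * u powi (m + int k))"
  by (simp add: efac_def)

lemma efac_Suc_left: "efac u c m (Suc k) = th (c * u powi m) * efac u c (m + 1) k"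
  unfolding efac_def prod.lessThan_Suc_shift by (simp add: algebra_simps)

lemma efac_shift: "u \<noteq> 0 \<Longrightarrow> efac u (c * u powi i) m k = efac u c (i + m) k"
  unfolding efac_def by (intro prod.cong) (auto simp: power_int_add algebra_simps)

lemma efac_nonzero: "(\<And>j. j \<ge> m \<Longrightarrow> th (c * u powi j) \<noteq> 0) \<Longrightarrow> efac u c m k \<noteq> 0"
  by (auto simp: efac_def)

lemma efac_add: "efac u c m (k + l) = efac u c m k * efac u c (m + int k) l"
  by (induction l) (simp_all add: efac_Suc add.assoc mult.assoc)

lemma egam_nonzero:
  assumes "\<And>j. th (c * u powi j) \<noteq> 0"
  shows "egam u c m \<noteq> 0"
  using assms by (auto simp: egam_def efac_nonzero)

lemma egam_nonzero_pos:
  assumes "\<And>j. j \<ge> 0 \<Longrightarrow> th (c * u powi j) \<noteq> 0" "m \<ge> 0"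
  shows "egam u c m \<noteq> 0"
  using assms by (auto simp: egam_def efac_nonzero)

text \<open>The analogue of the functional equation of the Gamma function. For m < 0 a factor of the
  denominator is cancelled, which must therefore be nonzero.\<close>

lemma egam_Suc:
  assumes "m \<ge> 0 \<or> th (c * u powi m) \<noteq> 0"
  shows "egam u c (m + 1) = egam u c m * th (c * u powi m)"
proof (cases "m \<ge> 0")
  case True
  then have "nat (m + 1) = Suc (nat m)" by simp
  with True show ?thesis by (simp add: egam_def efac_Suc)
next
  case False
  then have "nat (- m) = Suc (nat (- (m + 1)))" by simp
  with False assms show ?thesis
    by (cases "m = -1") (auto simp: egam_def efac_Suc_left)
qed

lemma efac_egam_aux:
  assumes "\<And>j. m \<le> j \<Longrightarrow> j \<ge> 0 \<or> th (c * u powi j) \<noteq> 0"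
  shows "egam u c (m + int k) = egam u c m * efac u c m k"
proof (induction k)
  case (Suc k)
  then show ?case using egam_Suc[of "m + int k" c u] assms
    by (simp add: efac_Suc algebra_simps)
qed simp

lemma efac_egam:
  assumes "\<And>j. th (c * u powi j) \<noteq> 0"
  shows "efac u c m k = egam u c (m + int k) / egam u c m"
  using efac_egam_aux[of m c u k] assms egam_nonzero[of c u m] by simp

text \<open>Meant for the base point c = u, that is for (q^2;q^2,p)_k: at negative indices the
  argument 1, where theta vanishes, would occur.\<close>

lemma efac_egam_pos:
  assumes "\<And>j. j \<ge> 0 \<Longrightarrow> th (c * u powi j) \<noteq> 0" "m \<ge> 0"
  shows "efac u c m k = egam u c (m + int k) / egam u c m"
  using efac_egam_aux[of m c u k] assms egam_nonzero_pos[of c u m] by simp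

lemma th_egam:
  assumes "\<And>j. th (c * u powi j) \<noteq> 0"
  shows "th (c * u powi m) = egam u c (m + 1) / egam u c m"
  using egam_Suc[of m c u] assms egam_nonzero[of c u m] by simp

text \<open>The product of the monomials -c u^(m+j) for j < k, which arises when a shifted factorial
  is reversed.\<close>

definition refl_factor :: "complex \<Rightarrow> complex \<Rightarrow> int \<Rightarrow> nat \<Rightarrow> complex" where
  "refl_factor u c m k = (- c) ^ k * u powi (m * int k + int (tri (int k)))"

text \<open>Each factor is inverted by \<theta>(1/x) = -\<theta>(x)/x. This reverses the order of
  the factors, so the lowest exponent on the right is 1 - m - k.\<close>

lemma efac_reflect:
  assumes "u \<noteq> 0" "c \<noteq> 0"
  shows "efac u (1 / c) m k = refl_factor u (1 / c) m k * efac u c (1 - m - int k) k"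
proof (induction k arbitrary: m)
  case 0
  show ?case by (simp add: refl_factor_def tri_def)
next
  case (Suc k)
  have t: "tri (1 + int k) = tri (int k) + k"
    using tri_Suc[of "int k"] by (simp add: add.commute)
  have r: "refl_factor u (1 / c) m (Suc k) = refl_factor u (1 / c) m k * (- (1 / c) * u powi (m + int k))"
    using assms by (simp add: refl_factor_def t power_int_add algebra_simps)
  have "th (1 / c * u powi (m + int k)) = th (1 / (c * u powi (- m - int k)))"
    using assms by (simp add: power_int_diff power_int_minus power_int_add field_simps)
  also have "\<dots> = - (1 / c) * u powi (m + int k) * th (c * u powi (1 - m - int (Suc k)))"
    using assms by (subst th_inverse) (simp_all add: power_int_diff power_int_minus power_int_add field_simps)
  finally have h: "th (1 / c * u powi (m + int k)) = - (1 / c) * u powi (m + int k) * th (c * u powi (1 - m - int (Suc k)))" .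
  have e: "1 - m - int (Suc k) + 1 = 1 - m - int k" by simp
  have l: "efac u c (1 - m - int (Suc k)) (Suc k) = th (c * u powi (1 - m - int (Suc k))) * efac u c (1 - m - int k) k"
    unfolding efac_Suc_left e ..
  show ?case unfolding efac_Suc[of u "1 / c"] Suc h r l by (simp only: mult_ac)
qed

lemma efac_egam_base:
  assumes "u \<noteq> 0" "c = d * u powi i" "\<And>j. th (d * u powi j) \<noteq> 0"
  shows "efac u c 0 k = egam u d (i + int k) / egam u d i"
  unfolding assms(2) efac_shift[OF assms(1)] using efac_egam[of d u, OF assms(3)] by simp

text \<open>Lets a factorial in y/x be expressed by the same function of an integer as one in
  x/y.\<close>

lemma efac_egam_reflected:
  assumes "u \<noteq> 0" "d \<noteq> 0" "c = 1 / d * u powi i" "\<And>j. th (d * u powi j) \<noteq> 0"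
  shows "efac u c 0 k = refl_factor u (1 / d) i k * egam u d (1 - i) / egam u d (1 - i - int k)"
  unfolding assms(3) efac_shift[OF assms(1)] efac_reflect[OF assms(1,2)]
  using efac_egam[of d u, OF assms(4)] by simp

lemma th_egam_base:
  assumes "c = d * u powi i" "\<And>j. th (d * u powi j) \<noteq> 0"
  shows "th c = egam u d (i + 1) / egam u d i"
  unfolding assms(1) by (rule th_egam[OF assms(2)])

lemma powi_sq: "(q\<^sup>2 :: complex) powi i = q powi (2 * i)"
  by (metis of_nat_numeral power_int_mult power_int_of_nat)

section \<open>Shifting the factors of a summand\<close>

text \<open>
  The part of a summand that depends on the pair \<open>x\<^sub>i = x\<close>, \<open>x\<^sub>j = y\<close>, where \<open>n\<close>, \<open>m\<close>, \<open>k\<close>, \<open>l\<close> stand for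
  \<open>n\<^sub>i\<close>, \<open>n\<^sub>j\<close>, \<open>k\<^sub>i\<close>, \<open>k\<^sub>j\<close>; it contains a factor of the Vandermonde quotient and one of the power of \<open>q\<close>.
\<close>

definition cross_factor ::
    "complex \<Rightarrow> complex \<Rightarrow> complex \<Rightarrow> nat \<Rightarrow> nat \<Rightarrow> nat \<Rightarrow> nat \<Rightarrow> complex" where
  "cross_factor q x y n m k l =
     th (x / y * q powi (2 * int k - 2 * int l)) * q powi (2 * int l) / th (x / y)
     * q powi (- (int k * int l)) / efac (q\<^sup>2) (x * y) 0 (k + l)
     * (efac (q\<^sup>2) (x / y * q powi (- 2 * int m)) 0 k * efac (q\<^sup>2) (x * y * q powi (2 * int m)) 0 k
        / efac (q\<^sup>2) (x / y * q powi 2) 0 k)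
     * (efac (q\<^sup>2) (y / x * q powi (- 2 * int n)) 0 l * efac (q\<^sup>2) (x * y * q powi (2 * int n)) 0 l
        / efac (q\<^sup>2) (y / x * q powi 2) 0 l)"

text \<open>The part belonging to one index, with N for |k|. The last two factors are the quotients
  of (abxq, axq^2/b;q^2,p) at index n by those at index k; with them in place no denominator depends
  on b.\<close>

definition single_factor ::
    "complex \<Rightarrow> complex \<Rightarrow> complex \<Rightarrow> complex \<Rightarrow> nat \<Rightarrow> nat \<Rightarrow> nat \<Rightarrow> complex" where
  "single_factor q a b x n k N =
     th (a * x * q powi (2 * int k + int N)) / th (a * x) * efac q (a * x) 0 N
     * efac q (a / x * q powi 1) 0 (N - k)
     / (efac q (a * x * q powi (2 * int n + 1)) 0 N * efac q (a / x * q powi (1 - 2 * int n)) 0 N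
        * efac q (x / a * q powi (int k - int N)) 0 k)
     * efac (q\<^sup>2) (a * b * x * q powi (1 + 2 * int k)) 0 (n - k)
     * efac (q\<^sup>2) (a * x / b * q powi (2 + 2 * int k)) 0 (n - k)"

definition rhs_factor :: "complex \<Rightarrow> complex \<Rightarrow> complex \<Rightarrow> complex \<Rightarrow> nat \<Rightarrow> complex" where
  "rhs_factor q a b x n =
     efac q (a * x * q powi 1) 0 (2 * n) / efac q (x / a) 0 (2 * n)
     * efac (q\<^sup>2) (x / (a * b) * q powi 1) 0 n * efac (q\<^sup>2) (b * x / a) 0 n"

text \<open>Writing y = y0 v^\<mu> covers both sides of the shift: \<mu> = 0 before, \<mu> = M
  after. Since y0 stays fixed, both are expressed by the same functions X and S and differ only in
  the indices.\<close>

lemma cross_factor_egam: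
  fixes q x y y0 :: complex and \<mu> :: int
  defines "v \<equiv> q\<^sup>2"
  defines "X \<equiv> egam v (x / y0)" and "S \<equiv> egam v (x * y0)"
  assumes q: "q \<noteq> 0" and x: "x \<noteq> 0" and y0: "y0 \<noteq> 0" and y: "y = y0 * v powi \<mu>"
    and gX: "\<And>j. th (x / y0 * v powi j) \<noteq> 0" and gS: "\<And>j. th (x * y0 * v powi j) \<noteq> 0"
  shows "cross_factor q x y n m k l = q powi (- 2 * int n * int l - int k * int l)
     * (X (int k - int l - \<mu> + 1) / X (int k - int l - \<mu>) * X (int k - int m - \<mu>) / X (- int m - \<mu>)
        * X (1 - \<mu> + int n) / (X (1 - \<mu> + int k) * X (1 - \<mu> + int n - int l)) * X (- \<mu> - int l))
     * (S \<mu> * S (int m + \<mu> + int k) * S (int n + \<mu> + int l)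
        / (S (\<mu> + int k + int l) * S (int m + \<mu>) * S (int n + \<mu>)))"
proof -
  have v: "v \<noteq> 0" using q by (simp add: v_def)
  have vp: "v powi i = q powi (2 * i)" for i by (simp add: v_def powi_sq)
  have Xnz: "X i \<noteq> 0" and Snz: "S i \<noteq> 0" for i
    unfolding X_def S_def using egam_nonzero gX gS by blast+
  have dbl: "q powi (2 * i) = q powi i * q powi i" "q powi (i * 2) = q powi i * q powi i" for i
    using q by (simp_all add: mult.commute[of i 2] flip: power_int_add)
  note pw = vp dbl power_int_add power_int_diff power_int_minus power2_eq_square q x y0 field_simps
  have t1: "th (x / y * q powi (2 * int k - 2 * int l)) = X (int k - int l - \<mu> + 1) / X (int k - int l - \<mu>)"
    unfolding X_def by (rule th_egam_base[OF _ gX]) (simp add: y pw)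
  have t2: "th (x / y) = X (1 - \<mu>) / X (- \<mu>)"
  proof -
    have "x / y = x / y0 * v powi (- \<mu>)" using q y0 by (simp add: y v_def power_int_minus field_simps)
    from th_egam_base[OF this gX] show ?thesis by (simp add: X_def)
  qed
  have xy: "x / y0 \<noteq> 0" using x y0 by simp
  have e1: "efac v (x * y) 0 (k + l) = S (\<mu> + int (k + l)) / S \<mu>"
    unfolding S_def by (rule efac_egam_base[OF v _ gS]) (simp add: y)
  have e2: "efac v (x / y * q powi (- 2 * int m)) 0 k = X (- int m - \<mu> + int k) / X (- int m - \<mu>)"
    unfolding X_def by (rule efac_egam_base[OF v _ gX]) (simp add: y pw)
  have e3: "efac v (x * y * q powi (2 * int m)) 0 k = S (int m + \<mu> + int k) / S (int m + \<mu>)"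
    unfolding S_def by (rule efac_egam_base[OF v _ gS]) (simp add: y pw)
  have e4: "efac v (x / y * q powi 2) 0 k = X (1 - \<mu> + int k) / X (1 - \<mu>)"
    unfolding X_def by (rule efac_egam_base[OF v _ gX]) (simp add: y pw)
  have e5: "efac v (y / x * q powi (- 2 * int n)) 0 l
      = refl_factor v (1 / (x / y0)) (\<mu> - int n) l * X (1 - (\<mu> - int n)) / X (1 - (\<mu> - int n) - int l)"
    unfolding X_def by (rule efac_egam_reflected[OF v xy _ gX]) (simp add: y pw)
  have e6: "efac v (x * y * q powi (2 * int n)) 0 l = S (int n + \<mu> + int l) / S (int n + \<mu>)"
    unfolding S_def by (rule efac_egam_base[OF v _ gS]) (simp add: y pw)
  have e7: "efac v (y / x * q powi 2) 0 l
      = refl_factor v (1 / (x / y0)) (1 + \<mu>) l * X (1 - (1 + \<mu>)) / X (1 - (1 + \<mu>) - int l)"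
    unfolding X_def by (rule efac_egam_reflected[OF v xy _ gX]) (simp add: y pw)
  have i: "\<mu> + int (k + l) = \<mu> + int k + int l" "- int m - \<mu> + int k = int k - int m - \<mu>"
    "1 - (\<mu> - int n) = 1 - \<mu> + int n" "1 - (1 + \<mu>) = - \<mu>" by simp_all
  \<comment> \<open>Both factors in y/x are reversed from the same base point, so the quotient of
    their monomials is a pure power of q.\<close>
  have r: "refl_factor v (1 / (x / y0)) (\<mu> - int n) l
      = refl_factor v (1 / (x / y0)) (1 + \<mu>) l * q powi (- 2 * int l - 2 * int n * int l)"
    unfolding refl_factor_def vp using q by (simp add: power_int_add[symmetric] algebra_simps)
  have rnz: "refl_factor v (1 / (x / y0)) (1 + \<mu>) l \<noteq> 0"
    using q x y0 by (simp add: refl_factor_def v_def)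
  have qq: "q powi (2 * int l) * q powi (- (int k * int l)) * q powi (- 2 * int l - 2 * int n * int l)
      = q powi (- 2 * int n * int l - int k * int l)"
    unfolding power_int_add[OF disjI1[OF q], symmetric]
    by (rule arg_cong[where f = "\<lambda>i. q powi i"]) (simp add: algebra_simps)
  show ?thesis
    unfolding cross_factor_def v_def[symmetric] t1 t2 e1 e2 e3 e4 e5 e6 e7 i r qq[symmetric]
    using Xnz Snz rnz by (simp add: divide_simps)
qed


text \<open>The monomials come from reversing (aq/x;q,p)_{N-k} and (aq^(1-2n)/x;q,p)_N; in the
  quotient the terms quadratic in N cancel.\<close>

lemma refl_factor_quotient:
  assumes u: "u \<noteq> 0" and c: "c \<noteq> 0" and kN: "k \<le> N"
  shows "refl_factor u (1 / c) (1 + \<mu>) (N - k) / refl_factor u (1 / c) (\<mu> + 1 - 2 * int n) N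
    = (- c) ^ k * u powi (int (tri (int k + 1)) - (1 + \<mu> + int N) * int k + 2 * int n * int N)"
proof -
  have t: "int (tri (int (N - k))) = int (tri (int N)) + int (tri (int k + 1)) - int N * int k"
  proof -
    have "int (N - k) = int N - int k" using kN by (simp add: of_nat_diff)
    then show ?thesis
      using tri_int[of "int N - int k"] tri_int[of "int N"] tri_int[of "int k + 1"]
      by (simp add: algebra_simps)
  qed
  have e: "(1 + \<mu>) * int (N - k) + int (tri (int (N - k)))
     = (\<mu> + 1 - 2 * int n) * int N + int (tri (int N))
       + (int (tri (int k + 1)) - (1 + \<mu> + int N) * int k + 2 * int n * int N)"
    using kN unfolding t by (simp add: of_nat_diff algebra_simps)
  have "(- (1 / c)) ^ N = (- (1 / c)) ^ (N - k) * (- (1 / c)) ^ k"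
    using kN by (simp flip: power_add)
  moreover have "(- (1 / c)) ^ k * (- c) ^ k = 1"
    using c by (simp flip: power_mult_distrib)
  ultimately have cc: "(- (1 / c)) ^ (N - k) = (- (1 / c)) ^ N * (- c) ^ k" by (simp add: mult_ac)
  have nz: "refl_factor u (1 / c) (\<mu> + 1 - 2 * int n) N \<noteq> 0"
    using u c by (simp add: refl_factor_def)
  have "refl_factor u (1 / c) (1 + \<mu>) (N - k) = refl_factor u (1 / c) (\<mu> + 1 - 2 * int n) N *
     ((- c) ^ k * u powi (int (tri (int k + 1)) - (1 + \<mu> + int N) * int k + 2 * int n * int N))"
    unfolding refl_factor_def e cc power_int_add[OF disjI1[OF u], of "(\<mu> + 1 - 2 * int n) * int N + int (tri (int N))"]
    by (simp only: mult_ac)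
  then show ?thesis using nz by (simp only: nonzero_mult_div_cancel_left simp_thms)
qed

text \<open>For this b the argument abxq is x/y0 times a power of q^2, and xq/(ab) is x y0 times
  such a power. Hence the functions X and S of \<open>cross_factor_egam\<close> reappear. The factor
  \<open>rhs_factor\<close> is split off because only the quotient by the right-hand side is
  invariant under the shift.\<close>

lemma single_factor_egam:
  fixes q a b x a0 y0 :: complex and \<mu> M :: int
  defines "v \<equiv> q\<^sup>2"
  defines "A \<equiv> egam q (a0 * x)" and "B \<equiv> egam q (x / a0)"
    and "X \<equiv> egam v (x / y0)" and "S \<equiv> egam v (x * y0)"
    and "D \<equiv> egam v (a0\<^sup>2 * x * y0 * q)" and "H \<equiv> egam v (x / (a0\<^sup>2 * y0 * q))"
  assumes q: "q \<noteq> 0" and x: "x \<noteq> 0" and y0: "y0 \<noteq> 0" and a0: "a0 \<noteq> 0"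
    and a: "a = a0 * q powi \<mu>" and b: "b = q powi (1 - 2 * M + \<mu>) / (a0 * y0)"
    and gA: "\<And>j. th (a0 * x * q powi j) \<noteq> 0" and gB: "\<And>j. th (x / a0 * q powi j) \<noteq> 0"
    and gX: "\<And>j. th (x / y0 * v powi j) \<noteq> 0" and gS: "\<And>j. th (x * y0 * v powi j) \<noteq> 0"
    and gD: "\<And>j. th (a0\<^sup>2 * x * y0 * q * v powi j) \<noteq> 0"
    and gH: "\<And>j. th (x / (a0\<^sup>2 * y0 * q) * v powi j) \<noteq> 0"
    and kN: "k \<le> N" and kn: "k \<le> n"
  shows "single_factor q a b x n k N = rhs_factor q a b x n
     * ((- (x / a0)) ^ k * q powi (int (tri (int k + 1)) - (1 + \<mu> + int N) * int k + 2 * int n * int N))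
     * (A (\<mu> + int N + 2 * int k + 1) * A (\<mu> + int N)
         / (A (\<mu> + int N + 2 * int k) * A (\<mu> + int N + 2 * int n + 1)))
     * (B (2 * int n - \<mu> - int N) / B (2 * int k - \<mu> - int N))
     * (X (1 - M + \<mu> + int n) / X (1 - M + \<mu> + int k)) * (S (M - \<mu>) / S (M - \<mu> + int n))
     * (D (M + int n) / D (M + int k)) * (H (1 - M) / H (1 - M + int n))"
    and "rhs_factor q a b x n \<noteq> 0"
proof -
  have v: "v \<noteq> 0" using q by (simp add: v_def)
  have vp: "v powi i = q powi (2 * i)" for i by (simp add: v_def powi_sq)
  have nz: "A i \<noteq> 0" "B i \<noteq> 0" "X i \<noteq> 0" "S i \<noteq> 0" "D i \<noteq> 0" "H i \<noteq> 0" for i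
    unfolding A_def B_def X_def S_def D_def H_def using egam_nonzero gA gB gX gS gD gH by blast+
  have xa: "x / a0 \<noteq> 0" using x a0 by simp
  have dbl: "q powi (2 * i) = q powi i * q powi i" "q powi (i * 2) = q powi i * q powi i" for i
    using q by (simp_all add: mult.commute[of i 2] flip: power_int_add)
  note pw = vp dbl power_int_add power_int_diff power_int_minus power2_eq_square q x y0 a0 field_simps
  have t1: "th (a * x * q powi (2 * int k + int N)) = A (\<mu> + int N + 2 * int k + 1) / A (\<mu> + int N + 2 * int k)"
    unfolding A_def by (rule th_egam_base[OF _ gA]) (simp add: a pw)
  have t2: "th (a * x) = A (\<mu> + 1) / A \<mu>"
    unfolding A_def by (rule th_egam_base[OF _ gA]) (simp add: a pw)
  have e1: "efac q (a * x) 0 N = A (\<mu> + int N) / A \<mu>"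
    unfolding A_def by (rule efac_egam_base[OF q _ gA]) (simp add: a pw)
  have e2: "efac q (a / x * q powi 1) 0 (N - k) = refl_factor q (1 / (x / a0)) (1 + \<mu>) (N - k)
      * B (1 - (1 + \<mu>)) / B (1 - (1 + \<mu>) - int (N - k))"
    unfolding B_def by (rule efac_egam_reflected[OF q xa _ gB]) (simp add: a pw)
  have e3: "efac q (a * x * q powi (2 * int n + 1)) 0 N = A (\<mu> + 2 * int n + 1 + int N) / A (\<mu> + 2 * int n + 1)"
    unfolding A_def by (rule efac_egam_base[OF q _ gA]) (simp add: a pw)
  have e4: "efac q (a / x * q powi (1 - 2 * int n)) 0 N = refl_factor q (1 / (x / a0)) (\<mu> + 1 - 2 * int n) N
      * B (1 - (\<mu> + 1 - 2 * int n)) / B (1 - (\<mu> + 1 - 2 * int n) - int N)"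
    unfolding B_def by (rule efac_egam_reflected[OF q xa _ gB]) (simp add: a pw)
  have e5: "efac q (x / a * q powi (int k - int N)) 0 k = B (int k - int N - \<mu> + int k) / B (int k - int N - \<mu>)"
    unfolding B_def by (rule efac_egam_base[OF q _ gB]) (simp add: a pw)
  have e6: "efac v (a * b * x * q powi (1 + 2 * int k)) 0 (n - k)
      = X (1 - M + \<mu> + int k + int (n - k)) / X (1 - M + \<mu> + int k)"
    unfolding X_def by (rule efac_egam_base[OF v _ gX]) (simp add: a b pw)
  have e7: "efac v (a * x / b * q powi (2 + 2 * int k)) 0 (n - k) = D (M + int k + int (n - k)) / D (M + int k)"
    unfolding D_def by (rule efac_egam_base[OF v _ gD]) (simp add: a b pw)
  have r1: "efac q (a * x * q powi 1) 0 (2 * n) = A (\<mu> + 1 + int (2 * n)) / A (\<mu> + 1)"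
    unfolding A_def by (rule efac_egam_base[OF q _ gA]) (simp add: a pw)
  have r2: "efac q (x / a) 0 (2 * n) = B (- \<mu> + int (2 * n)) / B (- \<mu>)"
    unfolding B_def by (rule efac_egam_base[OF q _ gB]) (simp add: a pw)
  have r3: "efac v (x / (a * b) * q powi 1) 0 n = S (M - \<mu> + int n) / S (M - \<mu>)"
    unfolding S_def by (rule efac_egam_base[OF v _ gS]) (simp add: a b pw)
  have r4: "efac v (b * x / a) 0 n = H (1 - M + int n) / H (1 - M)"
    unfolding H_def by (rule efac_egam_base[OF v _ gH]) (simp add: a b pw)
  let ?r1 = "refl_factor q (1 / (x / a0)) (1 + \<mu>) (N - k)"
    and ?r2 = "refl_factor q (1 / (x / a0)) (\<mu> + 1 - 2 * int n) N"
  have rnz: "?r2 \<noteq> 0" using q xa by (simp add: refl_factor_def)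
  note R = refl_factor_quotient[OF q xa kN, of \<mu> n]
  have i: "1 - (1 + \<mu>) = - \<mu>" "- \<mu> - int (N - k) = int k - int N - \<mu>"
    "1 - (\<mu> + 1 - 2 * int n) = 2 * int n - \<mu>" "1 - (\<mu> + 1 - 2 * int n) - int N = 2 * int n - \<mu> - int N"
    "int k - int N - \<mu> + int k = 2 * int k - \<mu> - int N"
    "1 - M + \<mu> + int k + int (n - k) = 1 - M + \<mu> + int n" "M + int k + int (n - k) = M + int n"
    "\<mu> + 2 * int n + 1 + int N = \<mu> + int N + 2 * int n + 1"
    "\<mu> + 1 + int (2 * n) = \<mu> + 2 * int n + 1" "- \<mu> + int (2 * n) = 2 * int n - \<mu>"
    using kN kn by (simp_all add: of_nat_diff)
  show "rhs_factor q a b x n \<noteq> 0"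
    unfolding rhs_factor_def v_def[symmetric] r1 r2 r3 r4 using nz by simp
  show "single_factor q a b x n k N = rhs_factor q a b x n
     * ((- (x / a0)) ^ k * q powi (int (tri (int k + 1)) - (1 + \<mu> + int N) * int k + 2 * int n * int N))
     * (A (\<mu> + int N + 2 * int k + 1) * A (\<mu> + int N)
         / (A (\<mu> + int N + 2 * int k) * A (\<mu> + int N + 2 * int n + 1)))
     * (B (2 * int n - \<mu> - int N) / B (2 * int k - \<mu> - int N))
     * (X (1 - M + \<mu> + int n) / X (1 - M + \<mu> + int k)) * (S (M - \<mu>) / S (M - \<mu> + int n))
     * (D (M + int n) / D (M + int k)) * (H (1 - M) / H (1 - M + int n))"
    unfolding R[symmetric] single_factor_def rhs_factor_def v_def[symmetric]
      t1 t2 e1 e2 e3 e4 e5 e6 e7 r1 r2 r3 r4 i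
    using nz rnz by (simp add: divide_simps)
qed


text \<open>Relative to \<open>rhs_factor\<close>, the parts in A, B, D and H agree before and after
  the shift. The parts in X and S agree only after the contribution of the pair is multiplied by
  that of the single index, so the two factors have to be treated together.\<close>

lemma cross_single_shift:
  fixes q a x y :: complex and M :: nat
  defines "b \<equiv> q powi (1 - 2 * int M) / (a * y)"
    and "a' \<equiv> a * q powi int M" and "y' \<equiv> y * q powi (2 * int M)"
    and "b' \<equiv> q powi (1 - int M) / (a * y)"
  assumes q: "q \<noteq> 0" and x: "x \<noteq> 0" and y: "y \<noteq> 0" and a: "a \<noteq> 0"
    and gA: "\<And>j. th (a * x * q powi j) \<noteq> 0" and gB: "\<And>j. th (x / a * q powi j) \<noteq> 0"
    and gX: "\<And>j. th (x / y * q powi j) \<noteq> 0" and gS: "\<And>j. th (x * y * q powi j) \<noteq> 0"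
    and gD: "\<And>j. th (a\<^sup>2 * x * y * q powi j) \<noteq> 0"
    and gH: "\<And>j. th (x / (a\<^sup>2 * y) * q powi j) \<noteq> 0"
    and kN: "k \<le> N" and kn: "k \<le> n"
  shows "cross_factor q x y n (m + M) k (l + M) * single_factor q a b x n k (N + M) * rhs_factor q a' b' x n
       = q powi (- (int M * int k)) *
         (cross_factor q x y' n m k l * single_factor q a' b' x n k N * rhs_factor q a b x n)"
proof -
  let ?v = "q\<^sup>2"
  have gX2: "\<And>j. th (x / y * ?v powi j) \<noteq> 0" and gS2: "\<And>j. th (x * y * ?v powi j) \<noteq> 0"
    unfolding powi_sq by (rule gX, rule gS)
  have gD2: "\<And>j. th (a\<^sup>2 * x * y * q * ?v powi j) \<noteq> 0"
  proof -
    fix j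
    have "a\<^sup>2 * x * y * q * ?v powi j = a\<^sup>2 * x * y * q powi (1 + 2 * j)"
      using q by (simp add: powi_sq power_int_add)
    then show "th (a\<^sup>2 * x * y * q * ?v powi j) \<noteq> 0" by (simp only: gD not_False_eq_True)
  qed
  have gH2: "\<And>j. th (x / (a\<^sup>2 * y * q) * ?v powi j) \<noteq> 0"
  proof -
    fix j
    have "x / (a\<^sup>2 * y * q) * ?v powi j = x / (a\<^sup>2 * y) * q powi (2 * j - 1)"
      using q by (simp add: powi_sq power_int_diff)
    then show "th (x / (a\<^sup>2 * y * q) * ?v powi j) \<noteq> 0" by (simp only: gH not_False_eq_True)
  qed
  have kN': "k \<le> N + M" using kN by simp
  have a0: "a = a * q powi 0" and b0: "b = q powi (1 - 2 * int M + 0) / (a * y)"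
    and b1: "b' = q powi (1 - 2 * int M + int M) / (a * y)"
    and a1: "a' = a * q powi int M"
    and y0: "y = y * ?v powi 0" and y1: "y' = y * ?v powi int M"
    unfolding powi_sq by (simp_all add: b_def b'_def a'_def y'_def)
  note c0 = cross_factor_egam[OF q x y y0 gX2 gS2, of n "m + M" k "l + M"]
    and c1 = cross_factor_egam[OF q x y y1 gX2 gS2, of n m k l]
    and s0 = single_factor_egam(1)[OF q x y a a0 b0 gA gB gX2 gS2 gD2 gH2 kN' kn]
    and s1 = single_factor_egam(1)[OF q x y a a1 b1 gA gB gX2 gS2 gD2 gH2 kN kn]
  define A B X S D H where "A = egam q (a * x)" and "B = egam q (x / a)"
    and "X = egam ?v (x / y)" and "S = egam ?v (x * y)"
    and "D = egam ?v (a\<^sup>2 * x * y * q)" and "H = egam ?v (x / (a\<^sup>2 * y * q))"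
  have nz: "A i \<noteq> 0" "B i \<noteq> 0" "X i \<noteq> 0" "S i \<noteq> 0" "D i \<noteq> 0" "H i \<noteq> 0" for i
    unfolding A_def B_def X_def S_def D_def H_def using egam_nonzero gA gB gX2 gS2 gD2 gH2 by blast+
  note f = A_def[symmetric] B_def[symmetric] X_def[symmetric] S_def[symmetric] D_def[symmetric] H_def[symmetric]
  \<comment> \<open>Of the powers of q, the terms in nM cancel between the pair and the single
    index, and the exponent -Mk remains.\<close>
  have P: "q powi (- 2 * int n * int (l + M) - int k * int (l + M)) *
      q powi (int (tri (int k + 1)) - (1 + 0 + int (N + M)) * int k + 2 * int n * int (N + M))
    = q powi (- (int M * int k)) * (q powi (- 2 * int n * int l - int k * int l) *
      q powi (int (tri (int k + 1)) - (1 + int M + int N) * int k + 2 * int n * int N))"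
    unfolding power_int_add[OF disjI1[OF q], symmetric]
    by (rule arg_cong[where f = "\<lambda>i. q powi i"]) (simp add: algebra_simps)
  have comm: "- int m - int M = - int M - int m" by simp
  have rearrange: "(p1 * X0 * S0) * (R * (c * p2) * A0 * B0 * X0' * S0' * D0 * H0) * R'
      = p0 * ((p3 * X1 * S1) * (R' * (c * p4) * A1 * B1 * X1' * S1' * D1 * H1) * R)"
    if "p1 * p2 = p0 * (p3 * p4)" "X0 * X0' = X1 * X1'" "S0 * S0' = S1 * S1'"
      "A0 = A1" "B0 = B1" "D0 = D1" "H0 = H1"
    for p0 p1 p2 p3 p4 X0 X1 X0' X1' S0 S1 S0' S1' R R' c A0 A1 B0 B1 D0 D1 H0 H1 :: complex
  proof -
    have "(p1 * X0 * S0) * (R * (c * p2) * A0 * B0 * X0' * S0' * D0 * H0) * R'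
      = (p1 * p2) * (X0 * X0') * (S0 * S0') * (R * c * A0 * B0 * D0 * H0 * R')" by (simp only: mult_ac)
    also have "\<dots> = p0 * ((p3 * X1 * S1) * (R' * (c * p4) * A1 * B1 * X1' * S1' * D1 * H1) * R)"
      unfolding that by (simp only: mult_ac)
    finally show ?thesis .
  qed
  show ?thesis
    unfolding c0 c1 s0 s1 f
    by (rule rearrange[OF P]) (simp_all add: algebra_simps comm)
qed


definition diag_factor :: "complex \<Rightarrow> complex \<Rightarrow> nat \<Rightarrow> nat \<Rightarrow> complex" where
  "diag_factor q y m l = efac (q\<^sup>2) (q powi (- 2 * int m)) 0 l * efac (q\<^sup>2) (y\<^sup>2 * q powi (2 * int m)) 0 l
     / efac (q\<^sup>2) (q powi 2) 0 l"

definition global_factor :: "complex \<Rightarrow> complex \<Rightarrow> complex \<Rightarrow> nat \<Rightarrow> complex" where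
  "global_factor q a b N = q powi int N * efac (q\<^sup>2) (a\<^sup>2 * q) 0 N * efac q b 0 N * efac q (q / b) 0 N"

text \<open>The factors of the distinguished index s, together with those that depend only on |k|.
  Here abyq is itself a power of q^2, so its factorial contains no free parameter; the condition
  2\<mu> - M + l \<ge> 0 keeps its arguments clear of 1, where theta vanishes.\<close>

lemma diag_single_egam:
  fixes q a b y a0 y0 :: complex and \<mu> M :: int
  defines "v \<equiv> q\<^sup>2"
  defines "A \<equiv> egam q (a0 * y0)" and "B \<equiv> egam q (y0 / a0)" and "C \<equiv> egam v (a0\<^sup>2 * q)"
    and "I \<equiv> egam v v" and "F \<equiv> egam v (y0\<^sup>2)" and "G \<equiv> egam v (a0\<^sup>2 * y0\<^sup>2 * q)"
  assumes q: "q \<noteq> 0" and y0: "y0 \<noteq> 0" and a0: "a0 \<noteq> 0"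
    and a: "a = a0 * q powi \<mu>" and y: "y = y0 * v powi \<mu>" and b: "b = q powi (1 - 2 * M + \<mu>) / (a0 * y0)"
    and gA: "\<And>j. th (a0 * y0 * q powi j) \<noteq> 0" and gB: "\<And>j. th (y0 / a0 * q powi j) \<noteq> 0"
    and gC: "\<And>j. th (a0\<^sup>2 * q * v powi j) \<noteq> 0" and gI0: "\<forall>j\<ge>0. th (v * v powi j) \<noteq> 0"
    and gF: "\<And>j. th (y0\<^sup>2 * v powi j) \<noteq> 0" and gG: "\<And>j. th (a0\<^sup>2 * y0\<^sup>2 * q * v powi j) \<noteq> 0"
    and lN: "l \<le> N" and lm: "l \<le> m" and l: "2 * \<mu> - M + int l \<ge> 0"
  shows "single_factor q a b y m l N * diag_factor q y m l * global_factor q a b N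
    = rhs_factor q a b y m * (q powi int N * refl_factor q (1 / (a0 * y0)) (1 - 2 * M + \<mu>) N
        * ((- (y0 / a0)) ^ l * q powi (int (tri (int l + 1)) - (1 - \<mu> + int N) * int l + 2 * int m * int N))
        * refl_factor v 1 (- int m) l / refl_factor v (1 / (a0\<^sup>2 * q)) (1 - M + \<mu>) m)
     * (A (3 * \<mu> + 2 * int l + int N + 1) * A (3 * \<mu> + int N) * A (2 * M - \<mu> + int N)
         / (A (3 * \<mu> + 2 * int l + int N) * A (3 * \<mu> + 2 * int m + int N + 1) * A (2 * M - \<mu> - int N)))
     * (B (2 * int m + \<mu> - int N) / B (2 * int l + \<mu> - int N))
     * (C (\<mu> + int N) * C (M - \<mu> - int m) / (C \<mu> * C (M - \<mu>)))
     * (I (2 * \<mu> - M + int m) * I (int m) * I 0 / (I (2 * \<mu> - M + int l) * I (int l) * I (int m - int l)))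
     * (F (2 * \<mu> + int m + int l) * F M / (F (2 * \<mu> + int m) * F (M + int m)))
     * (G (M + \<mu> + int m) / G (M + \<mu> + int l))"
    and "rhs_factor q a b y m \<noteq> 0"
proof -
  have v: "v \<noteq> 0" using q by (simp add: v_def)
  have vp: "v powi i = q powi (2 * i)" for i by (simp add: v_def powi_sq)
  have nz: "A i \<noteq> 0" "B i \<noteq> 0" "C i \<noteq> 0" "F i \<noteq> 0" "G i \<noteq> 0" for i
    unfolding A_def B_def C_def F_def G_def using egam_nonzero gA gB gC gF gG by blast+
  have gI: "th (v * v powi j) \<noteq> 0" if "j \<ge> 0" for j using gI0 that by blast
  have Inz: "I i \<noteq> 0" if "i \<ge> 0" for i unfolding I_def using egam_nonzero_pos gI that by blast
  have ya: "y0 / a0 \<noteq> 0" and ay: "a0 * y0 \<noteq> 0" and aq: "a0\<^sup>2 * q \<noteq> 0" using y0 a0 q by simp_all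
  have dbl: "q powi (2 * i) = q powi i * q powi i" "q powi (i * 2) = q powi i * q powi i"
     "q powi (3 * i) = q powi i * q powi i * q powi i" "q powi (i * 3) = q powi i * q powi i * q powi i"
     "q powi (i * 4) = q powi i * q powi i * (q powi i * q powi i)" for i
    using q by (simp_all add: mult.commute[of i 2] mult.commute[of i 3] mult.commute[of i 4] flip: power_int_add)
  note pw = vp dbl power_int_add power_int_diff power_int_minus power2_eq_square q y0 a0 field_simps
  have t1: "th (a * y * q powi (2 * int l + int N))
      = A (3 * \<mu> + 2 * int l + int N + 1) / A (3 * \<mu> + 2 * int l + int N)"
    unfolding A_def by (rule th_egam_base[OF _ gA]) (simp add: a y pw)
  have t2: "th (a * y) = A (3 * \<mu> + 1) / A (3 * \<mu>)"
    unfolding A_def by (rule th_egam_base[OF _ gA]) (simp add: a y pw)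
  have e1: "efac q (a * y) 0 N = A (3 * \<mu> + int N) / A (3 * \<mu>)"
    unfolding A_def by (rule efac_egam_base[OF q _ gA]) (simp add: a y pw)
  have e2: "efac q (a / y * q powi 1) 0 (N - l) = refl_factor q (1 / (y0 / a0)) (1 + (- \<mu>)) (N - l)
      * B (1 - (1 + (- \<mu>))) / B (1 - (1 + (- \<mu>)) - int (N - l))"
    unfolding B_def by (rule efac_egam_reflected[OF q ya _ gB]) (simp add: a y pw)
  have e3: "efac q (a * y * q powi (2 * int m + 1)) 0 N
      = A (3 * \<mu> + 2 * int m + 1 + int N) / A (3 * \<mu> + 2 * int m + 1)"
    unfolding A_def by (rule efac_egam_base[OF q _ gA]) (simp add: a y pw)
  have e4: "efac q (a / y * q powi (1 - 2 * int m)) 0 N = refl_factor q (1 / (y0 / a0)) ((- \<mu>) + 1 - 2 * int m) N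
      * B (1 - ((- \<mu>) + 1 - 2 * int m)) / B (1 - ((- \<mu>) + 1 - 2 * int m) - int N)"
    unfolding B_def by (rule efac_egam_reflected[OF q ya _ gB]) (simp add: a y pw)
  have e5: "efac q (y / a * q powi (int l - int N)) 0 l = B (int l - int N + \<mu> + int l) / B (int l - int N + \<mu>)"
    unfolding B_def by (rule efac_egam_base[OF q _ gB]) (simp add: a y pw)
  have e6: "efac v (a * b * y * q powi (1 + 2 * int l)) 0 (m - l)
      = I (2 * \<mu> - M + int l + int (m - l)) / I (2 * \<mu> - M + int l)"
  proof -
    have "a * b * y * q powi (1 + 2 * int l) = v * v powi (2 * \<mu> - M + int l)"
    proof -
      have "a * b * y * q powi (1 + 2 * int l)
          = q powi \<mu> * q powi (1 - 2 * M + \<mu>) * q powi (2 * \<mu>) * q powi (1 + 2 * int l)"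
        using a0 y0 by (simp add: a b y vp)
      also have "\<dots> = q powi 2 * q powi (2 * (2 * \<mu> - M + int l))"
        unfolding power_int_add[OF disjI1[OF q], symmetric]
        by (rule arg_cong[where f = "\<lambda>i. q powi i"]) simp
      finally show ?thesis unfolding vp by (simp add: v_def)
    qed
    then show ?thesis unfolding I_def efac_shift[OF v] using efac_egam_pos[OF gI l] efac_shift[OF v] by simp
  qed
  have e7: "efac v (a * y / b * q powi (2 + 2 * int l)) 0 (m - l)
      = G (M + \<mu> + int l + int (m - l)) / G (M + \<mu> + int l)"
    unfolding G_def by (rule efac_egam_base[OF v _ gG]) (simp add: a b y pw)
  have r1: "efac q (a * y * q powi 1) 0 (2 * m) = A (3 * \<mu> + 1 + int (2 * m)) / A (3 * \<mu> + 1)"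
    unfolding A_def by (rule efac_egam_base[OF q _ gA]) (simp add: a y pw)
  have r2: "efac q (y / a) 0 (2 * m) = B (\<mu> + int (2 * m)) / B \<mu>"
    unfolding B_def by (rule efac_egam_base[OF q _ gB]) (simp add: a y pw)
  have r3: "efac v (y / (a * b) * q powi 1) 0 m = F (M + int m) / F M"
    unfolding F_def by (rule efac_egam_base[OF v _ gF]) (simp add: a b y pw)
  have r4: "efac v (b * y / a) 0 m = refl_factor v (1 / (a0\<^sup>2 * q)) (1 - M + \<mu>) m
      * C (1 - (1 - M + \<mu>)) / C (1 - (1 - M + \<mu>) - int m)"
    unfolding C_def by (rule efac_egam_reflected[OF v aq _ gC]) (simp add: a b y pw)
  have d1: "efac v (q powi (- 2 * int m)) 0 l = refl_factor v 1 (- int m) l * (I (int m) / I (int m - int l))"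
  proof -
    \<comment> \<open>Reversal with c = 1; the result is moved to the base point v, where indices
      are non-negative because l \<le> m.\<close>
    have e: "q powi (- 2 * int m) = 1 * v powi (- int m)" by (simp add: vp)
    have "efac v (q powi (- 2 * int m)) 0 l = efac v (1 / 1) (- int m) l"
      unfolding e efac_shift[OF v] by simp
    also have "\<dots> = refl_factor v 1 (- int m) l * efac v 1 (1 - (- int m) - int l) l"
      using efac_reflect[OF v one_neq_zero, of "- int m" l] by (simp only: div_by_1)
    also have "1 - (- int m) - int l = 1 + (int m - int l)" by simp
    also have "efac v 1 (1 + (int m - int l)) l = efac v v (int m - int l) l"
      using efac_shift[OF v, of 1 1 "int m - int l" l] by (simp only: mult_1 power_int_1_right)
    also have "efac v v (int m - int l) l = I (int m) / I (int m - int l)"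
      unfolding I_def using efac_egam_pos[OF gI, of "int m - int l" l] lm by simp
    finally show ?thesis .
  qed
  have d2: "efac v (y\<^sup>2 * q powi (2 * int m)) 0 l = F (2 * \<mu> + int m + int l) / F (2 * \<mu> + int m)"
    unfolding F_def by (rule efac_egam_base[OF v _ gF]) (simp add: y pw)
  have d3: "efac v (q powi 2) 0 l = I (int l) / I 0"
    unfolding I_def using efac_egam_pos[OF gI, of 0 l] by (simp add: v_def)
  have g1: "efac v (a\<^sup>2 * q) 0 N = C (\<mu> + int N) / C \<mu>"
    unfolding C_def by (rule efac_egam_base[OF v _ gC]) (simp add: a pw)
  have g2: "efac q b 0 N = refl_factor q (1 / (a0 * y0)) (1 - 2 * M + \<mu>) N
      * A (1 - (1 - 2 * M + \<mu>)) / A (1 - (1 - 2 * M + \<mu>) - int N)"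
    unfolding A_def by (rule efac_egam_reflected[OF q ay _ gA]) (simp add: b pw)
  have g3: "efac q (q / b) 0 N = A (2 * M - \<mu> + int N) / A (2 * M - \<mu>)"
    unfolding A_def by (rule efac_egam_base[OF q _ gA]) (simp add: b pw)
  have i: "1 - (1 + (- \<mu>)) = \<mu>" "\<mu> - int (N - l) = int l - int N + \<mu>"
    "1 - ((- \<mu>) + 1 - 2 * int m) = 2 * int m + \<mu>"
    "int l - int N + \<mu> + int l = 2 * int l + \<mu> - int N"
    "2 * \<mu> - M + int l + int (m - l) = 2 * \<mu> - M + int m" "M + \<mu> + int l + int (m - l) = M + \<mu> + int m"
    "3 * \<mu> + 2 * int m + 1 + int N = 3 * \<mu> + 2 * int m + int N + 1"
    "3 * \<mu> + 1 + int (2 * m) = 3 * \<mu> + 2 * int m + 1" "\<mu> + int (2 * m) = 2 * int m + \<mu>"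
    "1 - (1 - M + \<mu>) = M - \<mu>" "1 - (1 - 2 * M + \<mu>) = 2 * M - \<mu>"
    using lN lm by (simp_all add: of_nat_diff)
  have rnz: "refl_factor q (1 / (y0 / a0)) ((- \<mu>) + 1 - 2 * int m) N \<noteq> 0"
    "refl_factor v (1 / (a0\<^sup>2 * q)) (1 - M + \<mu>) m \<noteq> 0"
    using q v ya aq by (simp_all add: refl_factor_def)
  note R = refl_factor_quotient[OF q ya lN, of "- \<mu>" m]
  have neg: "1 - \<mu> = 1 + (- \<mu>)" by simp
  have Inz': "I 0 \<noteq> 0" "I (int m) \<noteq> 0" "I (int l) \<noteq> 0" "I (int m - int l) \<noteq> 0"
    "I (2 * \<mu> - M + int l) \<noteq> 0" using lm l by (auto intro!: Inz)
  show "rhs_factor q a b y m \<noteq> 0"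
    unfolding rhs_factor_def v_def[symmetric] r1 r2 r3 r4 using nz rnz by simp
  show "single_factor q a b y m l N * diag_factor q y m l * global_factor q a b N
    = rhs_factor q a b y m * (q powi int N * refl_factor q (1 / (a0 * y0)) (1 - 2 * M + \<mu>) N
        * ((- (y0 / a0)) ^ l * q powi (int (tri (int l + 1)) - (1 - \<mu> + int N) * int l + 2 * int m * int N))
        * refl_factor v 1 (- int m) l / refl_factor v (1 / (a0\<^sup>2 * q)) (1 - M + \<mu>) m)
     * (A (3 * \<mu> + 2 * int l + int N + 1) * A (3 * \<mu> + int N) * A (2 * M - \<mu> + int N)
         / (A (3 * \<mu> + 2 * int l + int N) * A (3 * \<mu> + 2 * int m + int N + 1) * A (2 * M - \<mu> - int N)))
     * (B (2 * int m + \<mu> - int N) / B (2 * int l + \<mu> - int N))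
     * (C (\<mu> + int N) * C (M - \<mu> - int m) / (C \<mu> * C (M - \<mu>)))
     * (I (2 * \<mu> - M + int m) * I (int m) * I 0 / (I (2 * \<mu> - M + int l) * I (int l) * I (int m - int l)))
     * (F (2 * \<mu> + int m + int l) * F M / (F (2 * \<mu> + int m) * F (M + int m)))
     * (G (M + \<mu> + int m) / G (M + \<mu> + int l))"
    unfolding neg R[symmetric] single_factor_def diag_factor_def global_factor_def rhs_factor_def v_def[symmetric]
      t1 t2 e1 e2 e3 e4 e5 e6 e7 r1 r2 r3 r4 d1 d2 d3 g1 g2 g3
    unfolding i
    using nz rnz Inz' by (simp add: divide_simps)
qed


lemma tri_add: "int (tri (i + j)) = int (tri i) + int (tri j) + i * j"
  using tri_int[of "i + j"] tri_int[of i] tri_int[of j] by (simp add: algebra_simps)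

text \<open>Relative to \<open>rhs_factor\<close> the six functions match, partly by exchange:
  A(3\<mu>+N) with A(2M-\<mu>+N), C(\<mu>) with C(M-\<mu>), and the value of I from (q^2;q^2,p)_l
  with the one from abyq trade places. The remaining power is q^(M(N-l)), where N - l is the sum of
  the other k_i when N = |k|.\<close>

lemma diag_single_shift:
  fixes q a y :: complex and M :: nat
  defines "b \<equiv> q powi (1 - 2 * int M) / (a * y)"
    and "a' \<equiv> a * q powi int M" and "y' \<equiv> y * q powi (2 * int M)"
    and "b' \<equiv> q powi (1 - int M) / (a * y)"
  assumes q: "q \<noteq> 0" and y: "y \<noteq> 0" and a: "a \<noteq> 0"
    and gA: "\<And>j. th (a * y * q powi j) \<noteq> 0" and gB: "\<And>j. th (y / a * q powi j) \<noteq> 0"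
    and gC: "\<And>j. th (a\<^sup>2 * q powi j) \<noteq> 0" and gI: "\<And>j. j > 0 \<Longrightarrow> th (q powi j) \<noteq> 0"
    and gF: "\<And>j. th (y\<^sup>2 * q powi j) \<noteq> 0" and gG: "\<And>j. th (a\<^sup>2 * y\<^sup>2 * q powi j) \<noteq> 0"
    and lN: "l \<le> N" and lm: "l \<le> m"
  shows "single_factor q a b y (m + M) (l + M) (N + M) * diag_factor q y (m + M) (l + M)
      * global_factor q a b (N + M) * rhs_factor q a' b' y' m
    = q powi (int M * (int N - int l)) * (single_factor q a' b' y' m l N * diag_factor q y' m l
      * global_factor q a' b' N * rhs_factor q a b y (m + M))"
proof -
  let ?v = "q\<^sup>2"
  have gC2: "\<And>j. th (a\<^sup>2 * q * ?v powi j) \<noteq> 0"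
  proof -
    fix j
    have "a\<^sup>2 * q * ?v powi j = a\<^sup>2 * q powi (1 + 2 * j)"
      using q by (simp add: powi_sq power_int_add)
    then show "th (a\<^sup>2 * q * ?v powi j) \<noteq> 0" by (simp only: gC not_False_eq_True)
  qed
  have gG2: "\<And>j. th (a\<^sup>2 * y\<^sup>2 * q * ?v powi j) \<noteq> 0"
  proof -
    fix j
    have "a\<^sup>2 * y\<^sup>2 * q * ?v powi j = a\<^sup>2 * y\<^sup>2 * q powi (1 + 2 * j)"
      using q by (simp add: powi_sq power_int_add)
    then show "th (a\<^sup>2 * y\<^sup>2 * q * ?v powi j) \<noteq> 0" by (simp only: gG not_False_eq_True)
  qed
  have gF2: "\<And>j. th (y\<^sup>2 * ?v powi j) \<noteq> 0" unfolding powi_sq by (rule gF)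
  have gI2: "\<forall>j\<ge>0. th (?v * ?v powi j) \<noteq> 0"
  proof (intro allI impI)
    fix j :: int assume that: "j \<ge> 0"
    have "?v * ?v powi j = q powi (2 * (j + 1))" using q by (simp add: powi_sq power_int_add distrib_left)
    then show "th (?v * ?v powi j) \<noteq> 0" using gI[of "2 * (j + 1)"] that by (simp only:) simp
  qed
  have lN': "l + M \<le> N + M" and lm': "l + M \<le> m + M" using lN lm by simp_all
  have l0: "2 * 0 - int M + int (l + M) \<ge> 0" and l1: "2 * int M - int M + int l \<ge> 0" by simp_all
  have a0: "a = a * q powi 0" and b0: "b = q powi (1 - 2 * int M + 0) / (a * y)"
    and b1: "b' = q powi (1 - 2 * int M + int M) / (a * y)"
    and a1: "a' = a * q powi int M"
    and y0: "y = y * ?v powi 0" and y1: "y' = y * ?v powi int M"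
    unfolding powi_sq by (simp_all add: b_def b'_def a'_def y'_def)
  note s0 = diag_single_egam(1)[OF q y a a0 y0 b0 gA gB gC2 gI2 gF2 gG2 lN' lm' l0]
    and s1 = diag_single_egam(1)[OF q y a a1 y1 b1 gA gB gC2 gI2 gF2 gG2 lN lm l1]
  define P where "P \<mu> N l m = q powi int N * refl_factor q (1 / (a * y)) (1 - 2 * int M + \<mu>) N
        * ((- (y / a)) ^ l * q powi (int (tri (int l + 1)) - (1 - \<mu> + int N) * int l + 2 * int m * int N))
        * refl_factor ?v 1 (- int m) l / refl_factor ?v (1 / (a\<^sup>2 * q)) (1 - int M + \<mu>) m" for \<mu> N l m
  have P: "P 0 (N + M) (l + M) (m + M) = q powi (int M * (int N - int l)) * P (int M) N l m"
  proof -
    have Peq: "P \<mu> N l m = (- (1 / (a * y))) ^ N * (- (y / a)) ^ l * (- 1) ^ l / (- (1 / (a\<^sup>2 * q))) ^ m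
      * q powi (int N + (1 - 2 * int M + \<mu>) * int N + int (tri (int N))
         + (int (tri (int l + 1)) - (1 - \<mu> + int N) * int l + 2 * int m * int N)
         + 2 * (- int m * int l + int (tri (int l))) - 2 * ((1 - int M + \<mu>) * int m + int (tri (int m))))" for \<mu> N l m
    proof -
      have r: "n1 * (x * e1) * (y * e2) * (z * e3) / (w * e4) = x * y * z / w * (n1 * e1 * e2 * e3 / e4)"
        for n1 x e1 y e2 z e3 w e4 :: complex by simp
      show ?thesis
        unfolding P_def refl_factor_def powi_sq r
          power_int_add[OF disjI1[OF q], symmetric] power_int_diff[OF disjI1[OF q], symmetric]
        by (simp only: mult.assoc add.assoc)
    qed
    \<comment> \<open>The parameter y drops out of these monomials: both sides equal (-1)^M
      a^(-2M).\<close>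
    have cM: "(- (1 / (a * y))) ^ M * (- (y / a)) ^ M * (- 1) ^ M = (- (1 / (a\<^sup>2 * q))) ^ M * q powi int M"
      using q a y by (simp add: field_simps power2_eq_square flip: power_mult_distrib)
    have c3: "(- (1 / (a\<^sup>2 * q))) ^ M \<noteq> 0" using q a by simp
    have r: "x * x' * (y * y') * (z * z') / (w * w') * q powi e = q powi e0 * (x * y * z / w * q powi e1)"
      if "x' * y' * z' = w' * q powi i" "w' \<noteq> 0" "i + e = e0 + e1" for x x' y y' z z' w w' :: complex and i e e0 e1
    proof -
      have "x * x' * (y * y') * (z * z') / (w * w') * q powi e = (x * y * z) * (x' * y' * z') / (w * w') * q powi e"
        by (simp only: mult_ac)
      also have "\<dots> = x * y * z / w * (q powi i * q powi e)" unfolding that(1) using that(2) by simp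
      also have "q powi i * q powi e = q powi e0 * q powi e1"
        unfolding power_int_add[OF disjI1[OF q], symmetric] that(3) ..
      finally show ?thesis by (simp only: mult_ac)
    qed
    show ?thesis
      unfolding Peq power_add
      by (rule r[OF cM c3])
         (use tri_int[of "int M"] in \<open>simp add: tri_add algebra_simps\<close>)
  qed
  define A B C I F G where "A = egam q (a * y)" and "B = egam q (y / a)" and "C = egam ?v (a\<^sup>2 * q)"
    and "I = egam ?v ?v" and "F = egam ?v (y\<^sup>2)" and "G = egam ?v (a\<^sup>2 * y\<^sup>2 * q)"
  note f = A_def[symmetric] B_def[symmetric] C_def[symmetric] I_def[symmetric] F_def[symmetric] G_def[symmetric]
  have rearrange: "(R * p1 * A0 * B0 * C0 * I0 * F0 * G0) * R' = p0 * ((R' * p2 * A1 * B1 * C1 * I1 * F1 * G1) * R)"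
    if "p1 = p0 * p2" "A0 = A1" "B0 = B1" "C0 = C1" "I0 = I1" "F0 = F1" "G0 = G1"
    for p0 p1 p2 R R' A0 A1 B0 B1 C0 C1 I0 I1 F0 F1 G0 G1 :: complex
    unfolding that by (simp only: mult_ac)
  show ?thesis
    unfolding s0 s1 f P_def[symmetric]
    by (rule rearrange[OF P]) (simp_all add: algebra_simps)
qed

end

section \<open>Interpolation\<close>

text \<open>The value at (x, y) of the binary form of degree N with dehomogenisation P. A form is
  used instead of \<open>poly P (x / y)\<close> because the second coordinate may vanish.\<close>

definition hom_eval :: "complex poly \<Rightarrow> nat \<Rightarrow> complex \<Rightarrow> complex \<Rightarrow> complex" where
  "hom_eval P N x y = (\<Sum>i\<le>N. coeff P i * x ^ i * y ^ (N - i))"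

lemma hom_eval_add: "hom_eval (P + Q) N x y = hom_eval P N x y + hom_eval Q N x y"
  by (simp add: hom_eval_def distrib_right sum.distrib)

lemma hom_eval_smult: "hom_eval (smult c P) N x y = c * hom_eval P N x y"
  by (simp add: hom_eval_def sum_distrib_left mult.assoc)

lemma hom_eval_pCons: "hom_eval (pCons 0 P) (Suc N) x y = x * hom_eval P N x y"
  unfolding hom_eval_def sum.atMost_Suc_shift by (simp add: sum_distrib_left mult_ac)

lemma hom_eval_Suc: "degree P \<le> N \<Longrightarrow> hom_eval P (Suc N) x y = y * hom_eval P N x y"
  by (auto simp: hom_eval_def sum_distrib_left mult_ac coeff_eq_0 Suc_diff_le intro!: sum.cong)

lemma hom_eval_poly:
  assumes "degree P \<le> N" "y \<noteq> 0"
  shows "hom_eval P N x y = y ^ N * poly P (x / y)"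
proof -
  have "poly P (x / y) = (\<Sum>i\<le>N. coeff P i * (x / y) ^ i)"
    using assms(1) by (auto simp: poly_altdef intro!: sum.mono_neutral_left intro: le_degree)
  then show ?thesis using assms(2)
    by (auto simp: hom_eval_def sum_distrib_left power_divide power_diff field_simps intro!: sum.cong)
qed

text \<open>A nonzero binary form of degree N has at most N zeros on the projective line. By
  independence at most one of the points has h = 0, that is, lies at infinity. If one does, the
  coefficient of degree N vanishes, and the drop in degree makes up for the lost point.\<close>

lemma hom_eval_unique:
  assumes fin: "finite J" and card: "card J > N" and deg: "degree P \<le> N"
    and indep: "\<And>i j. i \<in> J \<Longrightarrow> j \<in> J \<Longrightarrow> i \<noteq> j \<Longrightarrow> g i * h j \<noteq> g j * h i"
    and zero: "\<And>i. i \<in> J \<Longrightarrow> hom_eval P N (g i) (h i) = 0"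
  shows "P = 0"
proof (rule ccontr)
  assume P: "P \<noteq> 0"
  define J' where "J' = {i \<in> J. h i \<noteq> 0}"
  have fin': "finite J'" using fin by (simp add: J'_def)
  have root: "poly P (g i / h i) = 0" if "i \<in> J'" for i
    using zero[of i] hom_eval_poly[OF deg, of "h i" "g i"] that by (auto simp: J'_def)
  have "inj_on (\<lambda>i. g i / h i) J'"
    using indep by (auto simp: inj_on_def J'_def field_simps)
  then have "card J' = card ((\<lambda>i. g i / h i) ` J')" by (simp add: card_image)
  also have "\<dots> \<le> card {z. poly P z = 0}"
    using root poly_roots_finite[OF P] by (intro card_mono) auto
  also have "\<dots> \<le> degree P" using card_poly_roots_bound[OF P] .
  finally have c: "card J' \<le> degree P" .
  show False
  proof (cases "J' = J")
    case True
    then show ?thesis using c card deg by simp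
  next
    case False
    then obtain i where i: "i \<in> J" "h i = 0" by (auto simp: J'_def)
    have "J' = J - {i}"
    proof -
      have "h j \<noteq> 0" if "j \<in> J" "j \<noteq> i" for j
        using indep[OF i(1) that(1)] that(2) i(2) by auto
      then show ?thesis using i by (auto simp: J'_def)
    qed
    then have cJ: "card J' = card J - 1" using i fin by simp
    have "coeff P N * g i ^ N = 0"
    proof -
      have "hom_eval P N (g i) 0 = (\<Sum>j\<in>{N}. coeff P j * g i ^ j * 0 ^ (N - j))"
        unfolding hom_eval_def by (rule sum.mono_neutral_right) auto
      then show ?thesis using zero[OF i(1)] i(2) by simp
    qed
    \<comment> \<open>For N > 0 there is a further point, and independence from it excludes that
      both coordinates of the point at infinity vanish.\<close>
    moreover have "g i ^ N \<noteq> 0"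
    proof (cases "N = 0")
      case False
      then obtain j where "j \<in> J'" using c cJ card 
      proof -
        have "card J' > 0" using False c cJ card by simp
        then show ?thesis using that by (metis card_gt_0_iff ex_in_conv)
      qed
      then have "g i * h j \<noteq> g j * h i" using indep[of i j] i by (auto simp: J'_def)
      then show ?thesis using i by auto
    qed simp
    ultimately have "coeff P N = 0" by (metis mult_eq_0_iff)
    then have "degree P < N \<or> N = 0" using P deg
      by (metis le_neq_implies_less leading_coeff_0_iff)
    then show False
    proof
      assume "degree P < N" then show False using c cJ card by simp
    next
      assume "N = 0" then show False using deg \<open>coeff P N = 0\<close> P
        by (metis le_zero_eq leading_coeff_0_iff)
    qed
  qed
qed

context elliptic_nome
begin

section \<open>Functions of b that are binary forms in two theta functions\<close>

definition theta_form ::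
    "(complex \<Rightarrow> complex) \<Rightarrow> (complex \<Rightarrow> complex) \<Rightarrow> nat \<Rightarrow> (complex \<Rightarrow> complex) \<Rightarrow> bool" where
  "theta_form g h N f \<longleftrightarrow> (\<exists>P. degree P \<le> N \<and> (\<forall>b. b \<noteq> 0 \<longrightarrow> f b = hom_eval P N (g b) (h b)))"

lemma theta_form_const: "theta_form g h 0 (\<lambda>b. c)"
  unfolding theta_form_def by (rule exI[of _ "[:c:]"]) (simp add: hom_eval_def)

lemma theta_form_add:
  assumes "theta_form g h N f" "theta_form g h N f'"
  shows "theta_form g h N (\<lambda>b. f b + f' b)"
  using assms unfolding theta_form_def by (metis hom_eval_add degree_add_le)

lemma theta_form_cmult:
  assumes "theta_form g h N f"
  shows "theta_form g h N (\<lambda>b. c * f b)"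
  using assms unfolding theta_form_def by (metis hom_eval_smult degree_smult_le order_trans)

lemma theta_form_0: "theta_form g h N (\<lambda>b. 0)"
  unfolding theta_form_def by (rule exI[of _ 0]) (simp add: hom_eval_def)

lemma theta_form_sum:
  assumes "\<And>k. k \<in> K \<Longrightarrow> theta_form g h N (f k)"
  shows "theta_form g h N (\<lambda>b. \<Sum>k\<in>K. f k b)"
  using assms by (induction K rule: infinite_finite_induct) (auto intro: theta_form_0 theta_form_add)

lemma theta_form_linear:
  assumes "theta_form g h N f" and "\<And>b. b \<noteq> 0 \<Longrightarrow> l b = \<alpha> * g b + \<beta> * h b"
  shows "theta_form g h (Suc N) (\<lambda>b. f b * l b)"
proof -
  obtain P where P: "degree P \<le> N" "\<And>b. b \<noteq> 0 \<Longrightarrow> f b = hom_eval P N (g b) (h b)"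
    using assms(1) by (auto simp: theta_form_def)
  have "degree (smult \<alpha> (pCons 0 P) + smult \<beta> P) \<le> Suc N"
    using P(1) by (intro degree_add_le order_trans[OF degree_smult_le] order_trans[OF degree_pCons_le]) auto
  moreover have "f b * l b = hom_eval (smult \<alpha> (pCons 0 P) + smult \<beta> P) (Suc N) (g b) (h b)" if "b \<noteq> 0" for b
    using that by (simp add: hom_eval_add hom_eval_smult hom_eval_pCons hom_eval_Suc P assms(2) algebra_simps)
  ultimately show ?thesis unfolding theta_form_def by blast
qed

text \<open>By the first clause g and h span the products \<theta>(cb)\<theta>(cq/b). By the second,
  (g b : h b) and (g b' : h b') are distinct points of the projective line unless b' is b or q/b up
  to a power of p.\<close>

definition theta_basis :: "complex \<Rightarrow> (complex \<Rightarrow> complex) \<Rightarrow> (complex \<Rightarrow> complex) \<Rightarrow> bool" where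
  "theta_basis q g h \<longleftrightarrow>
     (\<forall>c. c \<noteq> 0 \<longrightarrow> (\<exists>\<alpha> \<beta>. \<forall>b. b \<noteq> 0 \<longrightarrow> th (c * b) * th (c * q / b) = \<alpha> * g b + \<beta> * h b)) \<and>
     (\<forall>b b'. b \<noteq> 0 \<longrightarrow> b' \<noteq> 0 \<longrightarrow> th (b * b' / q) * th (b / b') \<noteq> 0 \<longrightarrow> g b * h b' \<noteq> g b' * h b)"

text \<open>If s^2 = q, then \<theta>(cb)\<theta>(cq/b) is \<theta>(xy)\<theta>(x/y) for x = cs and
  y = b/s. The determinant formula therefore gives the first clause, and with x = b/s, y = b'/s also
  the second.\<close>

lemma theta_basis_exists:
  assumes q: "q \<noteq> 0"
  obtains g h where "theta_basis q g h"
proof -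
  obtain G H where GH: "\<And>x y. x \<noteq> 0 \<Longrightarrow> y \<noteq> 0 \<Longrightarrow> th (x * y) * th (x / y) = x * (G x * H y - H x * G y)"
    using theta_wedge[OF nome] by blast
  define s where "s = csqrt q"
  have ss: "s * s = q" by (simp add: s_def flip: power2_eq_square)
  then have s: "s \<noteq> 0" using q by auto
  have "theta_basis q (\<lambda>b. G (b / s)) (\<lambda>b. H (b / s))"
    unfolding theta_basis_def
  proof (intro conjI allI impI)
    fix c :: complex assume c: "c \<noteq> 0"
    have "th (c * b) * th (c * q / b) = (- c * s * H (c * s)) * G (b / s) + (c * s * G (c * s)) * H (b / s)"
      if "b \<noteq> 0" for b
    proof -
      have "c * s * (b / s) = c * b" "c * s / (b / s) = c * q / b"
        using s that unfolding ss[symmetric] by (simp_all add: field_simps)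
      then show ?thesis using GH[of "c * s" "b / s"] c s that by (simp only: mult_eq_0_iff divide_eq_0_iff simp_thms) (simp add: algebra_simps)
    qed
    then show "\<exists>\<alpha> \<beta>. \<forall>b. b \<noteq> 0 \<longrightarrow> th (c * b) * th (c * q / b) = \<alpha> * G (b / s) + \<beta> * H (b / s)" by blast
  next
    fix b b' :: complex assume b: "b \<noteq> 0" "b' \<noteq> 0" "th (b * b' / q) * th (b / b') \<noteq> 0"
    have "b / s * (b' / s) = b * b' / q" "b / s / (b' / s) = b / b'"
      using s b unfolding ss[symmetric] by (simp_all add: field_simps)
    then have "th (b * b' / q) * th (b / b') = b / s * (G (b / s) * H (b' / s) - H (b / s) * G (b' / s))"
      using GH[of "b / s" "b' / s"] b s by simp
    then show "G (b / s) * H (b' / s) \<noteq> G (b' / s) * H (b / s)"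
      using b(3) by (auto simp: mult.commute)
  qed
  then show ?thesis by (rule that)
qed

lemma theta_form_unique:
  assumes basis: "theta_basis q g h" and form: "theta_form g h N f"
    and fin: "finite J" and card: "card J > N"
    and pts: "\<And>i. i \<in> J \<Longrightarrow> \<beta> i \<noteq> 0"
    and indep: "\<And>i j. i \<in> J \<Longrightarrow> j \<in> J \<Longrightarrow> i \<noteq> j \<Longrightarrow> th (\<beta> i * \<beta> j / q) * th (\<beta> i / \<beta> j) \<noteq> 0"
    and zero: "\<And>i. i \<in> J \<Longrightarrow> f (\<beta> i) = 0"
    and b: "b \<noteq> 0"
  shows "f b = 0"
proof -
  obtain P where P: "degree P \<le> N" "\<And>b. b \<noteq> 0 \<Longrightarrow> f b = hom_eval P N (g b) (h b)"
    using form by (auto simp: theta_form_def)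
  have B: "g b * h b' \<noteq> g b' * h b" if "b \<noteq> 0" "b' \<noteq> 0" "th (b * b' / q) * th (b / b') \<noteq> 0" for b b'
    using basis that by (simp add: theta_basis_def)
  have "P = 0"
  proof (rule hom_eval_unique[OF fin card P(1)])
    show "g (\<beta> i) * h (\<beta> j) \<noteq> g (\<beta> j) * h (\<beta> i)" if "i \<in> J" "j \<in> J" "i \<noteq> j" for i j
      by (rule B[OF pts[OF that(1)] pts[OF that(2)] indep[OF that]])
    show "hom_eval P N (g (\<beta> i)) (h (\<beta> i)) = 0" if "i \<in> J" for i
      using zero P(2) pts that by metis
  qed
  then show ?thesis using P(2)[OF b] by (simp add: hom_eval_def)
qed

text \<open>Each j < m contributes a product \<theta>(cu^j b)\<theta>(cu^j q/b), hence one linear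
  form in g and h.\<close>

lemma theta_form_efac_pair:
  assumes basis: "theta_basis q g h" and form: "theta_form g h N f"
    and u: "u \<noteq> 0" and c: "c \<noteq> 0"
  shows "theta_form g h (N + m) (\<lambda>b. f b * (efac u (c * b) 0 m * efac u (c * q / b) 0 m))"
proof (induction m)
  case 0
  then show ?case using form by simp
next
  case (Suc m)
  have "c * u powi int m \<noteq> 0" using u c by simp
  then obtain \<alpha> \<beta> where l: "\<And>b. b \<noteq> 0 \<Longrightarrow>
      th (c * u powi int m * b) * th (c * u powi int m * q / b) = \<alpha> * g b + \<beta> * h b"
    using basis unfolding theta_basis_def by blast
  have "theta_form g h (Suc (N + m)) (\<lambda>b. f b * (efac u (c * b) 0 m * efac u (c * q / b) 0 m)
      * (th (c * u powi int m * b) * th (c * u powi int m * q / b)))"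
    by (rule theta_form_linear[OF Suc l])
  then show ?case by (simp add: efac_Suc mult_ac)
qed

lemma theta_form_efac_pair_prod:
  assumes basis: "theta_basis q g h" and form: "theta_form g h N f"
    and u: "u \<noteq> 0" and fin: "finite I" and c: "\<And>i. i \<in> I \<Longrightarrow> c i \<noteq> 0"
  shows "theta_form g h (N + (\<Sum>i\<in>I. m i))
     (\<lambda>b. f b * (\<Prod>i\<in>I. efac u (c i * b) 0 (m i) * efac u (c i * q / b) 0 (m i)))"
  using fin c
proof (induction I)
  case empty
  then show ?case using form by simp
next
  case (insert i I)
  from theta_form_efac_pair[OF basis insert.IH u, of "c i" "m i"] insert
  show ?case by (simp add: mult_ac add_ac)
qed

end

section \<open>The identity for generic parameters\<close>

text \<open>Isolates the pairs containing s, the only ones that a change of x_s, n_s and k_s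
  affects. Symmetry allows these to be listed with s in second place.\<close>

lemma prod_pairs_split:
  fixes f :: "nat \<Rightarrow> nat \<Rightarrow> complex"
  assumes s: "s \<in> {1..r}" and sym: "\<And>i j. i \<in> {1..r} \<Longrightarrow> j \<in> {1..r} \<Longrightarrow> f i j = f j i"
  shows "(\<Prod>i=1..r. \<Prod>j=i+1..r. f i j)
    = (\<Prod>(i, j)\<in>{(i, j). i \<in> {1..r} \<and> j \<in> {i+1..r} \<and> i \<noteq> s \<and> j \<noteq> s}. f i j) * (\<Prod>i\<in>{1..r}-{s}. f i s)"
proof -
  let ?S = "SIGMA i:{1..r}. {i+1..r}"
  let ?A = "{(i, j). i \<in> {1..r} \<and> j \<in> {i+1..r} \<and> i \<noteq> s \<and> j \<noteq> s}"
  let ?B = "(\<lambda>i. (min i s, max i s)) ` ({1..r} - {s})"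
  have fin: "finite ?S" by (intro finite_SigmaI) auto
  have P: "?S = ?A \<union> ?B"
  proof (intro equalityI subsetI)
    fix z assume "z \<in> ?S"
    then obtain i j where z: "z = (i, j)" "1 \<le> i" "i < j" "j \<le> r" by auto
    consider "i = s" | "j = s" | "i \<noteq> s" "j \<noteq> s" by blast
    then show "z \<in> ?A \<union> ?B"
    proof cases
      case 1
      then have "z = (min j s, max j s)" "j \<in> {1..r} - {s}" using z by auto
      then show ?thesis by blast
    next
      case 2
      then have "z = (min i s, max i s)" "i \<in> {1..r} - {s}" using z by auto
      then show ?thesis by blast
    next
      case 3
      then show ?thesis using z by auto
    qed
  next
    fix z assume "z \<in> ?A \<union> ?B"
    then show "z \<in> ?S" using s by (auto simp: min_def max_def)
  qed
  have fin0: "finite ?A" by (rule finite_subset[OF _ fin]) auto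
  have fin1: "finite ?B" by simp
  have disj: "?A \<inter> ?B = {}" by (auto simp: min_def max_def split: if_splits)
  have inj: "inj_on (\<lambda>i. (min i s, max i s)) ({1..r} - {s})"
    by (auto simp: inj_on_def min_def max_def split: if_splits)
  have "(\<Prod>i=1..r. \<Prod>j=i+1..r. f i j) = (\<Prod>(i, j)\<in>?S. f i j)"
    by (rule prod.Sigma) auto
  also have "\<dots> = (\<Prod>(i, j)\<in>?A. f i j) * (\<Prod>(i, j)\<in>?B. f i j)"
    unfolding P by (rule prod.union_disjoint[OF fin0 fin1 disj])
  also have "(\<Prod>(i, j)\<in>?B. f i j) = (\<Prod>i\<in>{1..r}-{s}. f i s)"
    unfolding prod.reindex[OF inj] using s by (intro prod.cong) (auto simp: min_def max_def intro: sym)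
  finally show ?thesis .
qed

lemma prod_diag_pairs:
  fixes f :: "nat \<Rightarrow> nat \<Rightarrow> complex"
  shows "(\<Prod>i=1..r. \<Prod>j=1..r. f i j) = (\<Prod>i=1..r. f i i) * (\<Prod>i=1..r. \<Prod>j=i+1..r. f i j * f j i)"
proof (induction r)
  case (Suc r)
  have "(\<Prod>i=1..Suc r. \<Prod>j=1..Suc r. f i j)
      = (\<Prod>i=1..r. \<Prod>j=1..r. f i j) * (\<Prod>i=1..r. f i (Suc r)) * ((\<Prod>j=1..r. f (Suc r) j) * f (Suc r) (Suc r))"
    by (simp add: prod.distrib)
  moreover have "(\<Prod>i=1..Suc r. \<Prod>j=i+1..Suc r. f i j * f j i)
      = (\<Prod>i=1..r. \<Prod>j=i+1..r. f i j * f j i) * (\<Prod>i=1..r. f i (Suc r) * f (Suc r) i)"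
  proof -
    have "(\<Prod>i=1..r. \<Prod>j=i+1..Suc r. f i j * f j i)
      = (\<Prod>i=1..r. (\<Prod>j=i+1..r. f i j * f j i) * (f i (Suc r) * f (Suc r) i))"
      by (intro prod.cong) (auto simp: prod.cl_ivl_Suc)
    then show ?thesis by (simp add: prod.distrib)
  qed
  ultimately show ?case using Suc by (simp add: prod.distrib mult_ac)
qed simp

context elliptic_nome
begin

text \<open>The expression y \<theta>(x/y) is antisymmetric in x and y. It occurs in the numerator
  and in the denominator, so that the signs cancel; the other factors are symmetric or trade
  places.\<close>

lemma cross_factor_commute:
  assumes q: "q \<noteq> 0" and x: "x \<noteq> 0" and y: "y \<noteq> 0"
  shows "cross_factor q x y n m k l = cross_factor q y x m n l k"
proof -
  define z where "z = x / y * q powi (2 * int k - 2 * int l)"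
  have z: "z \<noteq> 0" and z': "y / x * q powi (2 * int l - 2 * int k) = 1 / z"
    using q x y by (simp_all add: z_def power_int_diff)
  have xy: "y / x = 1 / (x / y)" by simp
  have "th (y / x * q powi (2 * int l - 2 * int k)) * q powi (2 * int k) / th (y / x)
      = th z * ((x / y) / z * q powi (2 * int k)) / th (x / y)"
    unfolding z' unfolding xy using z x y by (subst (1 2) th_inverse) (simp_all add: field_simps)
  also have "(x / y) / z * q powi (2 * int k) = q powi (2 * int l)"
    using q x y by (simp add: z_def power_int_diff)
  finally show ?thesis
    unfolding cross_factor_def z_def[symmetric] by (simp add: mult_ac add.commute)
qed

text \<open>
  The summand of the theorem times \<open>(abx\<^sub>iq, ax\<^sub>iq\<^sup>2/b; q\<^sup>2, p)\<close> with index \<open>n\<^sub>i\<close> for all \<open>i\<close>, which is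
  defined for every nonzero \<open>b\<close>.
\<close>

definition sum_term ::
    "complex \<Rightarrow> nat \<Rightarrow> (nat \<Rightarrow> nat) \<Rightarrow> complex \<Rightarrow> complex \<Rightarrow> (nat \<Rightarrow> complex) \<Rightarrow> (nat \<Rightarrow> nat) \<Rightarrow> complex" where
  "sum_term q r n a b x k =
     (\<Prod>i=1..r. \<Prod>j=i+1..r. cross_factor q (x i) (x j) (n i) (n j) (k i) (k j))
     * (\<Prod>i=1..r. single_factor q a b (x i) (n i) (k i) (vsize r k) * diag_factor q (x i) (n i) (k i))
     * global_factor q a b (vsize r k)"

text \<open>
  Quantifying over all integers \<open>m\<close> makes the condition stable under the parameter shifts of
  the induction.
\<close>

definition generic :: "complex \<Rightarrow> nat \<Rightarrow> complex \<Rightarrow> (nat \<Rightarrow> complex) \<Rightarrow> bool" where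
  "generic q r a x \<longleftrightarrow> (\<forall>i\<in>{1..r}. \<forall>j\<in>{1..r}. \<forall>m::int.
     th (a * x i * q powi m) \<noteq> 0 \<and> th (x i / a * q powi m) \<noteq> 0
     \<and> (i \<noteq> j \<longrightarrow> th (x i / x j * q powi m) \<noteq> 0) \<and> th (x i * x j * q powi m) \<noteq> 0
     \<and> th (a\<^sup>2 * x i * x j * q powi m) \<noteq> 0 \<and> th (x i / (a\<^sup>2 * x j) * q powi m) \<noteq> 0)"

lemma generic_shift:
  assumes q: "q \<noteq> 0" and g: "generic q r a x"
  shows "generic q r (a * q powi \<alpha>) (\<lambda>i. x i * q powi e i)"
proof -
  have dbl: "q powi (2 * \<alpha>) = q powi \<alpha> * q powi \<alpha>" "q powi (\<alpha> * 2) = q powi \<alpha> * q powi \<alpha>"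
    using q by (simp_all add: mult.commute[of \<alpha> 2] flip: power_int_add)
  have 1: "a * q powi \<alpha> * (y * q powi f) * q powi m = a * y * q powi (\<alpha> + f + m)"
    "y * q powi f / (a * q powi \<alpha>) * q powi m = y / a * q powi (f - \<alpha> + m)"
    "y * q powi f / (z * q powi f') * q powi m = y / z * q powi (f - f' + m)"
    "y * q powi f * (z * q powi f') * q powi m = y * z * q powi (f + f' + m)"
    "(a * q powi \<alpha>)\<^sup>2 * (y * q powi f) * (z * q powi f') * q powi m = a\<^sup>2 * y * z * q powi (\<alpha> + \<alpha> + f + f' + m)"
    "y * q powi f / ((a * q powi \<alpha>)\<^sup>2 * (z * q powi f')) * q powi m = y / (a\<^sup>2 * z) * q powi (f - \<alpha> - \<alpha> - f' + m)"
    for y z f f' m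
    using q by (simp_all add: power_int_add power_int_diff power2_eq_square dbl mult_ac)
  show ?thesis using g unfolding generic_def 1 by blast
qed

section \<open>The shift of a whole summand and its consequence for the sum\<close>

lemma vsize_upd: "s \<in> {1..r} \<Longrightarrow> vsize r (k(s := k s + M)) = vsize r k + M"
  unfolding vsize_def by (subst (1 2) sum.remove[of _ s]) (auto intro!: sum.cong)

lemma vsize_remove: "s \<in> {1..r} \<Longrightarrow> vsize r k = k s + (\<Sum>i\<in>{1..r}-{s}. k i)"
  unfolding vsize_def by (subst sum.remove[of _ s]) auto

lemma le_vsize: "i \<in> {1..r} \<Longrightarrow> k i \<le> vsize r k"
  unfolding vsize_def by (intro member_le_sum) auto

text \<open>Multiplied out, this is the invariance of summand over right-hand side. Pairs without s
  do not change, every i other than s contributes q^(-M k_i), and s with the global factor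
  contributes q^(M(|k| - k_s)).\<close>

lemma sum_term_shift:
  fixes M :: nat and n k :: "nat \<Rightarrow> nat" and x :: "nat \<Rightarrow> complex"
  assumes q: "q \<noteq> 0" and gI: "\<And>j. j > 0 \<Longrightarrow> th (q powi j) \<noteq> 0"
    and a: "a \<noteq> 0" and x: "\<And>i. i \<in> {1..r} \<Longrightarrow> x i \<noteq> 0" and g: "generic q r a x"
    and s: "s \<in> {1..r}" and Mn: "M \<le> n s"
    and n': "n' = n(s := n s - M)" and k: "k \<in> mbox r n'"
    and x': "x' = x(s := x s * q powi (2 * int M))" and a': "a' = a * q powi int M"
    and b: "b = q powi (1 - 2 * int M) / (a * x s)" and b': "b' = q powi (1 - int M) / (a * x s)"
  shows "sum_term q r n a b x (k(s := k s + M)) * (\<Prod>i=1..r. rhs_factor q a' b' (x' i) (n' i))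
    = sum_term q r n' a' b' x' k * (\<Prod>i=1..r. rhs_factor q a b (x i) (n i))"
proof -
  let ?kM = "k(s := k s + M)" and ?N = "vsize r k"
  let ?P0 = "{(i, j). i \<in> {1..r} \<and> j \<in> {i+1..r} \<and> i \<noteq> s \<and> j \<noteq> s}"
  have kn: "k i \<le> n' i" if "i \<in> {1..r}" for i using k that by (auto simp: mbox_def)
  have xs: "x s \<noteq> 0" using x s by blast
  have x'nz: "x' i \<noteq> 0" if "i \<in> {1..r}" for i using x[OF that] x[OF s] q by (simp add: x')
  have G: "th (a * x i * q powi m) \<noteq> 0" "th (x i / a * q powi m) \<noteq> 0"
     "i \<noteq> j \<Longrightarrow> th (x i / x j * q powi m) \<noteq> 0" "th (x i * x j * q powi m) \<noteq> 0"
     "th (a\<^sup>2 * x i * x j * q powi m) \<noteq> 0" "th (x i / (a\<^sup>2 * x j) * q powi m) \<noteq> 0"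
    if "i \<in> {1..r}" "j \<in> {1..r}" for i j m
    using g that unfolding generic_def by blast+
  have split: "sum_term q r nn aa bb xx kk
    = (\<Prod>(i, j)\<in>?P0. cross_factor q (xx i) (xx j) (nn i) (nn j) (kk i) (kk j))
      * (\<Prod>i\<in>{1..r}-{s}. cross_factor q (xx i) (xx s) (nn i) (nn s) (kk i) (kk s)
           * single_factor q aa bb (xx i) (nn i) (kk i) (vsize r kk) * diag_factor q (xx i) (nn i) (kk i))
      * (single_factor q aa bb (xx s) (nn s) (kk s) (vsize r kk) * diag_factor q (xx s) (nn s) (kk s)
           * global_factor q aa bb (vsize r kk))"
    if xx0: "\<forall>i\<in>{1..r}. xx i \<noteq> 0" for nn aa bb xx kk
  proof -
    have xx: "xx i \<noteq> 0" if "i \<in> {1..r}" for i using xx0 that by blast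
    let ?f = "\<lambda>i j. cross_factor q (xx i) (xx j) (nn i) (nn j) (kk i) (kk j)"
    let ?g = "\<lambda>i. single_factor q aa bb (xx i) (nn i) (kk i) (vsize r kk) * diag_factor q (xx i) (nn i) (kk i)"
    have "(\<Prod>i=1..r. \<Prod>j=i+1..r. ?f i j) = (\<Prod>(i, j)\<in>?P0. ?f i j) * (\<Prod>i\<in>{1..r}-{s}. ?f i s)"
      by (rule prod_pairs_split[OF s]) (rule cross_factor_commute[OF q xx xx])
    moreover have "(\<Prod>i=1..r. ?g i) = ?g s * (\<Prod>i\<in>{1..r}-{s}. ?g i)"
      by (rule prod.remove) (use s in auto)
    ultimately show ?thesis unfolding sum_term_def by (simp add: prod.distrib mult_ac)
  qed
  have xall: "\<forall>i\<in>{1..r}. x i \<noteq> 0" "\<forall>i\<in>{1..r}. x' i \<noteq> 0" using x x'nz by blast+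
  have rs: "(\<Prod>i=1..r. F i) = F s * (\<Prod>i\<in>{1..r}-{s}. F i)" for F :: "nat \<Rightarrow> complex"
    by (rule prod.remove) (use s in auto)
  have P0: "(\<Prod>(i, j)\<in>?P0. cross_factor q (x i) (x j) (n i) (n j) (?kM i) (?kM j))
      = (\<Prod>(i, j)\<in>?P0. cross_factor q (x' i) (x' j) (n' i) (n' j) (k i) (k j))"
    by (intro prod.cong) (auto simp: x' n')
  have single: "cross_factor q (x i) (x s) (n i) (n s) (?kM i) (?kM s)
           * single_factor q a b (x i) (n i) (?kM i) (?N + M) * diag_factor q (x i) (n i) (?kM i)
           * rhs_factor q a' b' (x' i) (n' i)
         = q powi (- (int M * int (k i))) * (cross_factor q (x' i) (x' s) (n' i) (n' s) (k i) (k s)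
           * single_factor q a' b' (x' i) (n' i) (k i) ?N * diag_factor q (x' i) (n' i) (k i)
           * rhs_factor q a b (x i) (n i))" if i: "i \<in> {1..r} - {s}" for i
  proof -
    have ir: "i \<in> {1..r}" and ins: "i \<noteq> s" using i by auto
    have "cross_factor q (x i) (x s) (n i) ((n s - M) + M) (k i) (k s + M)
          * single_factor q a b (x i) (n i) (k i) (?N + M) * rhs_factor q a' b' (x i) (n i)
       = q powi (- (int M * int (k i))) *
         (cross_factor q (x i) (x s * q powi (2 * int M)) (n i) (n s - M) (k i) (k s)
          * single_factor q a' b' (x i) (n i) (k i) ?N * rhs_factor q a b (x i) (n i))"
      unfolding a' b b'
      by (rule cross_single_shift[OF q x[OF ir] xs a G(1)[OF ir s] G(2)[OF ir s] G(3)[OF ir s ins]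
            G(4)[OF ir s] G(5)[OF ir s] G(6)[OF ir s] le_vsize[OF ir]])
         (use kn[OF ir] ins in \<open>simp add: n'\<close>)
    then show ?thesis using Mn ins by (simp add: x' n' mult_ac)
  qed
  have last: "single_factor q a b (x s) (n s) (?kM s) (?N + M) * diag_factor q (x s) (n s) (?kM s)
       * global_factor q a b (?N + M) * rhs_factor q a' b' (x' s) (n' s)
     = q powi (int M * (int ?N - int (k s))) * (single_factor q a' b' (x' s) (n' s) (k s) ?N
       * diag_factor q (x' s) (n' s) (k s) * global_factor q a' b' ?N * rhs_factor q a b (x s) (n s))"
  proof -
    \<comment> \<open>The case i = j = s of the last clause of \<open>generic\<close>: x_s cancels,
      and the inverse of a^2 q^j remains up to the sign of the exponent chosen.\<close>
    have g1: "th (a\<^sup>2 * q powi j) \<noteq> 0" for j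
    proof -
      have "th (x s / (a\<^sup>2 * x s) * q powi (- j)) \<noteq> 0" by (rule G(6)[OF s s])
      moreover have "x s / (a\<^sup>2 * x s) * q powi (- j) = 1 / (a\<^sup>2 * q powi j)"
        using xs by (simp add: power_int_minus field_simps)
      ultimately show ?thesis using th_inverse[of "a\<^sup>2 * q powi j"] a q by auto
    qed
    have g2: "th ((x s)\<^sup>2 * q powi j) \<noteq> 0" "th (a\<^sup>2 * (x s)\<^sup>2 * q powi j) \<noteq> 0" for j
      using G(4)[OF s s, of j] G(5)[OF s s, of j] by (simp_all add: power2_eq_square mult.assoc)
    have "single_factor q a b (x s) ((n s - M) + M) (k s + M) (?N + M) * diag_factor q (x s) ((n s - M) + M) (k s + M)
       * global_factor q a b (?N + M) * rhs_factor q a' b' (x s * q powi (2 * int M)) (n s - M)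
     = q powi (int M * (int ?N - int (k s))) * (single_factor q a' b' (x s * q powi (2 * int M)) (n s - M) (k s) ?N
       * diag_factor q (x s * q powi (2 * int M)) (n s - M) (k s) * global_factor q a' b' ?N
       * rhs_factor q a b (x s) ((n s - M) + M))"
      unfolding a' b b'
      by (rule diag_single_shift[OF q xs a G(1)[OF s s] G(2)[OF s s] g1 gI g2 le_vsize[OF s]])
         (use kn[OF s] in \<open>simp_all add: n'\<close>)
    then show ?thesis using Mn by (simp add: x' n')
  qed
  have pw: "(\<Prod>i\<in>{1..r}-{s}. q powi (- (int M * int (k i)))) * q powi (int M * (int ?N - int (k s))) = 1"
  proof -
    have *: "(\<Prod>i\<in>A. q powi (- (int M * int (k i)))) = q powi (- (int M * int (\<Sum>i\<in>A. k i)))" if "finite A" for A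
      using that by (induction A) (simp_all add: power_int_add[OF disjI1[OF q], symmetric] algebra_simps)
    show ?thesis
      unfolding *[OF finite_Diff[OF finite_atLeastAtMost]] vsize_remove[OF s, of k]
      by (simp add: power_int_add[OF disjI1[OF q], symmetric] algebra_simps)
  qed
  define E E' where "E = (\<Prod>(i, j)\<in>?P0. cross_factor q (x' i) (x' j) (n' i) (n' j) (k i) (k j))"
    and "E' = (\<Prod>i\<in>{1..r}-{s}. cross_factor q (x' i) (x' s) (n' i) (n' s) (k i) (k s)
           * single_factor q a' b' (x' i) (n' i) (k i) ?N * diag_factor q (x' i) (n' i) (k i)
           * rhs_factor q a b (x i) (n i))"
  have rear: "(e * u * v) * (w * z) = e * (u * z) * (v * w)" for e u v w z :: complex by (simp only: mult_ac)
  have rear': "e * (p * u) * (p' * v) = (p * p') * (e * u * v)" for e p u p' v :: complex by (simp only: mult_ac)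
  have "sum_term q r n a b x ?kM * (\<Prod>i=1..r. rhs_factor q a' b' (x' i) (n' i))
      = E * (\<Prod>i\<in>{1..r}-{s}. q powi (- (int M * int (k i))) * (cross_factor q (x' i) (x' s) (n' i) (n' s) (k i) (k s)
           * single_factor q a' b' (x' i) (n' i) (k i) ?N * diag_factor q (x' i) (n' i) (k i)
           * rhs_factor q a b (x i) (n i)))
        * (q powi (int M * (int ?N - int (k s))) * (single_factor q a' b' (x' s) (n' s) (k s) ?N
       * diag_factor q (x' s) (n' s) (k s) * global_factor q a' b' ?N * rhs_factor q a b (x s) (n s)))"
    unfolding split[OF xall(1)] rs[of "\<lambda>i. rhs_factor q a' b' (x' i) (n' i)"] vsize_upd[OF s] P0 E_def[symmetric] rear
      prod.distrib[symmetric] last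
    by (rule arg_cong2[where f = "(*)", OF arg_cong2[where f = "(*)", OF refl prod.cong[OF refl]] refl]) (rule single)
  also have "\<dots> = E * E' * (single_factor q a' b' (x' s) (n' s) (k s) ?N
       * diag_factor q (x' s) (n' s) (k s) * global_factor q a' b' ?N * rhs_factor q a b (x s) (n s))"
    unfolding prod.distrib[of "\<lambda>i. q powi (- (int M * int (k i)))"] rear' pw E'_def by simp
  also have "\<dots> = sum_term q r n' a' b' x' k * (\<Prod>i=1..r. rhs_factor q a b (x i) (n i))"
    unfolding split[OF xall(2)] rs[of "\<lambda>i. rhs_factor q a b (x i) (n i)"] E_def[symmetric] E'_def rear
      prod.distrib[symmetric] ..
  finally show ?thesis .
qed

lemma finite_mbox: "finite (mbox r n)"
  unfolding mbox_def by (intro finite_PiE) auto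

text \<open>Serves to cancel the right-hand side of the shifted identity. For b = q^\<beta>/(ax_s)
  all arguments are of the kinds covered by \<open>generic\<close>.\<close>

lemma rhs_factor_nonzero:
  assumes q: "q \<noteq> 0" and a: "a \<noteq> 0" and g: "generic q r a x" and s: "s \<in> {1..r}" and i: "i \<in> {1..r}"
    and xs: "x s \<noteq> 0" and b: "b = q powi \<beta> / (a * x s)"
  shows "rhs_factor q a b (x i) m \<noteq> 0"
proof -
  have G: "th (a * x i * q powi m) \<noteq> 0" "th (x i / a * q powi m) \<noteq> 0"
     "th (x i * x s * q powi m) \<noteq> 0" "th (x i / (a\<^sup>2 * x s) * q powi m) \<noteq> 0" for m
    using g i s unfolding generic_def by blast+
  have e: "a * x i * q powi 1 * q powi j = a * x i * q powi (1 + j)"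
     "x i / (a * b) * q powi 1 * (q\<^sup>2) powi j = x i * x s * q powi (1 - \<beta> + 2 * j)"
     "b * x i / a * (q\<^sup>2) powi j = x i / (a\<^sup>2 * x s) * q powi (\<beta> + 2 * j)" for j
    using q a xs unfolding b powi_sq by (simp_all add: power_int_add power_int_diff power2_eq_square mult_ac)
  have "efac q (a * x i * q powi 1) 0 (2 * m) \<noteq> 0" "efac q (x i / a) 0 (2 * m) \<noteq> 0"
    "efac (q\<^sup>2) (x i / (a * b) * q powi 1) 0 m \<noteq> 0" "efac (q\<^sup>2) (b * x i / a) 0 m \<noteq> 0"
    by (rule efac_nonzero, simp only: e G not_False_eq_True)+
  then show ?thesis unfolding rhs_factor_def by simp
qed

text \<open>In the factorial starting at abx_sq^(1+2k_s) with base q^2, the factor number M - 1 -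
  k_s is \<theta>(1).\<close>

lemma sum_term_eq_0:
  fixes M :: nat
  assumes q: "q \<noteq> 0" and a: "a \<noteq> 0" and s: "s \<in> {1..r}" and xs: "x s \<noteq> 0"
    and b: "b = q powi (1 - 2 * int M) / (a * x s)" and k: "k s < M" "M \<le> n s"
  shows "sum_term q r n a b x k = 0"
proof -
  have "th (a * b * x s * q powi (1 + 2 * int (k s)) * (q\<^sup>2) powi (0 + int (M - 1 - k s))) = 0"
  proof -
    have "a * b * x s * q powi (1 + 2 * int (k s)) * (q\<^sup>2) powi (0 + int (M - 1 - k s))
       = q powi (1 - 2 * int M) * q powi (1 + 2 * int (k s)) * q powi (2 * (0 + int (M - 1 - k s)))"
      using a xs unfolding powi_sq b by simp
    also have "\<dots> = q powi 0"
      unfolding power_int_add[OF disjI1[OF q], symmetric]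
      by (rule arg_cong[where f = "\<lambda>i. q powi i"]) (use k in \<open>simp add: of_nat_diff\<close>)
    finally show ?thesis by simp
  qed
  moreover have "M - 1 - k s \<in> {..<n s - k s}" using k by auto
  ultimately have "efac (q\<^sup>2) (a * b * x s * q powi (1 + 2 * int (k s))) 0 (n s - k s) = 0"
    unfolding efac_def prod_zero_iff[OF finite_lessThan] by blast
  then have "single_factor q a b (x s) (n s) (k s) (vsize r k) * diag_factor q (x s) (n s) (k s) = 0"
    unfolding single_factor_def by simp
  then have "(\<Prod>i=1..r. single_factor q a b (x i) (n i) (k i) (vsize r k) * diag_factor q (x i) (n i) (k i)) = 0"
    using s by (subst prod_zero_iff) auto
  then show ?thesis unfolding sum_term_def by simp
qed

lemma sum_at_shift_point:
  fixes M :: nat and n :: "nat \<Rightarrow> nat" and x :: "nat \<Rightarrow> complex"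
  assumes q: "q \<noteq> 0" and gI: "\<And>j. j > 0 \<Longrightarrow> th (q powi j) \<noteq> 0"
    and a: "a \<noteq> 0" and x: "\<And>i. i \<in> {1..r} \<Longrightarrow> x i \<noteq> 0" and g: "generic q r a x"
    and s: "s \<in> {1..r}" and Mn: "M \<le> n s"
    and n': "n' = n(s := n s - M)"
    and x': "x' = x(s := x s * q powi (2 * int M))" and a': "a' = a * q powi int M"
    and b: "b = q powi (1 - 2 * int M) / (a * x s)" and b': "b' = q powi (1 - int M) / (a * x s)"
    and IH: "(\<Sum>k\<in>mbox r n'. sum_term q r n' a' b' x' k) = (\<Prod>i=1..r. rhs_factor q a' b' (x' i) (n' i))"
  shows "(\<Sum>k\<in>mbox r n. sum_term q r n a b x k) = (\<Prod>i=1..r. rhs_factor q a b (x i) (n i))"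
proof -
  have xs: "x s \<noteq> 0" using x s by blast
  have g': "generic q r a' x'"
  proof -
    have "x' = (\<lambda>i. x i * q powi (if i = s then 2 * int M else 0))" by (auto simp: x')
    then show ?thesis unfolding a' by (simp only: generic_shift[OF q g])
  qed
  \<comment> \<open>In the shifted parameters the exponent becomes 1 + 2M, since a'x'_s = ax_s
    q^(3M).\<close>
  have "b' = q powi (1 + 2 * int M) / (a' * x' s)"
  proof -
    have "q powi (1 + 2 * int M) = q powi (1 - int M) * q powi int M * q powi (2 * int M)"
      unfolding power_int_add[OF disjI1[OF q], symmetric] by simp
    then show ?thesis using q by (simp add: b' a' x')
  qed
  then have "rhs_factor q a' b' (x' i) (n' i) \<noteq> 0" if "i \<in> {1..r}" for i
    using rhs_factor_nonzero[OF q _ g' s that, of b' "1 + 2 * int M"] q a xs by (simp add: a' x')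
  then have R': "(\<Prod>i=1..r. rhs_factor q a' b' (x' i) (n' i)) \<noteq> 0" (is "?R' \<noteq> 0") by simp
  have "(\<Sum>k\<in>mbox r n. sum_term q r n a b x k) = (\<Sum>k\<in>{k \<in> mbox r n. M \<le> k s}. sum_term q r n a b x k)"
  proof (rule sum.mono_neutral_right[OF finite_mbox])
    show "\<forall>k\<in>mbox r n - {k \<in> mbox r n. M \<le> k s}. sum_term q r n a b x k = 0"
    proof
      fix k assume "k \<in> mbox r n - {k \<in> mbox r n. M \<le> k s}"
      then have "k s < M" by auto
      then show "sum_term q r n a b x k = 0" by (rule sum_term_eq_0[where n = n and x = x and k = k and s = s and M = M, OF q a s xs b _ Mn])
    qed
  qed auto
  also have "\<dots> = (\<Sum>k\<in>mbox r n'. sum_term q r n a b x (k(s := k s + M)))"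
    by (rule sum.reindex_bij_witness[of _ "\<lambda>k. k(s := k s + M)" "\<lambda>k. k(s := k s - M)"])
       (use s Mn in \<open>auto simp: mbox_def n' PiE_iff extensional_def fun_eq_iff intro!: diff_le_mono\<close>)
  finally have "(\<Sum>k\<in>mbox r n. sum_term q r n a b x k) * ?R'
      = (\<Sum>k\<in>mbox r n'. sum_term q r n a b x (k(s := k s + M)) * ?R')"
    by (simp add: sum_distrib_right)
  also have "\<dots> = (\<Sum>k\<in>mbox r n'. sum_term q r n' a' b' x' k * (\<Prod>i=1..r. rhs_factor q a b (x i) (n i)))"
    by (intro sum.cong refl sum_term_shift[OF q gI a x g s Mn n' _ x' a' b b'])
  also have "\<dots> = (\<Prod>i=1..r. rhs_factor q a b (x i) (n i)) * ?R'"
    unfolding sum_distrib_right[symmetric] IH by (simp only: mult.commute)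
  finally show ?thesis using R' by simp
qed

section \<open>The value at b = 1\<close>

lemma efac_double: "q \<noteq> 0 \<Longrightarrow> efac q c 0 (2 * n) = efac (q\<^sup>2) c 0 n * efac (q\<^sup>2) (c * q) 0 n"
proof (induction n)
  case (Suc n)
  have "2 * Suc n = Suc (Suc (2 * n))" by simp
  moreover have "(q\<^sup>2) ^ n = q powi (int n * 2)"
    using powi_sq[of q "int n"] by (simp add: mult.commute)
  ultimately show ?case using Suc
    by (simp add: efac_Suc power_int_add mult_ac)
qed simp

lemma sum_at_one:
  fixes n :: "nat \<Rightarrow> nat" and x :: "nat \<Rightarrow> complex"
  assumes q: "q \<noteq> 0" and g: "generic q r a x"
  shows "(\<Sum>k\<in>mbox r n. sum_term q r n a 1 x k) = (\<Prod>i=1..r. rhs_factor q a 1 (x i) (n i))"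
proof -
  define k0 :: "nat \<Rightarrow> nat" where "k0 = (\<lambda>i\<in>{1..r}. 0)"
  have k0: "k0 \<in> mbox r n" by (auto simp: k0_def mbox_def)
  have v0: "vsize r k0 = 0" by (simp add: vsize_def k0_def)
  have zero: "sum_term q r n a 1 x k = 0" if k: "k \<in> mbox r n - {k0}" for k
  proof -
    have "vsize r k \<noteq> 0"
    proof
      assume "vsize r k = 0"
      then have "\<forall>i\<in>{1..r}. k i = 0" by (simp add: vsize_def)
      then have "k = k0" using k by (auto simp: k0_def mbox_def PiE_iff extensional_def fun_eq_iff)
      then show False using k by simp
    qed
    then have "0 \<in> {..<vsize r k}" by simp
    \<comment> \<open>For |k| > 0 the factor (b;q,p)_{|k|} starts with \<theta>(b).\<close>
    moreover have "th (1 * q powi (0 + int 0)) = 0" by simp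
    ultimately have "efac q 1 0 (vsize r k) = 0"
      unfolding efac_def prod_zero_iff[OF finite_lessThan] by blast
    then show ?thesis by (simp add: sum_term_def global_factor_def)
  qed
  have "(\<Sum>k\<in>mbox r n. sum_term q r n a 1 x k) = (\<Sum>k\<in>{k0}. sum_term q r n a 1 x k)"
    by (rule sum.mono_neutral_right[OF finite_mbox]) (use k0 zero in auto)
  also have "\<dots> = sum_term q r n a 1 x k0" by simp
  also have "\<dots> = (\<Prod>i=1..r. rhs_factor q a 1 (x i) (n i))"
  proof -
    have "(\<Prod>i=1..r. \<Prod>j=i+1..r. cross_factor q (x i) (x j) (n i) (n j) (k0 i) (k0 j)) = 1"
    proof (intro prod.neutral ballI)
      fix i j assume ij: "i \<in> {1..r}" "j \<in> {i+1..r}"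
      then have "j \<in> {1..r}" "i \<noteq> j" by auto
      then have "th (x i / x j * q powi 0) \<noteq> 0" using g ij(1) unfolding generic_def by blast
      then show "cross_factor q (x i) (x j) (n i) (n j) (k0 i) (k0 j) = 1"
        using ij by (simp add: cross_factor_def k0_def)
    qed
    \<comment> \<open>Splitting (axq;q,p)_{2n} and (x/a;q,p)_{2n} into even and odd indices gives
      base q^2: the former yields the two tails of the summand, the latter cancels on the right-hand
      side.\<close>
    moreover have "single_factor q a 1 (x i) (n i) (k0 i) 0 * diag_factor q (x i) (n i) (k0 i)
        = rhs_factor q a 1 (x i) (n i)" if i: "i \<in> {1..r}" for i
    proof -
      have t: "th (a * x i * q powi 0) \<noteq> 0" using g i unfolding generic_def by blast
      have "efac q (x i / a) 0 (2 * n i) \<noteq> 0"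
        by (rule efac_nonzero) (use g i in \<open>unfold generic_def, blast\<close>)
      moreover have "efac q (a * x i * q) 0 (2 * n i)
          = efac (q\<^sup>2) (a * x i * q) 0 (n i) * efac (q\<^sup>2) (a * x i * q\<^sup>2) 0 (n i)"
        using efac_double[OF q, of "a * x i * q" "n i"] by (simp only: power2_eq_square mult.assoc)
      ultimately show ?thesis
        using i t efac_double[OF q, of "x i / a" "n i"]
        by (simp add: single_factor_def diag_factor_def rhs_factor_def k0_def)
    qed
    ultimately show ?thesis unfolding sum_term_def v0 by (simp add: global_factor_def)
  qed
  finally show ?thesis .
qed

section \<open>Degrees in b, and the induction\<close>

text \<open>The degree is the same for all k: (b, q/b;q,p)_{|k|} contributes |k|, and the tails of
  index i contribute n_i - k_i. The rest of the term is constant in b.\<close>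

lemma theta_form_sum_term:
  assumes basis: "theta_basis q g h" and q: "q \<noteq> 0" and a: "a \<noteq> 0"
    and x: "\<And>i. i \<in> {1..r} \<Longrightarrow> x i \<noteq> 0" and k: "k \<in> mbox r n"
  shows "theta_form g h (vsize r n) (\<lambda>b. sum_term q r n a b x k)"
proof -
  let ?N = "vsize r k"
  define c where "c i = a * x i * q powi (1 + 2 * int (k i))" for i
  define S where "S i = th (a * x i * q powi (2 * int (k i) + int ?N)) / th (a * x i) * efac q (a * x i) 0 ?N
     * efac q (a / x i * q powi 1) 0 (?N - k i)
     / (efac q (a * x i * q powi (2 * int (n i) + 1)) 0 ?N * efac q (a / x i * q powi (1 - 2 * int (n i))) 0 ?N
        * efac q (x i / a * q powi (int (k i) - int ?N)) 0 (k i))" for i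
  define C where "C = (\<Prod>i=1..r. \<Prod>j=i+1..r. cross_factor q (x i) (x j) (n i) (n j) (k i) (k j))
     * (\<Prod>i=1..r. S i * diag_factor q (x i) (n i) (k i)) * (q powi int ?N * efac (q\<^sup>2) (a\<^sup>2 * q) 0 ?N)"
  have q2: "q\<^sup>2 \<noteq> 0" using q by simp
  have c: "c i \<noteq> 0" if "i \<in> {1..r}" for i using x[OF that] a q by (simp add: c_def)
  have "theta_form g h (0 + ?N + (\<Sum>i\<in>{1..r}. n i - k i))
    (\<lambda>b. C * (efac q (1 * b) 0 ?N * efac q (1 * q / b) 0 ?N)
      * (\<Prod>i\<in>{1..r}. efac (q\<^sup>2) (c i * b) 0 (n i - k i) * efac (q\<^sup>2) (c i * q / b) 0 (n i - k i)))"
    by (intro theta_form_efac_pair_prod[OF basis _ q2] theta_form_efac_pair[OF basis _ q] theta_form_const c) auto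
  moreover have "0 + ?N + (\<Sum>i\<in>{1..r}. n i - k i) = vsize r n"
  proof -
    have "k i \<le> n i" if "i \<in> {1..r}" for i using k that by (auto simp: mbox_def)
    then show ?thesis unfolding vsize_def by (simp flip: sum.distrib)
  qed
  moreover have "C * (efac q (1 * b) 0 ?N * efac q (1 * q / b) 0 ?N)
      * (\<Prod>i\<in>{1..r}. efac (q\<^sup>2) (c i * b) 0 (n i - k i) * efac (q\<^sup>2) (c i * q / b) 0 (n i - k i))
    = sum_term q r n a b x k" for b
  proof -
    have e: "a * b * x i * q powi (1 + 2 * int (k i)) = c i * b"
      "a * x i / b * q powi (2 + 2 * int (k i)) = c i * q / b" for i
      using q by (simp_all add: c_def power_int_add power2_eq_square)
    have s: "single_factor q a b (x i) (n i) (k i) ?N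
       = S i * efac (q\<^sup>2) (c i * b) 0 (n i - k i) * efac (q\<^sup>2) (c i * q / b) 0 (n i - k i)" for i
      unfolding single_factor_def e S_def ..
    show ?thesis
      unfolding sum_term_def C_def s global_factor_def by (simp add: prod.distrib mult_ac)
  qed
  ultimately show ?thesis by simp
qed

lemma theta_form_rhs:
  assumes basis: "theta_basis q g h" and q: "q \<noteq> 0" and a: "a \<noteq> 0"
    and x: "\<And>i. i \<in> {1..r} \<Longrightarrow> x i \<noteq> 0"
  shows "theta_form g h (vsize r n) (\<lambda>b. \<Prod>i=1..r. rhs_factor q a b (x i) (n i))"
proof -
  define C where "C = (\<Prod>i=1..r. efac q (a * x i * q powi 1) 0 (2 * n i) / efac q (x i / a) 0 (2 * n i))"
  have q2: "q\<^sup>2 \<noteq> 0" using q by simp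
  have "theta_form g h (0 + (\<Sum>i\<in>{1..r}. n i))
    (\<lambda>b. C * (\<Prod>i\<in>{1..r}. efac (q\<^sup>2) (x i / a * b) 0 (n i) * efac (q\<^sup>2) (x i / a * q / b) 0 (n i)))"
    by (intro theta_form_efac_pair_prod[OF basis _ q2] theta_form_const) (use x a in auto)
  moreover have "C * (\<Prod>i\<in>{1..r}. efac (q\<^sup>2) (x i / a * b) 0 (n i) * efac (q\<^sup>2) (x i / a * q / b) 0 (n i))
    = (\<Prod>i=1..r. rhs_factor q a b (x i) (n i))" for b
  proof -
    have e: "x i / (a * b) * q powi 1 = x i / a * q / b" "b * x i / a = x i / a * b" for i
      by simp_all
    show ?thesis unfolding C_def rhs_factor_def e by (simp only: prod.distrib mult_ac)
  qed
  ultimately show ?thesis by (simp add: vsize_def)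
qed

lemma generic_sum:
  fixes n :: "nat \<Rightarrow> nat" and x :: "nat \<Rightarrow> complex"
  assumes q: "q \<noteq> 0" and gI: "\<And>j. j > 0 \<Longrightarrow> th (q powi j) \<noteq> 0"
    and a: "a \<noteq> 0" and x: "\<And>i. i \<in> {1..r} \<Longrightarrow> x i \<noteq> 0" and g: "generic q r a x" and b: "b \<noteq> 0"
  shows "(\<Sum>k\<in>mbox r n. sum_term q r n a b x k) = (\<Prod>i=1..r. rhs_factor q a b (x i) (n i))"
  using a x g b
proof (induction "vsize r n" arbitrary: n a b x rule: less_induct)
  case less
  note a = less.prems(1) and x = less.prems(2) and g = less.prems(3)
  obtain gg hh where basis: "theta_basis q gg hh" using theta_basis_exists[OF q] .
  let ?f = "\<lambda>b. (\<Sum>k\<in>mbox r n. sum_term q r n a b x k) + - 1 * (\<Prod>i=1..r. rhs_factor q a b (x i) (n i))"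
  \<comment> \<open>\<open>None\<close> stands for the point 1, and \<open>Some (s, m)\<close> for
    the point with M = m + 1.\<close>
  let ?J = "insert None (Some ` (SIGMA s:{1..r}. {..<n s}))"
  define \<beta> where "\<beta> z = (case z of None \<Rightarrow> 1 | Some (s, m) \<Rightarrow> q powi (1 - 2 * int (m + 1)) / (a * x s))" for z :: "(nat \<times> nat) option"
  have gIz: "th (q powi j) \<noteq> 0" if "j \<noteq> 0" for j
  proof (cases "j > 0")
    case False
    then have "th (q powi (- j)) \<noteq> 0" using gI that by simp
    then show ?thesis using th_inverse[of "q powi (- j)"] q by (auto simp: power_int_minus divide_simps)
  qed (rule gI)
  have form: "theta_form gg hh (vsize r n) ?f"
    by (intro theta_form_add theta_form_cmult theta_form_sum theta_form_sum_term[OF basis q a x]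
        theta_form_rhs[OF basis q a x])
  have "?f b = 0"
  proof (rule theta_form_unique[OF basis form, of ?J \<beta>])
    show "finite ?J" by (intro finite.insertI finite_imageI finite_SigmaI) auto
    show "card ?J > vsize r n"
    proof -
      have "card ?J = Suc (card (Some ` (SIGMA s:{1..r}. {..<n s})))"
        by (intro card_insert_disjoint finite_imageI finite_SigmaI) auto
      also have "card (Some ` (SIGMA s:{1..r}. {..<n s})) = vsize r n"
        by (subst card_image) (auto simp: vsize_def)
      finally show ?thesis by simp
    qed
    show "\<beta> z \<noteq> 0" if "z \<in> ?J" for z
      using that q a x by (auto simp: \<beta>_def)
    have G: "th (a * x i * q powi m) \<noteq> 0" "th (a\<^sup>2 * x i * x j * q powi m) \<noteq> 0"
      "i \<noteq> j \<Longrightarrow> th (x i / x j * q powi m) \<noteq> 0"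
      if "i \<in> {1..r}" "j \<in> {1..r}" for i j m
      using g that unfolding generic_def by blast+
    have inv: "th z \<noteq> 0" if "z' \<noteq> 0" "th z' \<noteq> 0" "z = 1 / z'" for z z'
      using that th_inverse[of z'] by simp
    have N: "th (\<beta> (Some (s, m)) * 1 / q) \<noteq> 0" "th (\<beta> (Some (s, m)) / 1) \<noteq> 0"
      "th (1 * \<beta> (Some (s, m)) / q) \<noteq> 0" "th (1 / \<beta> (Some (s, m))) \<noteq> 0"
      if s: "s \<in> {1..r}" for s m
    proof -
      have e: "\<beta> (Some (s, m)) * 1 / q = 1 / (a * x s * q powi (2 + 2 * int m))"
        "\<beta> (Some (s, m)) / 1 = 1 / (a * x s * q powi (1 + 2 * int m))"
      proof -
        have "q powi (1 - 2 * int (m + 1)) * q powi (1 + 2 * int m) = 1"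
          "q powi (1 - 2 * int (m + 1)) * q powi (2 + 2 * int m) = q"
          unfolding power_int_add[OF disjI1[OF q], symmetric] by simp_all
        then show "\<beta> (Some (s, m)) * 1 / q = 1 / (a * x s * q powi (2 + 2 * int m))"
          "\<beta> (Some (s, m)) / 1 = 1 / (a * x s * q powi (1 + 2 * int m))"
          using q a x[OF s] by (simp_all add: \<beta>_def field_simps)
      qed
      have nz: "a * x s * q powi m \<noteq> 0" for m using q a x[OF s] by simp
      show "th (\<beta> (Some (s, m)) * 1 / q) \<noteq> 0" by (rule inv[OF nz G(1)[OF s s] e(1)])
      then show "th (1 * \<beta> (Some (s, m)) / q) \<noteq> 0" by simp
      show "th (\<beta> (Some (s, m)) / 1) \<noteq> 0" by (rule inv[OF nz G(1)[OF s s] e(2)])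
      have "1 / \<beta> (Some (s, m)) = a * x s * q powi (1 + 2 * int m)" using e(2) nz by simp
      then show "th (1 / \<beta> (Some (s, m))) \<noteq> 0" using G(1)[OF s s] by simp
    qed
    \<comment> \<open>The product of two such points, divided by q, is the inverse of a^2 x_s x_t
      times a power of q; their quotient is x_t/x_s times a power of q. Both occur in
      \<open>generic\<close>.\<close>
    have SS: "th (\<beta> (Some (s, m)) * \<beta> (Some (t, l)) / q) * th (\<beta> (Some (s, m)) / \<beta> (Some (t, l))) \<noteq> 0"
      if s: "s \<in> {1..r}" and t: "t \<in> {1..r}" and ne: "(s, m) \<noteq> (t, l)" for s t m l
    proof -
      have e1: "\<beta> (Some (s, m)) * \<beta> (Some (t, l)) / q = 1 / (a\<^sup>2 * x s * x t * q powi (3 + 2 * int m + 2 * int l))"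
      proof -
        have "q powi (1 - 2 * int (m + 1)) * q powi (1 - 2 * int (l + 1)) * q powi (3 + 2 * int m + 2 * int l) = q"
          unfolding power_int_add[OF disjI1[OF q], symmetric] by simp
        then show ?thesis using q a x[OF s] x[OF t] by (simp add: \<beta>_def field_simps power2_eq_square)
      qed
      have e2: "\<beta> (Some (s, m)) / \<beta> (Some (t, l)) = x t / x s * q powi (2 * int l - 2 * int m)"
      proof -
        have "q powi (1 - 2 * int (m + 1)) = q powi (1 - 2 * int (l + 1)) * q powi (2 * int l - 2 * int m)"
          unfolding power_int_add[OF disjI1[OF q], symmetric] by simp
        then show ?thesis using q a x[OF s] x[OF t] by (simp add: \<beta>_def)
      qed
      have 1: "th (\<beta> (Some (s, m)) * \<beta> (Some (t, l)) / q) \<noteq> 0"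
        by (rule inv[OF _ G(2)[OF s t] e1]) (use q a x[OF s] x[OF t] in simp)
      have 2: "th (\<beta> (Some (s, m)) / \<beta> (Some (t, l))) \<noteq> 0"
      proof (cases "s = t")
        case True
        \<comment> \<open>For s = t the quotient is a nonzero power of q, so the hypothesis on p and
          q enters here.\<close>
        then have "2 * int l - 2 * int m \<noteq> 0" using ne by simp
        then show ?thesis unfolding e2 using gIz True x[OF s] by simp
      next
        case False
        then show ?thesis unfolding e2 using G(3)[OF t s] by blast
      qed
      show ?thesis using 1 2 by simp
    qed
    have \<beta>None: "\<beta> None = 1" by (simp add: \<beta>_def)
    show "th (\<beta> z * \<beta> z' / q) * th (\<beta> z / \<beta> z') \<noteq> 0" if "z \<in> ?J" "z' \<in> ?J" "z \<noteq> z'" for z z'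
      using that
    proof (cases z; cases z')
      fix u assume u: "z = None" "z' = Some u"
      obtain s m where "u = (s, m)" by (cases u)
      then show ?thesis using u that N[of s m] by (auto simp: \<beta>None)
    next
      fix u assume u: "z = Some u" "z' = None"
      obtain s m where "u = (s, m)" by (cases u)
      then show ?thesis using u that N[of s m] by (auto simp: \<beta>None)
    next
      fix u u' assume u: "z = Some u" "z' = Some u'"
      obtain s m t l where "u = (s, m)" "u' = (t, l)" by (cases u; cases u')
      then show ?thesis using u that SS[of s t m l] by auto
    qed simp_all
    show "?f (\<beta> z) = 0" if z: "z \<in> ?J" for z
    proof (cases z)
      case None
      then show ?thesis using sum_at_one[OF q g, of n] by (simp add: \<beta>None)
    next
      case (Some u)
      then obtain s m where u: "z = Some (s, m)" and s: "s \<in> {1..r}" and m: "m < n s"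
        using z by (cases u) auto
      define M where "M = m + 1"
      have Mn: "M \<le> n s" "M > 0" using m by (auto simp: M_def)
      define n' x' a' b' where "n' = n(s := n s - M)" and "x' = x(s := x s * q powi (2 * int M))"
        and "a' = a * q powi int M" and "b' = q powi (1 - int M) / (a * x s)"
      have lt: "vsize r n' < vsize r n"
        unfolding vsize_def by (rule sum_strict_mono_ex1) (use s Mn in \<open>auto simp: n'_def\<close>)
      have g': "generic q r a' x'"
      proof -
        have "x' = (\<lambda>i. x i * q powi (if i = s then 2 * int M else 0))" by (auto simp: x'_def)
        then show ?thesis unfolding a'_def by (simp only: generic_shift[OF q g])
      qed
      have "a' \<noteq> 0" "b' \<noteq> 0" "\<And>i. i \<in> {1..r} \<Longrightarrow> x' i \<noteq> 0"
        using a q x s by (auto simp: a'_def b'_def x'_def)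
      then have IH: "(\<Sum>k\<in>mbox r n'. sum_term q r n' a' b' x' k) = (\<Prod>i=1..r. rhs_factor q a' b' (x' i) (n' i))"
        using less.hyps[OF lt _ _ g'] by blast
      have bz: "\<beta> z = q powi (1 - 2 * int M) / (a * x s)" by (simp add: \<beta>_def u M_def)
      show ?thesis
        using sum_at_shift_point[OF q gI a x g s Mn(1) n'_def x'_def a'_def bz b'_def IH] by simp
    qed
    show "b \<noteq> 0" by (rule less.prems(4))
  qed
  then show ?case by simp
qed

end

section \<open>Arbitrary parameters\<close>

lemma finite_powi_roots:
  fixes w :: complex
  assumes "e \<noteq> 0"
  shows "finite {t. t powi e = w}"
proof (cases "e > 0")
  case True
  then have "{t. t powi e = w} = {t. t ^ nat e = w}" by (simp add: power_int_def)
  then show ?thesis using True finite_nth_roots[of "nat e" w] by simp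
next
  case False
  then have "{t. t powi e = w} \<subseteq> {t. t ^ nat (- e) = inverse w}"
    by (auto simp: power_int_def power_inverse)
  then show ?thesis using False assms finite_nth_roots[of "nat (- e)" "inverse w"]
    by (auto intro: finite_subset)
qed

text \<open>Every ball around z is uncountable and hence contains a point outside B.\<close>

lemma LIMSEQ_avoid_countable:
  fixes z :: complex
  assumes "countable B"
  obtains t where "t \<longlonglongrightarrow> z" "\<And>m. t m \<notin> B"
proof -
  have "\<exists>t. t \<in> ball z (1 / real (Suc m)) \<and> t \<notin> B" for m
  proof -
    have "uncountable (ball z (1 / real (Suc m)))" by (rule uncountable_ball) simp
    then show ?thesis using assms countable_subset[of "ball z (1 / real (Suc m))" B] by blast
  qed
  then obtain t where t: "\<And>m. t m \<in> ball z (1 / real (Suc m))" "\<And>m. t m \<notin> B" by metis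
  have "t \<longlonglongrightarrow> z"
  proof (rule tendsto_dist_iff[THEN iffD2], rule tendsto_sandwich[OF _ _ tendsto_const LIMSEQ_inverse_real_of_nat])
    show "\<forall>\<^sub>F m in sequentially. dist (t m) z \<le> inverse (real (Suc m))"
      using t(1) by (intro always_eventually allI) (auto simp: dist_commute inverse_eq_divide less_imp_le)
  qed simp
  then show ?thesis using t(2) by (rule that)
qed

context elliptic_nome
begin

text \<open>A zero forces c t^e to be an integer power of p: countably many values, each with
  finitely many roots t.\<close>

lemma countable_th_zeros:
  assumes c: "c \<noteq> 0" and e: "e \<noteq> 0"
  shows "countable {t. t \<noteq> 0 \<and> th (c * t powi e) = 0}"
proof (rule countable_subset)
  show "{t. t \<noteq> 0 \<and> th (c * t powi e) = 0} \<subseteq> (\<Union>l::int. {t. t powi e = p powi l / c})"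
  proof clarify
    fix t assume t: "t \<noteq> 0" "th (c * t powi e) = 0"
    then obtain l where "c * t powi e = p powi l"
      using theta_eq_0D[OF nome, of "c * t powi e"] c by auto
    then show "t \<in> (\<Union>l::int. {t. t powi e = p powi l / c})" using c by (auto simp: field_simps)
  qed
  show "countable (\<Union>l::int. {t. t powi e = p powi l / c})"
    by (intro countable_UN countableI_type countable_finite[OF finite_powi_roots[OF e]])
qed

text \<open>
  The exponents \<open>3i\<close> ensure that every monomial occurring in the genericity condition varies with \<open>t\<close>.
\<close>

lemma generic_perturbation:
  assumes q: "q \<noteq> 0" and a: "a \<noteq> 0" and x_all: "\<forall>i\<in>{1..r}. x i \<noteq> 0"
  obtains t where "t \<longlonglongrightarrow> 1" "\<And>m. t m \<noteq> 0"
    "\<And>m. generic q r (a * t m) (\<lambda>i. x i * t m ^ (3 * i))"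
proof -
  have x: "x i \<noteq> 0" if "i \<in> {1..r}" for i using x_all that by blast
  define Z where "Z c e = {t. t \<noteq> 0 \<and> th (c * t powi e) = 0}" for c e
  \<comment> \<open>The values of t at which \<open>generic\<close> fails for i, j, m. The second
    argument of \<open>Z\<close> is the exponent of t in the monomial when a is scaled by t and x_i
    by t^(3i).\<close>
  define W where "W i j m =
     Z (a * x i * q powi m) (3 * int i + 1) \<union> Z (x i / a * q powi m) (3 * int i - 1)
     \<union> (if i = j then {} else Z (x i / x j * q powi m) (3 * int i - 3 * int j))
     \<union> Z (x i * x j * q powi m) (3 * int i + 3 * int j)
     \<union> Z (a\<^sup>2 * x i * x j * q powi m) (3 * int i + 3 * int j + 2)
     \<union> Z (x i / (a\<^sup>2 * x j) * q powi m) (3 * int i - 3 * int j - 2)" for i j and m :: int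
  define B where "B = insert 0 (\<Union>i\<in>{1..r}. \<Union>j\<in>{1..r}. \<Union>m. W i j m)"
  have cZ: "countable (Z c e)" if "c \<noteq> 0" "e \<noteq> 0" for c e
    unfolding Z_def using that by (rule countable_th_zeros)
  have "countable B"
    unfolding B_def W_def
  proof (intro countable_insert countable_UN countable_Un)
    fix i j m assume ij: "i \<in> {1..r}" "j \<in> {1..r}"
    show "countable (Z (a * x i * q powi m) (3 * int i + 1))"
      "countable (Z (x i / a * q powi m) (3 * int i - 1))"
      "countable (Z (x i * x j * q powi m) (3 * int i + 3 * int j))"
      "countable (Z (a\<^sup>2 * x i * x j * q powi m) (3 * int i + 3 * int j + 2))"
    proof -
      have "3 * int i - 1 \<noteq> 0" by presburger
      moreover have "3 * int i + 1 \<noteq> 0" "3 * int i + 3 * int j \<noteq> 0" "3 * int i + 3 * int j + 2 \<noteq> 0"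
        using ij by auto
      ultimately show "countable (Z (a * x i * q powi m) (3 * int i + 1))"
        "countable (Z (x i / a * q powi m) (3 * int i - 1))"
        "countable (Z (x i * x j * q powi m) (3 * int i + 3 * int j))"
        "countable (Z (a\<^sup>2 * x i * x j * q powi m) (3 * int i + 3 * int j + 2))"
        using q a x[OF ij(1)] x[OF ij(2)] by (auto intro!: cZ simp del: mult_eq_0_iff)
    qed
    \<comment> \<open>The exponent is congruent to 1 modulo 3, hence nonzero even for i = j.\<close>
    show "countable (Z (x i / (a\<^sup>2 * x j) * q powi m) (3 * int i - 3 * int j - 2))"
      by (rule cZ) (use ij q a x[OF ij(1)] x[OF ij(2)] in \<open>simp, presburger\<close>)
    show "countable (if i = j then {} else Z (x i / x j * q powi m) (3 * int i - 3 * int j))"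
      using ij q x[OF ij(1)] x[OF ij(2)] by (auto intro!: cZ)
  qed auto
  then obtain t where t: "t \<longlonglongrightarrow> (1 :: complex)" "\<And>m. t m \<notin> B" using LIMSEQ_avoid_countable[of B 1] by blast
  have t0: "t m \<noteq> 0" for m using t(2)[of m] by (auto simp: B_def)
  have "generic q r (a * t m) (\<lambda>i. x i * t m ^ (3 * i))" for m
    unfolding generic_def
  proof (intro ballI allI)
    fix i j and l :: int assume ij: "i \<in> {1..r}" "j \<in> {1..r}"
    define s where "s = t m"
    have s0: "s \<noteq> 0" and sB: "s \<notin> B" using t0 t(2) by (auto simp: s_def)
    have s3: "s ^ (3 * k) = s powi (3 * int k)" for k
      using power_int_of_nat[of s "3 * k"] by simp
    have sW: "s \<notin> W i j l" using sB ij unfolding B_def by blast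
    have nZ: "s \<notin> Z (a * x i * q powi l) (3 * int i + 1)" "s \<notin> Z (x i / a * q powi l) (3 * int i - 1)"
      "i \<noteq> j \<Longrightarrow> s \<notin> Z (x i / x j * q powi l) (3 * int i - 3 * int j)"
      "s \<notin> Z (x i * x j * q powi l) (3 * int i + 3 * int j)"
      "s \<notin> Z (a\<^sup>2 * x i * x j * q powi l) (3 * int i + 3 * int j + 2)"
      "s \<notin> Z (x i / (a\<^sup>2 * x j) * q powi l) (3 * int i - 3 * int j - 2)"
      using sW unfolding W_def by simp_all
    have e: "a * s * (x i * s powi (3 * int i)) * q powi l = a * x i * q powi l * s powi (3 * int i + 1)"
      "x i * s powi (3 * int i) / (a * s) * q powi l = x i / a * q powi l * s powi (3 * int i - 1)"
      "x i * s powi (3 * int i) / (x j * s powi (3 * int j)) * q powi l = x i / x j * q powi l * s powi (3 * int i - 3 * int j)"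
      "x i * s powi (3 * int i) * (x j * s powi (3 * int j)) * q powi l = x i * x j * q powi l * s powi (3 * int i + 3 * int j)"
      "(a * s)\<^sup>2 * (x i * s powi (3 * int i)) * (x j * s powi (3 * int j)) * q powi l = a\<^sup>2 * x i * x j * q powi l * s powi (3 * int i + 3 * int j + 2)"
      "x i * s powi (3 * int i) / ((a * s)\<^sup>2 * (x j * s powi (3 * int j))) * q powi l = x i / (a\<^sup>2 * x j) * q powi l * s powi (3 * int i - 3 * int j - 2)"
      using s0 by (simp_all add: power_int_add power_int_diff power2_eq_square mult_ac)
    show "th (a * t m * (x i * t m ^ (3 * i)) * q powi l) \<noteq> 0
      \<and> th (x i * t m ^ (3 * i) / (a * t m) * q powi l) \<noteq> 0
      \<and> (i \<noteq> j \<longrightarrow> th (x i * t m ^ (3 * i) / (x j * t m ^ (3 * j)) * q powi l) \<noteq> 0)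
      \<and> th (x i * t m ^ (3 * i) * (x j * t m ^ (3 * j)) * q powi l) \<noteq> 0
      \<and> th ((a * t m)\<^sup>2 * (x i * t m ^ (3 * i)) * (x j * t m ^ (3 * j)) * q powi l) \<noteq> 0
      \<and> th (x i * t m ^ (3 * i) / ((a * t m)\<^sup>2 * (x j * t m ^ (3 * j))) * q powi l) \<noteq> 0"
      unfolding s_def[symmetric] s3 e using nZ s0 unfolding Z_def by blast
  qed
  then show ?thesis using t t0 that by blast
qed

section \<open>Continuity of the factors in a and x\<close>

lemma th_tendsto:
  assumes "f \<longlonglongrightarrow> c" "c \<noteq> 0" "\<And>m. f m \<noteq> 0"
  shows "(\<lambda>m. th (f m)) \<longlonglongrightarrow> th c"
  by (rule theta_tendsto[OF nome assms(2,1,3)])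

lemma efac_tendsto:
  assumes "u \<noteq> 0" "f \<longlonglongrightarrow> c" "c \<noteq> 0" "\<And>m. f m \<noteq> 0"
  shows "(\<lambda>m. efac u (f m) i k) \<longlonglongrightarrow> efac u c i k"
  unfolding efac_def using assms by (intro tendsto_prod th_tendsto tendsto_intros) auto

lemma cross_factor_tendsto:
  assumes q: "q \<noteq> 0" and X: "X \<longlonglongrightarrow> x" and Y: "Y \<longlonglongrightarrow> y"
    and nz: "x \<noteq> 0" "y \<noteq> 0" "\<And>m. X m \<noteq> 0" "\<And>m. Y m \<noteq> 0"
    and d: "th (x / y) \<noteq> 0" "efac (q\<^sup>2) (x * y) 0 (k + l) \<noteq> 0"
      "efac (q\<^sup>2) (x / y * q powi 2) 0 k \<noteq> 0" "efac (q\<^sup>2) (y / x * q powi 2) 0 l \<noteq> 0"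
  shows "(\<lambda>t. cross_factor q (X t) (Y t) n m k l) \<longlonglongrightarrow> cross_factor q x y n m k l"
  unfolding cross_factor_def
  by (intro tendsto_intros th_tendsto efac_tendsto X Y d) (use q nz in auto)

lemma single_factor_tendsto:
  assumes q: "q \<noteq> 0" and A: "A \<longlonglongrightarrow> a" and X: "X \<longlonglongrightarrow> x"
    and nz: "a \<noteq> 0" "b \<noteq> 0" "x \<noteq> 0" "\<And>m. A m \<noteq> 0" "\<And>m. X m \<noteq> 0"
    and d: "th (a * x) \<noteq> 0" "efac q (a * x * q powi (2 * int n + 1)) 0 N \<noteq> 0"
      "efac q (a / x * q powi (1 - 2 * int n)) 0 N \<noteq> 0" "efac q (x / a * q powi (int k - int N)) 0 k \<noteq> 0"
  shows "(\<lambda>t. single_factor q (A t) b (X t) n k N) \<longlonglongrightarrow> single_factor q a b x n k N"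
  unfolding single_factor_def
  by (intro tendsto_intros th_tendsto efac_tendsto A X) (use q nz d in auto)

lemma diag_factor_tendsto:
  assumes q: "q \<noteq> 0" and X: "X \<longlonglongrightarrow> x" and nz: "x \<noteq> 0" "\<And>m. X m \<noteq> 0"
    and d: "efac (q\<^sup>2) (q powi 2) 0 k \<noteq> 0"
  shows "(\<lambda>t. diag_factor q (X t) n k) \<longlonglongrightarrow> diag_factor q x n k"
  unfolding diag_factor_def
  by (intro tendsto_intros efac_tendsto X d) (use q nz in auto)

lemma global_factor_tendsto:
  assumes q: "q \<noteq> 0" and A: "A \<longlonglongrightarrow> a" and nz: "a \<noteq> 0" "\<And>m. A m \<noteq> 0"
  shows "(\<lambda>t. global_factor q (A t) b N) \<longlonglongrightarrow> global_factor q a b N"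
  unfolding global_factor_def
  by (intro tendsto_intros efac_tendsto A) (use q nz in auto)

lemma rhs_factor_tendsto:
  assumes q: "q \<noteq> 0" and A: "A \<longlonglongrightarrow> a" and X: "X \<longlonglongrightarrow> x"
    and nz: "a \<noteq> 0" "b \<noteq> 0" "x \<noteq> 0" "\<And>m. A m \<noteq> 0" "\<And>m. X m \<noteq> 0"
    and d: "efac q (x / a) 0 (2 * n) \<noteq> 0"
  shows "(\<lambda>t. rhs_factor q (A t) b (X t) n) \<longlonglongrightarrow> rhs_factor q a b x n"
  unfolding rhs_factor_def
  by (intro tendsto_intros efac_tendsto A X d) (use q nz in auto)

text \<open>Since \<open>generic\<close> constrains only a and the x_i, these are perturbed while b
  stays fixed. Both sides are continuous at the original parameters because their denominators do
  not vanish there, which is what d1 to d8 express.\<close>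

lemma sum_identity:
  fixes n :: "nat \<Rightarrow> nat" and x :: "nat \<Rightarrow> complex"
  assumes q: "q \<noteq> 0" and gI: "\<And>j. j > 0 \<Longrightarrow> th (q powi j) \<noteq> 0"
    and a: "a \<noteq> 0" and b: "b \<noteq> 0" and x: "\<And>i. i \<in> {1..r} \<Longrightarrow> x i \<noteq> 0"
    and d1: "\<And>i j. i \<in> {1..r} \<Longrightarrow> j \<in> {i+1..r} \<Longrightarrow> th (x i / x j) \<noteq> 0"
    and d2: "\<And>k i j. k \<in> mbox r n \<Longrightarrow> i \<in> {1..r} \<Longrightarrow> j \<in> {i+1..r} \<Longrightarrow>
      efac (q\<^sup>2) (x i * x j) 0 (k i + k j) \<noteq> 0"
    and d3: "\<And>k i j. k \<in> mbox r n \<Longrightarrow> i \<in> {1..r} \<Longrightarrow> j \<in> {1..r} \<Longrightarrow>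
      efac (q\<^sup>2) (x i / x j * q powi 2) 0 (k i) \<noteq> 0"
    and d4: "\<And>i. i \<in> {1..r} \<Longrightarrow> th (a * x i) \<noteq> 0"
    and d5: "\<And>k i. k \<in> mbox r n \<Longrightarrow> i \<in> {1..r} \<Longrightarrow>
      efac q (a * x i * q powi (2 * int (n i) + 1)) 0 (vsize r k) \<noteq> 0"
    and d6: "\<And>k i. k \<in> mbox r n \<Longrightarrow> i \<in> {1..r} \<Longrightarrow>
      efac q (a / x i * q powi (1 - 2 * int (n i))) 0 (vsize r k) \<noteq> 0"
    and d7: "\<And>k i. k \<in> mbox r n \<Longrightarrow> i \<in> {1..r} \<Longrightarrow>
      efac q (x i / a * q powi (int (k i) - int (vsize r k))) 0 (k i) \<noteq> 0"
    and d8: "\<And>i. i \<in> {1..r} \<Longrightarrow> efac q (x i / a) 0 (2 * n i) \<noteq> 0"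
  shows "(\<Sum>k\<in>mbox r n. sum_term q r n a b x k) = (\<Prod>i=1..r. rhs_factor q a b (x i) (n i))"
proof -
  obtain t where t: "t \<longlonglongrightarrow> 1" and t0: "\<And>m. t m \<noteq> 0"
    and g: "\<And>m. generic q r (a * t m) (\<lambda>i. x i * t m ^ (3 * i))"
    using generic_perturbation[OF q a, of r x] x by blast
  have A: "(\<lambda>m. a * t m) \<longlonglongrightarrow> a" using tendsto_mult[OF tendsto_const[of a] t] by simp
  have X: "(\<lambda>m. x i * t m ^ (3 * i)) \<longlonglongrightarrow> x i" for i
    using tendsto_mult[OF tendsto_const[of "x i"] tendsto_power[OF t, of "3 * i"]] by simp
  have A0: "a * t m \<noteq> 0" for m using a t0 by simp
  have X0: "x i * t m ^ (3 * i) \<noteq> 0" if "i \<in> {1..r}" for i m using x[OF that] t0 by simp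
  have eq: "(\<Sum>k\<in>mbox r n. sum_term q r n (a * t m) b (\<lambda>i. x i * t m ^ (3 * i)) k)
      = (\<Prod>i=1..r. rhs_factor q (a * t m) b (x i * t m ^ (3 * i)) (n i))" for m
    by (rule generic_sum[OF q gI A0 X0 g b])
  have "(\<lambda>m. \<Sum>k\<in>mbox r n. sum_term q r n (a * t m) b (\<lambda>i. x i * t m ^ (3 * i)) k)
      \<longlonglongrightarrow> (\<Sum>k\<in>mbox r n. sum_term q r n a b x k)"
    unfolding sum_term_def
  proof (intro tendsto_sum tendsto_mult tendsto_prod)
    fix k i j assume k: "k \<in> mbox r n" and i: "i \<in> {1..r}" and j: "j \<in> {i+1..r}"
    have j': "j \<in> {1..r}" using i j by auto
    show "(\<lambda>m. cross_factor q (x i * t m ^ (3 * i)) (x j * t m ^ (3 * j)) (n i) (n j) (k i) (k j))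
        \<longlonglongrightarrow> cross_factor q (x i) (x j) (n i) (n j) (k i) (k j)"
      by (rule cross_factor_tendsto[OF q X X x[OF i] x[OF j'] X0[OF i] X0[OF j'] d1[OF i j] d2[OF k i j]
            d3[OF k i j'] d3[OF k j' i]])
  next
    fix k i assume k: "k \<in> mbox r n" and i: "i \<in> {1..r}"
    show "(\<lambda>m. single_factor q (a * t m) b (x i * t m ^ (3 * i)) (n i) (k i) (vsize r k))
        \<longlonglongrightarrow> single_factor q a b (x i) (n i) (k i) (vsize r k)"
      by (rule single_factor_tendsto[OF q A X a b x[OF i] A0 X0[OF i] d4[OF i] d5[OF k i] d6[OF k i] d7[OF k i]])
    have "efac (q\<^sup>2) (q powi 2) 0 (k i) \<noteq> 0" using d3[OF k i i] x[OF i] by simp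
    then show "(\<lambda>m. diag_factor q (x i * t m ^ (3 * i)) (n i) (k i)) \<longlonglongrightarrow> diag_factor q (x i) (n i) (k i)"
      by (rule diag_factor_tendsto[OF q X x[OF i] X0[OF i]])
  next
    fix k assume "k \<in> mbox r n"
    show "(\<lambda>m. global_factor q (a * t m) b (vsize r k)) \<longlonglongrightarrow> global_factor q a b (vsize r k)"
      by (rule global_factor_tendsto[OF q A a A0])
  qed
  moreover have "(\<lambda>m. \<Prod>i=1..r. rhs_factor q (a * t m) b (x i * t m ^ (3 * i)) (n i))
      \<longlonglongrightarrow> (\<Prod>i=1..r. rhs_factor q a b (x i) (n i))"
    by (intro tendsto_prod) (rule rhs_factor_tendsto[OF q A X a b x A0 X0 d8])
  ultimately show ?thesis unfolding eq by (rule LIMSEQ_unique)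
qed

section \<open>Return to the notation of the theorem\<close>

lemma ell_fac_single: "ell_fac [c] u p k = efac u c 0 k"
  by (simp add: ell_fac_def efac_def)

lemma ell_fac_pair: "ell_fac [c, d] u p k = efac u c 0 k * efac u d 0 k"
  by (simp add: ell_fac_def efac_def)

lemma efac_split:
  assumes "u \<noteq> 0" "k \<le> n"
  shows "efac u c 0 n = efac u c 0 k * efac u (c * u powi int k) 0 (n - k)"
  using efac_add[of u c 0 k "n - k"] efac_shift[OF assms(1), of c "int k" 0 "n - k"] assms(2) by simp

text \<open>Distributes the power with exponent -e_2(k) over the pairs, so that each
  \<open>cross_factor\<close> receives its share.\<close>

lemma powi_e2:
  fixes q :: complex
  assumes "q \<noteq> 0"
  shows "q powi (int N - int (e2 r k)) = q powi int N * (\<Prod>i=1..r. \<Prod>j=i+1..r. q powi (- (int (k i) * int (k j))))"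
proof -
  have s: "q powi (- int (\<Sum>i\<in>I. f i)) = (\<Prod>i\<in>I. q powi (- int (f i)))" if "finite I" for I and f :: "nat \<Rightarrow> nat"
    using that
  proof (induction I)
    case (insert i I)
    have "- int (sum f (insert i I)) = - int (f i) + - int (sum f I)" using insert by simp
    moreover have "q powi (- int (f i) + - int (sum f I)) = q powi (- int (f i)) * q powi (- int (sum f I))"
      by (rule power_int_add) (use assms in simp)
    ultimately show ?case using insert by (simp only: prod.insert[OF insert.hyps])
  qed simp
  have "q powi (- int (e2 r k)) = (\<Prod>i=1..r. \<Prod>j=i+1..r. q powi (- int (k i * k j)))"
    unfolding e2_def by (simp only: s finite_atLeastAtMost)
  then have "q powi (- int (e2 r k)) = (\<Prod>i=1..r. \<Prod>j=i+1..r. q powi (- (int (k i) * int (k j))))"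
    by (simp only: of_nat_mult)
  moreover have "q powi (int N - int (e2 r k)) = q powi int N * q powi (- int (e2 r k))"
    by (subst power_int_add[symmetric]) (use assms in simp_all)
  ultimately show ?thesis by simp
qed

text \<open>A regrouping by pairs, single indices and |k|. In the double product over i and j the
  diagonal gives \<open>diag_factor\<close>, while (i, j) and (j, i) are combined and go to
  \<open>cross_factor\<close>.\<close>

lemma summand_eq_sum_term:
  fixes n k :: "nat \<Rightarrow> nat" and x :: "nat \<Rightarrow> complex"
  assumes q: "q \<noteq> 0" and x: "\<And>i. i \<in> {1..r} \<Longrightarrow> x i \<noteq> 0"
    and k: "k \<in> mbox r n"
    and den_ab: "\<And>i. i \<in> {1..r} \<Longrightarrow> ell_fac [a * b * x i * q, a * x i * q\<^sup>2 / b] (q\<^sup>2) p (k i) \<noteq> 0"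
    and den_ab_n: "\<And>i. i \<in> {1..r} \<Longrightarrow> ell_fac [a * b * x i * q, a * x i * q\<^sup>2 / b] (q\<^sup>2) p (n i) \<noteq> 0"
  shows "Delta r (\<lambda>i. x i * q ^ (2 * k i)) p / Delta r x p
        * q powi (int (vsize r k) - int (e2 r k))
        * (\<Prod>i=1..r. \<Prod>j=i+1..r. 1 / ell_fac [x i * x j] (q\<^sup>2) p (k i + k j))
        * (\<Prod>i=1..r.
             theta (a * x i * q ^ (2 * k i + vsize r k)) p / theta (a * x i) p
             * (ell_fac [a * x i] q p (vsize r k)
                  * ell_fac [a * q / x i] q p (vsize r k - k i)
                / (ell_fac [a * x i * q ^ (2 * n i + 1),
                            a * q powi (1 - 2 * int (n i)) / x i] q p (vsize r k)
                  * ell_fac [q powi (int (k i) - int (vsize r k)) * x i / a] q p (k i))))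
        * (ell_fac [a\<^sup>2 * q] (q\<^sup>2) p (vsize r k) * ell_fac [b, q / b] q p (vsize r k)
           / (\<Prod>i=1..r. ell_fac [a * b * x i * q, a * x i * q\<^sup>2 / b] (q\<^sup>2) p (k i)))
        * (\<Prod>i=1..r. \<Prod>j=1..r.
             ell_fac [q powi (- 2 * int (n j)) * x i / x j,
                      x i * x j * q ^ (2 * n j)] (q\<^sup>2) p (k i)
             / ell_fac [q\<^sup>2 * x i / x j] (q\<^sup>2) p (k i))
     = sum_term q r n a b x k
        / (\<Prod>i=1..r. ell_fac [a * b * x i * q, a * x i * q\<^sup>2 / b] (q\<^sup>2) p (n i))"
proof -
  let ?v = "q\<^sup>2" and ?N = "vsize r k"
  define D where "D i m = ell_fac [a * b * x i * q, a * x i * q\<^sup>2 / b] ?v p m" for i m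
  define E where "E i = efac ?v (a * b * x i * q powi (1 + 2 * int (k i))) 0 (n i - k i)
     * efac ?v (a * x i / b * q powi (2 + 2 * int (k i))) 0 (n i - k i)" for i
  define S where "S i = theta (a * x i * q ^ (2 * k i + ?N)) p / theta (a * x i) p
             * (ell_fac [a * x i] q p ?N * ell_fac [a * q / x i] q p (?N - k i)
                / (ell_fac [a * x i * q ^ (2 * n i + 1), a * q powi (1 - 2 * int (n i)) / x i] q p ?N
                  * ell_fac [q powi (int (k i) - int ?N) * x i / a] q p (k i)))" for i
  define F where "F i j = ell_fac [q powi (- 2 * int (n j)) * x i / x j, x i * x j * q ^ (2 * n j)] ?v p (k i)
             / ell_fac [?v * x i / x j] ?v p (k i)" for i j
  define T where "T i j = x j * q ^ (2 * k j) * theta (x i * q ^ (2 * k i) / (x j * q ^ (2 * k j))) p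
      / (x j * theta (x i / x j) p)" for i j
  define V where "V i j = 1 / ell_fac [x i * x j] ?v p (k i + k j)" for i j
  define g1 where "g1 = ell_fac [a\<^sup>2 * q] ?v p ?N * ell_fac [b, q / b] q p ?N"
  have v: "?v \<noteq> 0" using q by simp
  have nat_pow: "q ^ m = q powi int m" for m by simp
  \<comment> \<open>The tails E replace the denominators of index k_i by those of index n_i, which
    are common to all summands.\<close>
  have DE: "D i (n i) = D i (k i) * E i" if i: "i \<in> {1..r}" for i
  proof -
    have kn: "k i \<le> n i" using k i by (auto simp: mbox_def)
    have e: "a * b * x i * q * ?v powi int (k i) = a * b * x i * q powi (1 + 2 * int (k i))"
      "a * x i * q\<^sup>2 / b * ?v powi int (k i) = a * x i / b * q powi (2 + 2 * int (k i))"
      using q unfolding powi_sq by (simp_all add: power_int_add)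
    show ?thesis unfolding D_def E_def ell_fac_pair efac_split[OF v kn] e by (simp only: mult_ac)
  qed
  have Dprod: "(\<Prod>i=1..r. D i (n i)) = (\<Prod>i=1..r. D i (k i)) * (\<Prod>i=1..r. E i)"
    by (simp add: DE flip: prod.distrib)
  have Dk: "(\<Prod>i=1..r. D i (k i)) \<noteq> 0" using den_ab by (simp add: D_def)
  have Delta: "Delta r (\<lambda>i. x i * q ^ (2 * k i)) p / Delta r x p = (\<Prod>i=1..r. \<Prod>j=i+1..r. T i j)"
    unfolding Delta_def T_def by (simp only: prod_dividef)
  have cross: "cross_factor q (x i) (x j) (n i) (n j) (k i) (k j)
      = T i j * q powi (- (int (k i) * int (k j))) * V i j * (F i j * F j i)"
    if i: "i \<in> {1..r}" and j: "j \<in> {i+1..r}" for i j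
  proof -
    have xi: "x i \<noteq> 0" and xj: "x j \<noteq> 0" using x i j by auto
    have t: "T i j = th (x i / x j * q powi (2 * int (k i) - 2 * int (k j))) * q powi (2 * int (k j)) / th (x i / x j)"
    proof -
      have "x i * q ^ (2 * k i) / (x j * q ^ (2 * k j)) = x i / x j * q powi (2 * int (k i) - 2 * int (k j))"
        using q unfolding nat_pow by (simp add: power_int_diff)
      moreover have "q ^ (2 * k j) = q powi (2 * int (k j))" unfolding nat_pow by simp
      ultimately show ?thesis using xj unfolding T_def by simp
    qed
    have f: "F i j = efac ?v (x i / x j * q powi (- 2 * int (n j))) 0 (k i) * efac ?v (x i * x j * q powi (2 * int (n j))) 0 (k i)
        / efac ?v (x i / x j * q powi 2) 0 (k i)" for i j
      unfolding F_def ell_fac_pair ell_fac_single nat_pow by (simp add: mult_ac)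
    have c: "x j * x i = x i * x j" by simp
    show ?thesis unfolding cross_factor_def t f V_def ell_fac_single c by (simp add: mult_ac)
  qed
  have single: "single_factor q a b (x i) (n i) (k i) ?N = S i * E i" for i
  proof -
    have "q ^ (2 * k i + ?N) = q powi (2 * int (k i) + int ?N)" "q ^ (2 * n i + 1) = q powi (2 * int (n i) + 1)"
      "a * q / x i = a / x i * q powi 1" "a * q powi (1 - 2 * int (n i)) / x i = a / x i * q powi (1 - 2 * int (n i))"
      "q powi (int (k i) - int ?N) * x i / a = x i / a * q powi (int (k i) - int ?N)"
      unfolding nat_pow by (simp_all add: add.commute)
    then show ?thesis
      unfolding single_factor_def S_def E_def ell_fac_pair ell_fac_single by (simp add: mult_ac)
  qed
  have diag: "diag_factor q (x i) (n i) (k i) = F i i" if i: "i \<in> {1..r}" for i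
  proof -
    have "q powi (- 2 * int (n i)) * x i / x i = q powi (- 2 * int (n i))"
      "x i * x i * q ^ (2 * n i) = (x i)\<^sup>2 * q powi (2 * int (n i))" "?v * x i / x i = q powi 2"
      using x[OF i] unfolding nat_pow by (simp_all add: power2_eq_square)
    then show ?thesis unfolding diag_factor_def F_def ell_fac_pair ell_fac_single by (simp only:)
  qed
  have global: "global_factor q a b ?N = q powi int ?N * g1"
    unfolding global_factor_def g1_def ell_fac_pair ell_fac_single by (simp only: mult_ac)
  have "sum_term q r n a b x k = (\<Prod>i=1..r. \<Prod>j=i+1..r. T i j) * (\<Prod>i=1..r. \<Prod>j=i+1..r. q powi (- (int (k i) * int (k j))))
      * (\<Prod>i=1..r. \<Prod>j=i+1..r. V i j) * (\<Prod>i=1..r. \<Prod>j=i+1..r. F i j * F j i)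
      * ((\<Prod>i=1..r. S i) * (\<Prod>i=1..r. E i) * (\<Prod>i=1..r. F i i)) * (q powi int ?N * g1)"
  proof -
    have 1: "(\<Prod>i=1..r. \<Prod>j=i+1..r. cross_factor q (x i) (x j) (n i) (n j) (k i) (k j))
      = (\<Prod>i=1..r. \<Prod>j=i+1..r. T i j * q powi (- (int (k i) * int (k j))) * V i j * (F i j * F j i))"
      by (intro prod.cong refl cross)
    have 2: "(\<Prod>i=1..r. single_factor q a b (x i) (n i) (k i) ?N * diag_factor q (x i) (n i) (k i))
      = (\<Prod>i=1..r. S i * E i * F i i)"
      by (intro prod.cong refl) (simp only: single diag)
    show ?thesis unfolding sum_term_def 1 2 global by (simp only: prod.distrib)
  qed
  moreover have "(\<Prod>i=1..r. E i) \<noteq> 0"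
  proof -
    have "(\<Prod>i=1..r. D i (n i)) \<noteq> 0" using den_ab_n by (simp add: D_def)
    then show ?thesis unfolding Dprod by simp
  qed
  moreover have "A * (u * U) * V' * S' * (g / d) * (Fd * FF) = A * U * V' * FF * (S' * e * Fd) * (u * g) / (d * e)"
    if "d \<noteq> 0" "e \<noteq> 0" for A u U V' S' g d e Fd FF :: complex
    using that by simp
  ultimately show ?thesis
    unfolding S_def[symmetric] F_def[symmetric] D_def[symmetric] V_def[symmetric] g1_def[symmetric]
      Delta powi_e2[OF q] prod_diag_pairs Dprod
    using Dk by simp
qed

end

theorem theorem4p7:
  fixes p q a b :: complex
    and r :: nat
    and n :: "nat \<Rightarrow> nat"
    and x :: "nat \<Rightarrow> complex"
  assumes p: "norm p < 1"
    and q: "q \<noteq> 0"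
    and pq: "\<And>(k::nat) (m::int). k > 0 \<Longrightarrow> q ^ k \<noteq> p powi m"
    and r: "r \<ge> 1"
    and nz: "a \<noteq> 0" "b \<noteq> 0" "\<And>i. i \<in> {1..r} \<Longrightarrow> x i \<noteq> 0"
    \<comment> \<open>Genericity: none of the denominators occurring in the identity vanishes.\<close>
    and den_Delta: "Delta r x p \<noteq> 0"
    and den_pairs: "\<And>k i j. k \<in> mbox r n \<Longrightarrow> 1 \<le> i \<Longrightarrow> i < j \<Longrightarrow> j \<le> r \<Longrightarrow>
          ell_fac [x i * x j] (q\<^sup>2) p (k i + k j) \<noteq> 0"
    and den_theta: "\<And>i. i \<in> {1..r} \<Longrightarrow> theta (a * x i) p \<noteq> 0"
    and den_n: "\<And>k i. k \<in> mbox r n \<Longrightarrow> i \<in> {1..r} \<Longrightarrow>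
          ell_fac [a * x i * q ^ (2 * n i + 1), a * q powi (1 - 2 * int (n i)) / x i] q p
            (vsize r k) \<noteq> 0"
    and den_k: "\<And>k i. k \<in> mbox r n \<Longrightarrow> i \<in> {1..r} \<Longrightarrow>
          ell_fac [q powi (int (k i) - int (vsize r k)) * x i / a] q p (k i) \<noteq> 0"
    and den_ab: "\<And>k i. k \<in> mbox r n \<Longrightarrow> i \<in> {1..r} \<Longrightarrow>
          ell_fac [a * b * x i * q, a * x i * q\<^sup>2 / b] (q\<^sup>2) p (k i) \<noteq> 0"
    and den_ij: "\<And>k i j. k \<in> mbox r n \<Longrightarrow> i \<in> {1..r} \<Longrightarrow> j \<in> {1..r} \<Longrightarrow>
          ell_fac [q\<^sup>2 * x i / x j] (q\<^sup>2) p (k i) \<noteq> 0"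
    and den_rhs: "\<And>i. i \<in> {1..r} \<Longrightarrow>
          ell_fac [x i / a] q p (2 * n i)
            * ell_fac [a * b * x i * q, a * x i * q\<^sup>2 / b] (q\<^sup>2) p (n i) \<noteq> 0"
  shows
    "(\<Sum>k\<in>mbox r n.
        Delta r (\<lambda>i. x i * q ^ (2 * k i)) p / Delta r x p
        * q powi (int (vsize r k) - int (e2 r k))
        * (\<Prod>i=1..r. \<Prod>j=i+1..r. 1 / ell_fac [x i * x j] (q\<^sup>2) p (k i + k j))
        * (\<Prod>i=1..r.
             theta (a * x i * q ^ (2 * k i + vsize r k)) p / theta (a * x i) p
             * (ell_fac [a * x i] q p (vsize r k)
                  * ell_fac [a * q / x i] q p (vsize r k - k i)
                / (ell_fac [a * x i * q ^ (2 * n i + 1),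
                            a * q powi (1 - 2 * int (n i)) / x i] q p (vsize r k)
                  * ell_fac [q powi (int (k i) - int (vsize r k)) * x i / a] q p (k i))))
        * (ell_fac [a\<^sup>2 * q] (q\<^sup>2) p (vsize r k) * ell_fac [b, q / b] q p (vsize r k)
           / (\<Prod>i=1..r. ell_fac [a * b * x i * q, a * x i * q\<^sup>2 / b] (q\<^sup>2) p (k i)))
        * (\<Prod>i=1..r. \<Prod>j=1..r.
             ell_fac [q powi (- 2 * int (n j)) * x i / x j,
                      x i * x j * q ^ (2 * n j)] (q\<^sup>2) p (k i)
             / ell_fac [q\<^sup>2 * x i / x j] (q\<^sup>2) p (k i)))
     = (\<Prod>i=1..r.
          ell_fac [a * x i * q] q p (2 * n i)
            * ell_fac [x i * q / (a * b), b * x i / a] (q\<^sup>2) p (n i)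
          / (ell_fac [x i / a] q p (2 * n i)
            * ell_fac [a * b * x i * q, a * x i * q\<^sup>2 / b] (q\<^sup>2) p (n i)))"
proof -
  interpret elliptic_nome p by unfold_locales (rule p)
  \<comment> \<open>The location of the zeros of theta turns the hypothesis on p and q into the
    non-vanishing used in the induction.\<close>
  have gI: "th (q powi j) \<noteq> 0" if j: "j > 0" for j
  proof
    assume "th (q powi j) = 0"
    then obtain l where l: "q powi j = p powi l" using theta_eq_0D[OF p, of "q powi j"] q by auto
    moreover have "q powi j = q ^ nat j" using j by (simp add: power_int_def)
    ultimately show False using pq[of "nat j" l] j by simp
  qed
  define D where "D i = ell_fac [a * b * x i * q, a * x i * q\<^sup>2 / b] (q\<^sup>2) p (n i)" for i
  have nat_pow: "q ^ m = q powi int m" for m by simp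
  have "(\<Sum>k\<in>mbox r n. sum_term q r n a b x k) = (\<Prod>i=1..r. rhs_factor q a b (x i) (n i))"
  proof (rule sum_identity[OF q gI nz(1,2,3)])
    show "th (x i / x j) \<noteq> 0" if "i \<in> {1..r}" "j \<in> {i+1..r}" for i j
      using den_Delta that unfolding Delta_def by (auto simp: prod_zero_iff)
    show "efac (q\<^sup>2) (x i * x j) 0 (k i + k j) \<noteq> 0"
      if "k \<in> mbox r n" "i \<in> {1..r}" "j \<in> {i+1..r}" for k i j
      using den_pairs[OF that(1), of i j] that unfolding ell_fac_single by auto
    show "efac (q\<^sup>2) (x i / x j * q powi 2) 0 (k i) \<noteq> 0"
      if "k \<in> mbox r n" "i \<in> {1..r}" "j \<in> {1..r}" for k i j
      using den_ij[OF that] unfolding ell_fac_single by (simp add: mult.commute)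
    show "th (a * x i) \<noteq> 0" if "i \<in> {1..r}" for i by (rule den_theta[OF that])
    show "efac q (a * x i * q powi (2 * int (n i) + 1)) 0 (vsize r k) \<noteq> 0"
      "efac q (a / x i * q powi (1 - 2 * int (n i))) 0 (vsize r k) \<noteq> 0"
      if "k \<in> mbox r n" "i \<in> {1..r}" for k i
      using den_n[OF that] unfolding ell_fac_pair nat_pow by (simp_all add: add.commute)
    show "efac q (x i / a * q powi (int (k i) - int (vsize r k))) 0 (k i) \<noteq> 0"
      if "k \<in> mbox r n" "i \<in> {1..r}" for k i
      using den_k[OF that] unfolding ell_fac_single by (simp add: mult.commute)
    show "efac q (x i / a) 0 (2 * n i) \<noteq> 0" if "i \<in> {1..r}" for i
      using den_rhs[OF that] unfolding ell_fac_single by simp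
  qed
  \<comment> \<open>Division by the denominators of index n_i, which do not depend on k, undoes the
    clearing of denominators.\<close>
  then have sum: "(\<Sum>k\<in>mbox r n. sum_term q r n a b x k / (\<Prod>i=1..r. D i))
      = (\<Prod>i=1..r. rhs_factor q a b (x i) (n i) / D i)"
    by (simp add: prod_dividef flip: sum_divide_distrib)
  have rhs: "rhs_factor q a b (x i) (n i) / D i = ell_fac [a * x i * q] q p (2 * n i)
            * ell_fac [x i * q / (a * b), b * x i / a] (q\<^sup>2) p (n i)
          / (ell_fac [x i / a] q p (2 * n i) * D i)" for i
    unfolding rhs_factor_def ell_fac_pair ell_fac_single by simp
  show ?thesis
    unfolding D_def[symmetric] rhs[symmetric] sum[symmetric]
    unfolding D_def
    by (rule sum.cong[OF refl], rule summand_eq_sum_term[OF q nz(3) _ den_ab])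
       (use den_rhs in auto)
qed

end
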